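(* Consider a GB problem whose intersection graph has tree-width $\le\omega$, and let $(T,Q)$ be a tree-decomposition of the intersection graph of width $\le\omega$. (a) There is an exact linear programming formulation with $O(2^\omega n)$ variables and constraints, with $\{0,1,-1\}$-valued constraint coefficients. (b) The formulation can be constructed by performing $2^{\omega}m$ oracle queries and with additional workload $$O^*\Big(\omega2^\omega\sum_{t\in V(T)}|\{i: K[i]\subseteq Q_t\}|+\omega mn\Big)=O^*\big(\omega2^\omega mn+\omega^22^\omega n\big),$$ where the "$*$" notation indicates logarithmic factors in $m$ or $n$.
   Context: Problem GB ("general binary"): there are $n$ variables and $m$ constraints. For $1\le i\le m$, constraint $i$ is given by a subset $K[i]\subseteq\{1,\dots,n\}$ and a set $S^i\subseteq\{0,1\}^{K[i]}$, the latter given implicitly by a membership oracle which, on input $y\in\{0,1\}^{K[i]}$, truthfully reports whether $y\in S^i$. The problem is to minimize a linear function $c^Tx$ over $x\in\{0,1\}^n$ subject to $x_{K[i]}\in S^i$ for $1\le i\le m$, where $x_{K[i]}$ is the subvector indexed by $K[i]$. The intersection graph has vertex set $\{1,\dots,n\}$ and an edge $\{j,k\}$ whenever $\{j,k\}\subseteq K[i]$ for some $i$. A tree-decomposition of a graph $G$ is a pair $(T,Q)$ with $T$ a tree and $Q=\{Q_t:t\in V(T)\}$ a family of subsets of $V(G)$ such that for each $v\in V(G)$ the set $\{t: v\in Q_t\}$ forms a subtree of $T$, and each edge of $G$ is contained in some $Q_t$. Its width is $\max_t|Q_t|-1$; the tree-width of $G$ is the minimum width of a tree-decomposition. An exact linear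 programming formulation is a (continuous) linear program, possibly with additional variables, having $n$ designated variables representing $x_1,\dots,x_n$, with objective $c^Tx$ in these variables, and such that the projection of its feasible region onto them is the convex hull of the feasible solutions of GB.
   Formalization: The query bound is 2^(ω+1)m, since K[i] may have ω+1 elements and 2^ω m queries can be too few; in the workload bounds the factor ω is max(1,ω), the m in ωmn is max(1,m), n is max(n,|V(T)|), as the stated bounds fail for ω=0, m=0 or large T; n≥1 is assumed. *)

theory Defs
  imports "HOL-Analysis.Convex" "HOL-Library.FuncSet" "HOL-Library.Function_Algebras"
begin

text \<open>Points of \<open>\<real>\<^sup>I\<close> are functions in \<^term>\<open>I \<rightarrow>\<^sub>E UNIV\<close>. The pointwise vector space structure below
  makes the library's \<^const>\<open>hull\<close> with \<^const>\<open>convex\<close> available for them. Affine combinations of such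
  extensional functions are again extensional, so the value \<^term>\<open>undefined\<close> outside \<open>I\<close> does not
  interfere with convex hulls.\<close>

instantiation "fun" :: (type, real_vector) real_vector
begin

definition scaleR_fun :: "real \<Rightarrow> ('a \<Rightarrow> 'b) \<Rightarrow> 'a \<Rightarrow> 'b" where
  "scaleR_fun r f = (\<lambda>x. r *\<^sub>R f x)"

instance
  by standard (simp_all add: scaleR_fun_def fun_eq_iff scaleR_add_right scaleR_add_left)

end


section \<open>Graphs, tree-decompositions, tree-width\<close>

text \<open>A simple graph is given by a vertex set and a set of two-element vertex sets.\<close>

definition induces_connected :: "'a set set \<Rightarrow> 'a set \<Rightarrow> bool" where
  "induces_connected E U \<longleftrightarrow> U \<noteq> {} \<and>
     (\<forall>u\<in>U. \<forall>v\<in>U. (u, v) \<in> {(a, b). a \<in> U \<and> b \<in> U \<and> {a, b} \<in> E}\<^sup>*)"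

definition has_cycle :: "'a set set \<Rightarrow> bool" where
  "has_cycle E \<longleftrightarrow> (\<exists>cs. length cs \<ge> 3 \<and> distinct cs \<and>
     (\<forall>i<length cs. {cs ! i, cs ! (Suc i mod length cs)} \<in> E))"

definition is_tree :: "'a set \<Rightarrow> 'a set set \<Rightarrow> bool" where
  "is_tree V E \<longleftrightarrow> finite V \<and> E \<subseteq> {{s, t} | s t. s \<in> V \<and> t \<in> V \<and> s \<noteq> t} \<and>
     induces_connected E V \<and> \<not> has_cycle E"

text \<open>Arguments: the graph \<open>(V, E)\<close>, the tree \<open>(VT, ET)\<close> and the bags \<open>Q\<close>. A vertex subset of a tree spans a
  subtree iff it is nonempty and induces a connected subgraph.\<close>

definition tree_decomposition ::
  "'a set \<Rightarrow> 'a set set \<Rightarrow> nat set \<Rightarrow> nat set set \<Rightarrow> (nat \<Rightarrow> 'a set) \<Rightarrow> bool" where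
  "tree_decomposition V E VT ET Q \<longleftrightarrow> is_tree VT ET \<and>
     (\<forall>t\<in>VT. Q t \<subseteq> V) \<and>
     (\<forall>v\<in>V. induces_connected ET {t \<in> VT. v \<in> Q t}) \<and>
     (\<forall>e\<in>E. \<exists>t\<in>VT. e \<subseteq> Q t)"

text \<open>The truncated subtraction is harmless for a graph with at least one vertex, where the
  maximum is positive.\<close>

definition td_width :: "nat set \<Rightarrow> (nat \<Rightarrow> 'a set) \<Rightarrow> nat" where
  "td_width VT Q = Max ((\<lambda>t. card (Q t)) ` VT) - 1"

definition treewidth :: "'a set \<Rightarrow> 'a set set \<Rightarrow> nat" where
  "treewidth V E = (LEAST w. \<exists>VT ET Q. tree_decomposition V E VT ET Q \<and> td_width VT Q = w)"


section \<open>General binary problems\<close>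

text \<open>Minimize \<open>\<Sum>j=1..n. c j * x j\<close> over \<open>x \<in> {0,1}\<^sup>n\<close> such that the subvector of \<open>x\<close> indexed by
  \<open>K i\<close> lies in \<open>S i\<close>, for \<open>i = 1, \<dots>, m\<close>.\<close>

record gb =
  gb_n :: nat
  gb_m :: nat
  gb_K :: "nat \<Rightarrow> nat set"
  gb_S :: "nat \<Rightarrow> (nat \<Rightarrow> real) set"
  gb_c :: "nat \<Rightarrow> real"

definition gb_problem :: "gb \<Rightarrow> bool" where
  "gb_problem P \<longleftrightarrow> gb_n P \<ge> 1 \<and>
     (\<forall>i\<in>{1..gb_m P}. gb_K P i \<subseteq> {1..gb_n P} \<and> gb_S P i \<subseteq> (gb_K P i \<rightarrow>\<^sub>E {0, 1}))"

definition gb_feasible :: "gb \<Rightarrow> (nat \<Rightarrow> real) set" where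
  "gb_feasible P = {x \<in> {1..gb_n P} \<rightarrow>\<^sub>E {0, 1}.
     \<forall>i\<in>{1..gb_m P}. restrict x (gb_K P i) \<in> gb_S P i}"

definition ig_vertices :: "gb \<Rightarrow> nat set" where
  "ig_vertices P = {1..gb_n P}"

definition ig_edges :: "gb \<Rightarrow> nat set set" where
  "ig_edges P = {{j, k} | j k. j \<noteq> k \<and> (\<exists>i\<in>{1..gb_m P}. {j, k} \<subseteq> gb_K P i)}"


section \<open>Linear programs\<close>

datatype sense = LE | EQ | GE

fun sense_holds :: "sense \<Rightarrow> real \<Rightarrow> real \<Rightarrow> bool" where
  "sense_holds LE a b \<longleftrightarrow> a \<le> b"
| "sense_holds EQ a b \<longleftrightarrow> a = b"
| "sense_holds GE a b \<longleftrightarrow> a \<ge> b"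

record lp_row =
  row_coeff :: "nat \<Rightarrow> real"
  row_sense :: sense
  row_rhs :: real

text \<open>A minimization problem in the real variables numbered \<open>1, \<dots>, lp_nvars\<close>. All restrictions on
  the variables, nonnegativity and bounds included, are rows.\<close>

record lp =
  lp_nvars :: nat
  lp_obj :: "nat \<Rightarrow> real"
  lp_rows :: "lp_row list"

definition lp_feasible :: "lp \<Rightarrow> (nat \<Rightarrow> real) set" where
  "lp_feasible L = {z \<in> {1..lp_nvars L} \<rightarrow>\<^sub>E UNIV. \<forall>r\<in>set (lp_rows L).
     sense_holds (row_sense r) (\<Sum>j=1..lp_nvars L. row_coeff r j * z j) (row_rhs r)}"

text \<open>The first \<open>n\<close> variables are the designated ones.\<close>

definition exact_formulation :: "gb \<Rightarrow> lp \<Rightarrow> bool" where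
  "exact_formulation P L \<longleftrightarrow> gb_n P \<le> lp_nvars L \<and>
     (\<forall>j\<in>{1..gb_n P}. lp_obj L j = gb_c P j) \<and>
     (\<forall>j\<in>{gb_n P<..lp_nvars L}. lp_obj L j = 0) \<and>
     (\<lambda>z. restrict z {1..gb_n P}) ` lp_feasible L = convex hull (gb_feasible P)"

definition lp_size_le :: "lp \<Rightarrow> real \<Rightarrow> bool" where
  "lp_size_le L b \<longleftrightarrow> real (lp_nvars L) \<le> b \<and> real (length (lp_rows L)) \<le> b"

definition unit_coefficients :: "lp \<Rightarrow> bool" where
  "unit_coefficients L \<longleftrightarrow>
     (\<forall>r\<in>set (lp_rows L). \<forall>j\<in>{1..lp_nvars L}. row_coeff r j \<in> {0, 1, -1})"


section \<open>Oracle random access machines\<close>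

text \<open>Programs for a random access machine with finitely many integer registers and finitely many
  unbounded integer arrays, presented as structured programs, with an append-only output and an
  oracle. Arithmetic is restricted to addition and subtraction, so that the unit cost criterion is
  the usual one. Every assignment, store, output, oracle call and test costs one time
  unit; the expressions occurring in a fixed program have constant size.\<close>

datatype expr =
    Const int
  | Reg string
  | Fetch string expr
  | Add expr expr
  | Sub expr expr

datatype test = Less expr expr | Equal expr expr | Neg test | Conj test test

text \<open>\<open>Query x e a\<close> asks the oracle about the constraint with index \<open>e\<close> and the assignment stored in array
  \<open>a\<close>; the answer, 0 or 1, is put into register \<open>x\<close>.\<close>

datatype prog =
    Assign string expr
  | Store string expr expr
  | Emit expr
  | Query string expr string
  | Seq prog prog
  | Cond test prog prog
  | While test prog

record state =
  regs :: "string \<Rightarrow> int"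
  arrs :: "string \<Rightarrow> int \<Rightarrow> int"
  outp :: "int list"

fun eval_expr :: "expr \<Rightarrow> state \<Rightarrow> int" where
  "eval_expr (Const k) s = k"
| "eval_expr (Reg x) s = regs s x"
| "eval_expr (Fetch a e) s = arrs s a (eval_expr e s)"
| "eval_expr (Add e f) s = eval_expr e s + eval_expr f s"
| "eval_expr (Sub e f) s = eval_expr e s - eval_expr f s"

fun eval_test :: "test \<Rightarrow> state \<Rightarrow> bool" where
  "eval_test (Less e f) s \<longleftrightarrow> eval_expr e s < eval_expr f s"
| "eval_test (Equal e f) s \<longleftrightarrow> eval_expr e s = eval_expr f s"
| "eval_test (Neg b) s \<longleftrightarrow> \<not> eval_test b s"
| "eval_test (Conj b d) s \<longleftrightarrow> eval_test b s \<and> eval_test d s"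

definition set_reg :: "string \<Rightarrow> int \<Rightarrow> state \<Rightarrow> state" where
  "set_reg x k s = s\<lparr>regs := (regs s)(x := k)\<rparr>"

text \<open>\<open>exec orc p s t q s'\<close>: with oracle \<open>orc\<close>, program \<open>p\<close> started in \<open>s\<close> halts in \<open>s'\<close> after \<open>t\<close> time units and
  \<open>q\<close> oracle calls.\<close>

inductive exec ::
  "(int \<Rightarrow> (int \<Rightarrow> int) \<Rightarrow> bool) \<Rightarrow> prog \<Rightarrow> state \<Rightarrow> nat \<Rightarrow> nat \<Rightarrow> state \<Rightarrow> bool"
  for orc where
  exec_Assign: "exec orc (Assign x e) s 1 0 (set_reg x (eval_expr e s) s)"
| exec_Store: "exec orc (Store a e f) s 1 0
    (s\<lparr>arrs := (arrs s)(a := (arrs s a)(eval_expr e s := eval_expr f s))\<rparr>)"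
| exec_Emit: "exec orc (Emit e) s 1 0 (s\<lparr>outp := outp s @ [eval_expr e s]\<rparr>)"
| exec_Query: "exec orc (Query x e a) s 1 1
    (set_reg x (if orc (eval_expr e s) (arrs s a) then 1 else 0) s)"
| exec_Seq: "exec orc p s t q s' \<Longrightarrow> exec orc p' s' t' q' s'' \<Longrightarrow>
    exec orc (Seq p p') s (t + t') (q + q') s''"
| exec_CondTrue: "eval_test b s \<Longrightarrow> exec orc p s t q s' \<Longrightarrow> exec orc (Cond b p p') s (t + 1) q s'"
| exec_CondFalse: "\<not> eval_test b s \<Longrightarrow> exec orc p' s t q s' \<Longrightarrow> exec orc (Cond b p p') s (t + 1) q s'"
| exec_WhileFalse: "\<not> eval_test b s \<Longrightarrow> exec orc (While b p) s 1 0 s"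
| exec_WhileTrue: "eval_test b s \<Longrightarrow> exec orc p s t q s' \<Longrightarrow>
    exec orc (While b p) s' t' q' s'' \<Longrightarrow> exec orc (While b p) s (t + t' + 1) (q + q') s''"


subsection \<open>Membership oracle, input and output of the construction\<close>

text \<open>The queried vector \<open>y\<close> consists of the cells of the array with indices in \<open>K i\<close>;
  a non-binary vector is rejected, being outside \<open>S i\<close>. For a tree-decomposition of width at most
  \<open>\<omega>\<close> the set \<open>K i\<close> may have up to \<open>\<omega> + 1\<close> elements, hence \<open>2\<^bsup>\<omega>+1\<^esup>\<close> vectors, all of which may
  have to be queried.\<close>

definition gb_oracle :: "gb \<Rightarrow> int \<Rightarrow> (int \<Rightarrow> int) \<Rightarrow> bool" where
  "gb_oracle P i y \<longleftrightarrow> 1 \<le> i \<and> i \<le> int (gb_m P) \<and>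
     restrict (\<lambda>j. real_of_int (y (int j))) (gb_K P (nat i)) \<in> gb_S P (nat i)"

definition encode_set :: "nat set \<Rightarrow> int list" where
  "encode_set A = int (card A) # map int (sorted_list_of_set A)"

text \<open>The input consists of \<open>n\<close>, \<open>m\<close>, \<open>N = |V(T)|\<close>, the sets \<open>K i\<close>, the bags and the edges of the tree
  (listed in any order and orientation), for the tree nodes \<open>1, \<dots>, N\<close>. The sets \<open>S i\<close> are not part of it.\<close>

definition input_encoding ::
  "gb \<Rightarrow> nat \<Rightarrow> nat set set \<Rightarrow> (nat \<Rightarrow> nat set) \<Rightarrow> int list \<Rightarrow> bool" where
  "input_encoding P N ET Q xs \<longleftrightarrow> (\<exists>es :: (nat \<times> nat) list.
     distinct (map (\<lambda>(s, t). {s, t}) es) \<and> set (map (\<lambda>(s, t). {s, t}) es) = ET \<and>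
     xs = [int (gb_n P), int (gb_m P), int N]
        @ concat (map (\<lambda>i. encode_set (gb_K P i)) [1..<gb_m P + 1])
        @ concat (map (\<lambda>t. encode_set (Q t)) [1..<N + 1])
        @ int (length es) # concat (map (\<lambda>(s, t). [int s, int t]) es))"

definition initial_state :: "int list \<Rightarrow> state" where
  "initial_state xs = \<lparr>regs = (\<lambda>_. 0),
     arrs = (\<lambda>a k. if a = ''input'' \<and> 0 \<le> k \<and> k < int (length xs) then xs ! nat k else 0),
     outp = []\<rparr>"

fun sense_code :: "sense \<Rightarrow> int" where
  "sense_code LE = -1"
| "sense_code EQ = 0"
| "sense_code GE = 1"

text \<open>Sparse encoding of a row: sense, right-hand side, number of listed entries, and the
  entries \<open>(j, a)\<close>, where \<open>a\<close> is the coefficient of variable \<open>j\<close>; unlisted coefficients are 0.\<close>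

definition row_encoding :: "nat \<Rightarrow> lp_row \<Rightarrow> int list \<Rightarrow> bool" where
  "row_encoding d r ys \<longleftrightarrow> (\<exists>(rhs :: int) (as :: (nat \<times> int) list).
     row_rhs r = real_of_int rhs \<and>
     distinct (map fst as) \<and> fst ` set as \<subseteq> {1..d} \<and>
     (\<forall>(j, a)\<in>set as. row_coeff r j = real_of_int a) \<and>
     (\<forall>j\<in>{1..d} - fst ` set as. row_coeff r j = 0) \<and>
     ys = [sense_code (row_sense r), rhs, int (length as)]
        @ concat (map (\<lambda>(j, a). [int j, a]) as))"

text \<open>The objective is not part of the encoding: it is the given vector \<open>c\<close> on the designated variables.\<close>

definition lp_encoding :: "lp \<Rightarrow> int list \<Rightarrow> bool" where
  "lp_encoding L xs \<longleftrightarrow> (\<exists>yss. list_all2 (row_encoding (lp_nvars L)) (lp_rows L) yss \<and>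
     xs = [int (lp_nvars L), int (length (lp_rows L))] @ concat yss)"


section \<open>Workload bounds\<close>

text \<open>The two workload expressions
  \<open>\<omega> 2\<^sup>\<omega> \<Sum>\<^sub>t |{i. K i \<subseteq> Q t}| + \<omega> m n\<close> and \<open>\<omega> 2\<^sup>\<omega> m n + \<omega>\<^sup>2 2\<^sup>\<omega> n\<close>.
  They are those expressions verbatim if \<open>\<omega> \<ge> 1\<close>, \<open>m \<ge> 1\<close> and \<open>|V(T)| \<le> n\<close>. The maxima cover the
  degenerate cases: a factor \<open>\<omega> = 0\<close> or \<open>m = 0\<close> would make the bound vanish, and a
  tree with more than \<open>n\<close> nodes has to be read.\<close>

definition workload1 :: "gb \<Rightarrow> nat set \<Rightarrow> (nat \<Rightarrow> nat set) \<Rightarrow> nat \<Rightarrow> real" where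
  "workload1 P VT Q \<omega> =
     real (max 1 \<omega>) * 2 ^ \<omega> * (\<Sum>t\<in>VT. real (card {i \<in> {1..gb_m P}. gb_K P i \<subseteq> Q t}))
     + real (max 1 \<omega>) * real (max 1 (gb_m P)) * real (max (gb_n P) (card VT))"

definition workload2 :: "gb \<Rightarrow> nat set \<Rightarrow> nat \<Rightarrow> real" where
  "workload2 P VT \<omega> =
     real (max 1 \<omega>) * 2 ^ \<omega> * real (gb_m P) * real (max (gb_n P) (card VT))
     + real (max 1 \<omega>) ^ 2 * 2 ^ \<omega> * real (max (gb_n P) (card VT))"

text \<open>The factor hidden by \<open>O\<^sup>*\<close> is a power of this one, which is at least 1 for \<open>n \<ge> 1\<close>.\<close>

definition log_factor :: "gb \<Rightarrow> real" where
  "log_factor P = log 2 (real (gb_m P + gb_n P + 1))"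

end

theory Submission
  imports Defs
begin

text \<open>The linear program arises from eliminating the variables one at a time. Search the tree of the
tree-decomposition from its first node and number the vertices \<open>1, \<dots>, n\<close> in the order in which
the search meets them in the bags. Then eliminate the vertices in decreasing order: every vertex
\<open>v\<close> has a bag, which starts as \<open>{v}\<close>; a constraint \<open>K i\<close> is put into the bag of its last vertex; and
when \<open>v\<close> is eliminated, the rest of its bag, the separator, is put into the bag of the last vertex of
the separator, the parent of \<open>v\<close>. An additional vertex \<open>0\<close> with empty bag is the parent of the vertices
with empty separator and carries the constraints with \<open>K i = {}\<close>. If \<open>u\<close> precedes \<open>v\<close> and both are in
a common bag of the tree-decomposition, then \<open>u\<close> lies in the first bag containing \<open>v\<close>
(\<open>first_occurrence_good_order\<close>). By induction every elimination bag is contained in a bag of the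
tree-decomposition, and so has at most \<open>\<omega> + 1\<close> elements (\<open>inv_absorb\<close>).

The program has, besides \<open>x\<close>, a variable \<open>\<lambda> v Y\<close> for every vertex \<open>v\<close> and every subset \<open>Y\<close> of its bag,
the probability that \<open>Y\<close> is the set of ones in the bag. Rows demand that the probabilities are nonnegative,
that they vanish if \<open>Y\<close> violates a constraint placed at \<open>v\<close>, that \<open>v\<close> and its parent induce the same
distribution on the separator, that \<open>\<lambda> 0 {} = 1\<close>, and that \<open>x v\<close> is the probability of \<open>v \<in> Y\<close>.
Going through the vertices in increasing order, the local distributions can be glued to
a distribution on all subsets of \<open>{1, \<dots>, n}\<close>, by choosing \<open>v\<close> with its conditional probability given
the separator (\<open>glue\<close>). The glued distribution lives on feasible points and has mean \<open>x\<close>, so \<open>x\<close> is in the convex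
hull (\<open>feasible_projects\<close>); conversely a feasible point gives a point distribution
(\<open>solution_lifts\<close>).

The bags of the tree-decomposition itself would be too expensive for the workload bound, which
charges \<open>2\<^sup>\<omega>\<close> only for the bags containing some \<open>K i\<close>. With elimination bags, a vertex without constraint and with
a single child has a smaller bag than its child, hence at most half as many subsets. The remaining
vertices either have a one-element bag or carry a constraint or are branchings, and of the latter two
there are \<open>O(m)\<close>. So the number of all \<open>\<lambda> v Y\<close> is \<open>O(2\<^sup>\<omega> m + n)\<close> (\<open>sum_bag_powers\<close>); the same holds if
every parent is counted once per child (\<open>sum_parent_bag_powers\<close>), which bounds the entries of
the rows linking a vertex to its parent.

The program \<open>construct\<close> performs these steps with linked adjacency lists for the search and consecutive blocks of memory
for the bags. Its correctness and its running time, a constant times \<open>\<omega> (2\<^sup>\<omega> m + n + |V(T)|)\<close>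
with \<open>\<omega>\<close> replaced by \<open>\<omega> + 1\<close>, are proved together in a calculus of weakest preconditions whose predicates see the clocks
(\<open>construct_wp\<close>). Every \<open>K i\<close> is contained in some bag, so this time is within the first
workload expression (\<open>workload1_ge\<close>).\<close>

section \<open>Search orders of a tree\<close>

definition search_order :: "'a set \<Rightarrow> 'a set set \<Rightarrow> 'a list \<Rightarrow> bool" where
  "search_order V E q \<longleftrightarrow> distinct q \<and> set q = V \<and>
     (\<forall>k<length q. 0 < k \<longrightarrow> (\<exists>j<k. {q ! j, q ! k} \<in> E))"

text \<open>A walk from \<open>x\<close> to \<open>y\<close> has to leave \<open>S\<close> at some edge.\<close>

lemma connected_crossing:
  assumes "induces_connected E V" "x \<in> V" "x \<in> S" "y \<in> V" "y \<notin> S"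
  shows "\<exists>a\<in>V. \<exists>b\<in>V. a \<in> S \<and> b \<notin> S \<and> {a, b} \<in> E"
proof (rule ccontr)
  assume no: "\<not> ?thesis"
  have "(x, y) \<in> {(a, b). a \<in> V \<and> b \<in> V \<and> {a, b} \<in> E}\<^sup>*"
    using assms by (auto simp: induces_connected_def)
  then have "y \<in> S"
    by (induction rule: rtrancl_induct) (use assms no in auto)
  with assms show False by simp
qed

text \<open>As long as a vertex is missing, some edge leaves the set of the listed vertices, and its other end
  can be appended.\<close>

lemma search_order_exists:
  assumes "finite V" "induces_connected E V"
  shows "\<exists>q. search_order V E q"
proof -
  have "k \<ge> 1 \<Longrightarrow> k \<le> card V \<Longrightarrow> \<exists>q. length q = k \<and> distinct q \<and> set q \<subseteq> V \<and>
     (\<forall>k<length q. 0 < k \<longrightarrow> (\<exists>j<k. {q ! j, q ! k} \<in> E))" for k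
  proof (induction k)
    case (Suc k)
    show ?case
    proof (cases "k = 0")
      case True
      from assms obtain v where "v \<in> V" by (auto simp: induces_connected_def)
      with True show ?thesis by (intro exI[of _ "[v]"]) auto
    next
      case False
      with Suc obtain q where q: "length q = k" "distinct q" "set q \<subseteq> V"
        "\<forall>k<length q. 0 < k \<longrightarrow> (\<exists>j<k. {q ! j, q ! k} \<in> E)" by auto
      have "card (set q) < card V" using q Suc.prems by (simp add: distinct_card)
      with q obtain y where y: "y \<in> V" "y \<notin> set q" by (metis nless_le subsetI subset_antisym)
      have "q ! 0 \<in> set q" using False q by auto
      with connected_crossing[OF assms(2), of "q ! 0" "set q" y] y q
      obtain a b where ab: "a \<in> set q" "b \<in> V" "b \<notin> set q" "{a, b} \<in> E" by auto
      then obtain j where "j < k" "q ! j = a" using q by (metis in_set_conv_nth)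
      with ab q show ?thesis
        by (intro exI[of _ "q @ [b]"]) (fastforce simp: nth_append less_Suc_eq)
    qed
  qed simp
  moreover have "card V \<ge> 1"
    using assms by (simp add: Suc_leI card_gt_0_iff induces_connected_def)
  ultimately obtain q where "length q = card V" "distinct q" "set q \<subseteq> V"
     "\<forall>k<length q. 0 < k \<longrightarrow> (\<exists>j<k. {q ! j, q ! k} \<in> E)" by (meson order_refl)
  then show ?thesis
    unfolding search_order_def by (metis assms(1) card_subset_eq distinct_card)
qed

text \<open>Whenever a walk returns to a vertex, it is cut back to the first visit.\<close>

lemma simple_path:
  assumes "(u, v) \<in> {(a, b). {a, b} \<in> E}\<^sup>*"
  shows "\<exists>p. p \<noteq> [] \<and> hd p = u \<and> last p = v \<and> distinct p \<and>
           (\<forall>i. Suc i < length p \<longrightarrow> {p ! i, p ! Suc i} \<in> E)"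
  using assms
proof (induction rule: rtrancl_induct)
  case base
  show ?case by (intro exI[of _ "[u]"]) simp
next
  case (step y z)
  then obtain p where p: "p \<noteq> []" "hd p = u" "last p = y" "distinct p"
    "\<forall>i. Suc i < length p \<longrightarrow> {p ! i, p ! Suc i} \<in> E" by auto
  show ?case
  proof (cases "z \<in> set p")
    case True
    then obtain j where j: "j < length p" "p ! j = z" by (metis in_set_conv_nth)
    let ?p = "take (Suc j) p"
    have "last ?p = z" using j by (simp add: take_Suc_conv_app_nth)
    with p j show ?thesis by (intro exI[of _ ?p]) (auto simp: hd_conv_nth)
  next
    case False
    have "{(p @ [z]) ! i, (p @ [z]) ! Suc i} \<in> E" if "Suc i < length (p @ [z])" for i
    proof (cases "Suc i = length p")
      case True
      then have "p ! i = y" using p by (metis diff_Suc_1 last_conv_nth)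
      then show ?thesis using step True by (simp add: nth_append)
    next
      case False
      then show ?thesis using p that by (auto simp: nth_append)
    qed
    then show ?thesis using p False by (intro exI[of _ "p @ [z]"]) auto
  qed
qed

text \<open>The edges from the vertices to their parents connect everything to the first vertex. Any other edge would
  close a path of such edges to a cycle.\<close>

lemma tree_edges_from_parents:
  assumes tree: "is_tree V E" and q: "search_order V E q"
    and f: "\<And>k. 0 < k \<Longrightarrow> k < length q \<Longrightarrow> f k < k \<and> {q ! f k, q ! k} \<in> E" and e: "e \<in> E"
  shows "\<exists>k. 0 < k \<and> k < length q \<and> e = {q ! f k, q ! k}"
proof (rule ccontr)
  assume no: "\<not> ?thesis"
  define E' where "E' = {{q ! f k, q ! k} | k. 0 < k \<and> k < length q}"
  define R where "R = {(a, b). {a, b} \<in> E'}"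
  have sub: "E' \<subseteq> E" using f by (auto simp: E'_def)
  have root: "k < length q \<Longrightarrow> (q ! 0, q ! k) \<in> R\<^sup>*" for k
  proof (induction k rule: less_induct)
    case (less k)
    show ?case
    proof (cases "k = 0")
      case False
      with less.prems f have "(q ! 0, q ! f k) \<in> R\<^sup>*" by (intro less.IH) (auto intro: less_trans)
      moreover have "(q ! f k, q ! k) \<in> R" using False less.prems by (auto simp: R_def E'_def)
      ultimately show ?thesis by simp
    qed simp
  qed
  from tree e obtain a b where ab: "e = {a, b}" "a \<in> V" "b \<in> V" "a \<noteq> b"
    by (auto simp: is_tree_def)
  with q obtain i j where "q ! i = a" "q ! j = b" "i < length q" "j < length q"
    unfolding search_order_def by (metis in_set_conv_nth)
  with root have "(q ! 0, a) \<in> R\<^sup>*" "(q ! 0, b) \<in> R\<^sup>*" by auto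
  moreover have "sym R" by (auto simp: R_def sym_def insert_commute)
  ultimately have "(a, b) \<in> R\<^sup>*" by (meson rtrancl_trans sym_rtrancl symD)
  then obtain p where p: "p \<noteq> []" "hd p = a" "last p = b" "distinct p"
    "\<And>i. Suc i < length p \<Longrightarrow> {p ! i, p ! Suc i} \<in> E'"
    using simple_path[of a b E'] unfolding R_def by auto
  have "length p \<noteq> 1" using p ab by (metis One_nat_def last_conv_nth hd_conv_nth diff_Suc_1)
  moreover have "length p \<noteq> 2"
  proof
    assume 2: "length p = 2"
    then have "e = {p ! 0, p ! 1}" using p(1-3) ab by (simp add: hd_conv_nth last_conv_nth)
    with p(5)[of 0] 2 no show False by (auto simp: E'_def)
  qed
  ultimately have 3: "length p \<ge> 3" using p(1) by (cases p rule: remdups_adj.cases) (auto simp: Suc_le_eq)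
  have "{p ! i, p ! (Suc i mod length p)} \<in> E" if "i < length p" for i
  proof (cases "Suc i = length p")
    case True
    then have "p ! i = b" "p ! (Suc i mod length p) = a"
      using p by (metis diff_Suc_1 last_conv_nth, metis hd_conv_nth mod_self)
    then show ?thesis using e ab by (simp add: insert_commute)
  next
    case False
    with that p(5)[of i] sub show ?thesis by auto
  qed
  with 3 p(4) have "has_cycle E" unfolding has_cycle_def by blast
  with tree show False by (simp add: is_tree_def)
qed

text \<open>As every edge joins a vertex to its parent, a connected set which contains \<open>q ! s\<close> but not its
  parent consists of descendants of \<open>q ! s\<close>, and these do not precede it.\<close>

lemma parent_in_subtree:
  assumes tree: "is_tree V E" and q: "search_order V E q"
    and f: "\<And>k. 0 < k \<Longrightarrow> k < length q \<Longrightarrow> f k < k \<and> {q ! f k, q ! k} \<in> E"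
    and U: "U \<subseteq> V" "induces_connected E U"
    and s: "s < length q" "q ! s \<in> U" and r: "r < s" "q ! r \<in> U"
  shows "q ! f s \<in> U"
proof (rule ccontr)
  assume no: "q ! f s \<notin> U"
  define g where "g k = (if 0 < k \<and> k < length q then f k else 0)" for k
  have g: "g k \<le> k" for k using f by (auto simp: g_def less_imp_le)
  have gi: "(g ^^ i) k \<le> k" for i k by (induction i) (auto intro: order_trans[OF g])
  have inj: "i = j" if "q ! i = q ! j" "i < length q" "j < length q" for i j
    using q that by (simp add: search_order_def nth_eq_iff_index_eq)
  have "(q ! s, x) \<in> {(a, b). a \<in> U \<and> b \<in> U \<and> {a, b} \<in> E}\<^sup>* \<Longrightarrow>
     \<exists>k<length q. x = q ! k \<and> (\<exists>i. (g ^^ i) k = s)" for x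
  proof (induction rule: rtrancl_induct)
    case base
    have "(g ^^ 0) s = s" by simp
    with s show ?case by blast
  next
    case (step y z)
    then obtain k i where k: "k < length q" "y = q ! k" "(g ^^ i) k = s" by auto
    from step tree_edges_from_parents[OF tree q f] obtain j where
      j: "0 < j" "j < length q" "{y, z} = {q ! f j, q ! j}" by blast
    then have fj: "f j < length q" "g j = f j" using f[of j] by (auto simp: g_def)
    from j(3) consider "y = q ! f j" "z = q ! j" | "y = q ! j" "z = q ! f j"
      by (auto simp: doubleton_eq_iff)
    then show ?case
    proof cases
      case 1
      then have "k = f j" using k fj inj by simp
      then have "(g ^^ Suc i) j = s" using k fj by (simp add: funpow_swap1)
      then show ?thesis using 1 j by blast
    next
      case 2
      then have kj: "k = j" using k j inj by simp
      show ?thesis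
      proof (cases i)
        case 0
        then show ?thesis using 2 k kj no step by simp
      next
        case (Suc i')
        then have "(g ^^ i') (f j) = s" using k kj fj by (simp add: funpow_swap1)
        then show ?thesis using 2 fj by blast
      qed
    qed
  qed
  moreover have "(q ! s, q ! r) \<in> {(a, b). a \<in> U \<and> b \<in> U \<and> {a, b} \<in> E}\<^sup>*"
    using U s r by (auto simp: induces_connected_def)
  ultimately obtain k i where "k < length q" "q ! r = q ! k" "(g ^^ i) k = s" by blast
  with inj[of r k] gi[of i k] r s show False by simp
qed

lemma card_tree_edges:
  assumes tree: "is_tree V E" and q: "search_order V E q"
  shows "card E \<le> length q"
proof -
  from q have "\<forall>k. \<exists>j. 0 < k \<and> k < length q \<longrightarrow> j < k \<and> {q ! j, q ! k} \<in> E"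
    by (auto simp: search_order_def)
  then obtain f where f: "\<And>k. 0 < k \<Longrightarrow> k < length q \<Longrightarrow> f k < k \<and> {q ! f k, q ! k} \<in> E" by metis
  have "E \<subseteq> (\<lambda>k. {q ! f k, q ! k}) ` {..<length q}"
    using tree_edges_from_parents[OF tree q f] by blast
  from surj_card_le[OF _ this] show ?thesis by simp
qed

text \<open>The form in which the subtree property of tree-decompositions is used. The node \<open>T\<close> stands for the topmost bag containing \<open>v\<close>.\<close>

definition good_order :: "nat set \<Rightarrow> (nat \<Rightarrow> nat set) \<Rightarrow> (nat \<Rightarrow> nat) \<Rightarrow> bool" where
  "good_order VT Q pos \<longleftrightarrow> (\<forall>v\<in>\<Union>(Q ` VT). \<exists>T\<in>VT. \<forall>t\<in>VT. \<forall>u\<in>Q t. v \<in> Q t \<longrightarrow> pos u \<le> pos v \<longrightarrow> u \<in> Q T)"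

text \<open>Take the first bag containing \<open>v\<close>. From a common bag of \<open>u\<close> and \<open>v\<close> go up to parents: until the
  first bag of \<open>v\<close> is reached, both vertices also occur earlier, because \<open>u\<close> appears no later than
  \<open>v\<close>, so by connectedness neither is lost.\<close>

lemma first_occurrence_good_order:
  assumes td: "tree_decomposition V E VT ET Q" and q: "search_order VT ET q"
    and first: "\<And>u v k. u \<in> V \<Longrightarrow> v \<in> V \<Longrightarrow> pos u \<le> pos v \<Longrightarrow> k < length q \<Longrightarrow> v \<in> Q (q ! k) \<Longrightarrow>
      \<exists>j\<le>k. u \<in> Q (q ! j)"
  shows "good_order VT Q pos"
  unfolding good_order_def
proof
  fix v assume "v \<in> \<Union>(Q ` VT)"
  then have "\<exists>k. k < length q \<and> v \<in> Q (q ! k)" using q by (auto simp: search_order_def in_set_conv_nth)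
  define kv where "kv = (LEAST k. k < length q \<and> v \<in> Q (q ! k))"
  have kv: "kv < length q" "v \<in> Q (q ! kv)"
    using LeastI_ex[OF \<open>\<exists>k. k < length q \<and> v \<in> Q (q ! k)\<close>] by (auto simp: kv_def)
  have kv_le: "kv \<le> k" if "k < length q" "v \<in> Q (q ! k)" for k
    unfolding kv_def using that by (simp add: Least_le)
  have inV: "x \<in> V" if "x \<in> Q (q ! k)" "k < length q" for x k
    using that td q by (auto simp: tree_decomposition_def search_order_def)
  from q have "\<forall>k. \<exists>j. 0 < k \<and> k < length q \<longrightarrow> j < k \<and> {q ! j, q ! k} \<in> ET"
    by (auto simp: search_order_def)
  then obtain f where f: "\<And>k. 0 < k \<Longrightarrow> k < length q \<Longrightarrow> f k < k \<and> {q ! f k, q ! k} \<in> ET" by metis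
  have main: "s < length q \<Longrightarrow> u \<in> Q (q ! s) \<Longrightarrow> v \<in> Q (q ! s) \<Longrightarrow> pos u \<le> pos v \<Longrightarrow> u \<in> Q (q ! kv)" for u s
  proof (induction s rule: less_induct)
    case (less s)
    show ?case
    proof (cases "s = kv")
      case False
      with kv_le less.prems have "kv < s" by force
      from first[OF inV inV less.prems(4) kv] less.prems kv
      obtain ku where ku: "ku \<le> kv" "u \<in> Q (q ! ku)" by blast
      have *: "q ! f s \<in> {t \<in> VT. x \<in> Q t}" if "x \<in> Q (q ! s)" "r < s" "x \<in> Q (q ! r)" for x r
      proof (rule parent_in_subtree[OF _ q f, where r = r])
        show "is_tree VT ET" "induces_connected ET {t \<in> VT. x \<in> Q t}"
          using td inV that less.prems by (auto simp: tree_decomposition_def)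
      qed (use q that less.prems in \<open>auto simp: search_order_def\<close>)
      have "q ! f s \<in> {t \<in> VT. v \<in> Q t}" "q ! f s \<in> {t \<in> VT. u \<in> Q t}"
        using *[OF less.prems(3) \<open>kv < s\<close> kv(2)] *[OF less.prems(2), of ku] ku \<open>kv < s\<close> by auto
      moreover have "f s < s" using f \<open>kv < s\<close> less.prems(1) by auto
      ultimately show ?thesis using less.IH less.prems by simp
    qed (use less in simp)
  qed
  have "\<forall>t\<in>VT. \<forall>u\<in>Q t. v \<in> Q t \<longrightarrow> pos u \<le> pos v \<longrightarrow> u \<in> Q (q ! kv)"
    using main q by (metis in_set_conv_nth search_order_def)
  moreover have "q ! kv \<in> VT" using kv q by (auto simp: search_order_def)
  ultimately show "\<exists>T\<in>VT. \<forall>t\<in>VT. \<forall>u\<in>Q t. v \<in> Q t \<longrightarrow> pos u \<le> pos v \<longrightarrow> u \<in> Q T" by blast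
qed

section \<open>Symbolic elimination\<close>

definition snoc_new :: "'a \<Rightarrow> 'a list \<Rightarrow> 'a list" where
  "snoc_new x xs = (if x \<in> set xs then xs else xs @ [x])"

lemma set_snoc_new [simp]: "set (snoc_new x xs) = insert x (set xs)"
  and distinct_snoc_new [simp]: "distinct (snoc_new x xs) = distinct xs"
  by (auto simp: snoc_new_def)

lemma set_fold_snoc_new [simp]: "set (fold snoc_new ws xs) = set ws \<union> set xs"
  by (induction ws arbitrary: xs) auto

lemma distinct_fold_snoc_new [simp]: "distinct (fold snoc_new ws xs) = distinct xs"
  by (induction ws arbitrary: xs) auto

lemma fold_snoc_new_append: "\<exists>zs. fold snoc_new ws xs = xs @ zs"
proof (induction ws arbitrary: xs)
  case (Cons w ws)
  obtain zs where "fold snoc_new ws (snoc_new w xs) = snoc_new w xs @ zs" using Cons by blast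
  moreover have "\<exists>ys. snoc_new w xs = xs @ ys" by (simp add: snoc_new_def)
  ultimately show ?case by auto
qed simp

lemma list_tl_subset: "set (tl xs) \<subseteq> set xs"
  by (cases xs) auto

text \<open>The start value \<open>0\<close> is the result for the empty list. In the application \<open>pos 0 = 0\<close>
  and list members have positive positions, so that it is the result for no other list.\<close>

definition last_max :: "(nat \<Rightarrow> nat) \<Rightarrow> nat list \<Rightarrow> nat" where
  "last_max pos xs = foldl (\<lambda>b w. if pos b < pos w then w else b) 0 xs"

lemma foldl_max:
  fixes pos :: "nat \<Rightarrow> nat"
  defines "g \<equiv> \<lambda>b w. if pos b < pos w then w else b"
  shows "foldl g b xs \<in> insert b (set xs) \<and> (\<forall>w\<in>insert b (set xs). pos w \<le> pos (foldl g b xs))"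
proof (induction xs arbitrary: b)
  case (Cons x xs)
  show ?case using Cons[of "g b x"] by (auto simp: g_def split: if_splits)
qed simp

text \<open>The effect of a clique \<open>xs\<close> on the bags \<open>B\<close>: the last vertex of \<open>xs\<close> becomes responsible for it.\<close>

definition absorb :: "(nat \<Rightarrow> nat) \<Rightarrow> nat list \<Rightarrow> (nat \<Rightarrow> nat list) \<Rightarrow> nat \<Rightarrow> nat list" where
  "absorb pos xs B = B(last_max pos xs := fold snoc_new xs (B (last_max pos xs)))"

text \<open>The sets \<open>C v\<close> bound the elimination bags from above. They are the neighbourhoods of \<open>v\<close> among its
  predecessors, together with \<open>v\<close> itself, in a chordal graph with cliques \<open>K i\<close> for which the reverse of the
  numbering is a perfect elimination order.\<close>

locale elimination =
  fixes n m w :: nat and K :: "nat \<Rightarrow> nat set" and pos ord :: "nat \<Rightarrow> nat" and C :: "nat \<Rightarrow> nat set"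
  assumes pos0: "pos 0 = 0"
    and pos: "v \<in> {1..n} \<Longrightarrow> pos v \<in> {1..n} \<and> ord (pos v) = v"
    and ord: "c \<in> {1..n} \<Longrightarrow> ord c \<in> {1..n} \<and> pos (ord c) = c"
    and K_sub: "i \<in> {1..m} \<Longrightarrow> K i \<subseteq> {1..n}"
    and C_sub: "v \<in> {1..n} \<Longrightarrow> C v \<subseteq> {1..n}"
    and C_card: "v \<in> {1..n} \<Longrightarrow> card (C v) \<le> w"
    and C_self: "v \<in> {1..n} \<Longrightarrow> v \<in> C v"
    and C_pos: "v \<in> {1..n} \<Longrightarrow> u \<in> C v \<Longrightarrow> pos u \<le> pos v"
    and C_chord: "v \<in> {1..n} \<Longrightarrow> a \<in> C v \<Longrightarrow> b \<in> C v \<Longrightarrow> pos a \<le> pos b \<Longrightarrow> a \<in> C b"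
    and K_chord: "i \<in> {1..m} \<Longrightarrow> a \<in> K i \<Longrightarrow> b \<in> K i \<Longrightarrow> pos a \<le> pos b \<Longrightarrow> a \<in> C b"
begin

abbreviation Kl :: "nat \<Rightarrow> nat list" where "Kl i \<equiv> sorted_list_of_set (K i)"

lemma finite_K: "i \<in> {1..m} \<Longrightarrow> finite (K i)"
  using K_sub finite_subset by blast

lemma set_Kl: "i \<in> {1..m} \<Longrightarrow> set (Kl i) = K i"
  using finite_K by simp

text \<open>First all constraints are absorbed. Afterwards the vertices hand on their separators, the vertex
  with number \<open>n - j\<close> in round \<open>j\<close>; its bag is complete by then.\<close>

primrec BK :: "nat \<Rightarrow> nat \<Rightarrow> nat list" where
  "BK 0 = (\<lambda>v. if v = 0 then [] else [v])"
| "BK (Suc i) = absorb pos (Kl (Suc i)) (BK i)"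

primrec BE :: "nat \<Rightarrow> nat \<Rightarrow> nat list" where
  "BE 0 = BK m"
| "BE (Suc j) = absorb pos (tl (BE j (ord (n - j)))) (BE j)"

definition bag :: "nat \<Rightarrow> nat list" where "bag = BE n"
definition sep :: "nat \<Rightarrow> nat list" where "sep v = tl (bag v)"
definition par :: "nat \<Rightarrow> nat" where "par v = last_max pos (sep v)"
definition vert :: "nat \<Rightarrow> nat" where "vert i = last_max pos (Kl i)"

lemma pos_inj: "u \<in> {1..n} \<Longrightarrow> v \<in> {1..n} \<Longrightarrow> pos u = pos v \<Longrightarrow> u = v"
  using pos by metis

lemma last_max:
  assumes "set xs \<subseteq> {1..n}"
  shows "xs = [] \<Longrightarrow> last_max pos xs = 0"
    "xs \<noteq> [] \<Longrightarrow> last_max pos xs \<in> set xs"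
    "\<And>x. x \<in> set xs \<Longrightarrow> pos x \<le> pos (last_max pos xs)"
proof -
  note f = foldl_max[where pos = pos and b = 0 and xs = xs, folded last_max_def]
  show "x \<in> set xs \<Longrightarrow> pos x \<le> pos (last_max pos xs)" for x using f by auto
  show "last_max pos xs \<in> set xs" if "xs \<noteq> []"
  proof -
    from that obtain x where x: "x \<in> set xs" by (cases xs) auto
    with assms pos have "pos x \<ge> 1" by fastforce
    moreover have "pos x \<le> pos (last_max pos xs)" using f x by blast
    ultimately have "last_max pos xs \<noteq> 0" using pos0 by (intro notI) simp
    with f show ?thesis by auto
  qed
qed (simp add: last_max_def)

text \<open>That \<open>v\<close> heads its own bag makes it the lowest bit in the numbering of the subsets of the bag.\<close>

definition inv :: "(nat \<Rightarrow> nat list) \<Rightarrow> bool" where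
  "inv B \<longleftrightarrow> B 0 = [] \<and> (\<forall>v\<in>{1..n}. \<exists>S. B v = v # S \<and> distinct (v # S) \<and> set S \<subseteq> C v)"

text \<open>The lists whose absorption keeps the bags within the sets \<open>C v\<close>.\<close>

definition chain :: "nat list \<Rightarrow> bool" where
  "chain xs \<longleftrightarrow> set xs \<subseteq> {1..n} \<and> (\<forall>a\<in>set xs. \<forall>b\<in>set xs. pos a \<le> pos b \<longrightarrow> a \<in> C b)"

lemma inv_Cons:
  assumes "inv B" "v \<in> {1..n}"
  obtains S where "B v = v # S" "v \<notin> set S" "distinct S" "set S \<subseteq> C v"
  using assms unfolding inv_def by (metis distinct.simps(2))

lemma inv_Cons_tl: "inv B \<Longrightarrow> v \<in> {1..n} \<Longrightarrow> B v = v # tl (B v)"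
  by (metis inv_Cons list.sel(3))

lemma inv_set:
  assumes "inv B" "v \<in> {1..n}"
  shows "set (B v) \<subseteq> C v"
  by (rule inv_Cons[OF assms]) (use C_self[OF assms(2)] in simp)

lemma inv_props:
  assumes "inv B" "v \<le> n"
  shows "distinct (B v)" "set (B v) \<subseteq> {1..n}" "length (B v) \<le> w" "length (B v) \<le> n"
proof -
  show d: "distinct (B v)" using assms by (cases "v = 0") (simp add: inv_def, auto elim: inv_Cons[of B v])
  show s: "set (B v) \<subseteq> {1..n}"
    using assms inv_set[of B v] C_sub[of v] by (cases "v = 0") (auto simp: inv_def)
  show "length (B v) \<le> n" using d s by (metis card_atLeastAtMost card_mono diff_Suc_1 distinct_card finite_atLeastAtMost)
  show "length (B v) \<le> w"
  proof (cases "v = 0")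
    case False
    then have v: "v \<in> {1..n}" using assms by simp
    have "length (B v) = card (set (B v))" using d by (simp add: distinct_card)
    also have "\<dots> \<le> card (C v)"
      using inv_set[OF assms(1) v] C_sub[OF v] by (meson card_mono finite_atLeastAtMost finite_subset)
    finally show ?thesis using C_card[OF v] by simp
  qed (use assms in \<open>simp add: inv_def\<close>)
qed

lemma chain_K: "i \<in> {1..m} \<Longrightarrow> chain (Kl i)"
  using K_sub K_chord by (auto simp: chain_def set_Kl)

lemma chain_tl:
  assumes "inv B" "v \<in> {1..n}"
  shows "chain (tl (B v))"
proof -
  have "set (tl (B v)) \<subseteq> C v" by (rule order_trans[OF list_tl_subset inv_set[OF assms]])
  then have "\<And>a. a \<in> set (tl (B v)) \<Longrightarrow> a \<in> C v" by blast
  then show ?thesis unfolding chain_def using C_sub[OF assms(2)] C_chord[OF assms(2)] by auto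
qed

lemma last_max_le: "chain xs \<Longrightarrow> last_max pos xs \<le> n"
  using last_max[of xs] by (cases "xs = []") (auto simp: chain_def)

lemma absorb_0: "absorb pos [] B = B"
  by (simp add: absorb_def)

lemma inv_absorb:
  assumes "inv B" "chain xs"
  shows "inv (absorb pos xs B)"
proof (cases "xs = []")
  case False
  define p where "p = last_max pos xs"
  note lm = last_max[of xs, folded p_def]
  have xs: "set xs \<subseteq> {1..n}" using assms by (simp add: chain_def)
  have p: "p \<in> set xs" "p \<in> {1..n}" using lm(2)[OF xs False] xs by auto
  obtain S where S: "B p = p # S" "p \<notin> set S" "distinct S" "set S \<subseteq> C p"
    using inv_Cons[OF assms(1) p(2)] .
  obtain zs where zs: "fold snoc_new xs (B p) = B p @ zs" using fold_snoc_new_append by blast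
  have "set xs \<subseteq> C p" using assms(2) lm(3)[OF xs] p by (auto simp: chain_def)
  moreover have "set (fold snoc_new xs (B p)) = set xs \<union> set (B p)" by simp
  ultimately have "set (B p @ zs) \<subseteq> C p" using S C_self[OF p(2)] unfolding zs by auto
  moreover have "distinct (fold snoc_new xs (B p))" using S by simp
  then have "distinct (B p @ zs)" unfolding zs .
  ultimately have "fold snoc_new xs (B p) = p # (S @ zs) \<and> distinct (p # (S @ zs)) \<and> set (S @ zs) \<subseteq> C p"
    using S(1) unfolding zs by simp
  then have "\<exists>S. fold snoc_new xs (B p) = p # S \<and> distinct (p # S) \<and> set S \<subseteq> C p" by blast
  then show ?thesis using assms p by (auto simp: inv_def absorb_def p_def[symmetric])
qed (simp add: absorb_0 assms)

lemma inv_BK: "i \<le> m \<Longrightarrow> inv (BK i)"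
proof (induction i)
  case (Suc i)
  then show ?case using inv_absorb[OF _ chain_K[of "Suc i"]] by simp
qed (auto simp: inv_def)

lemma inv_BE: "j \<le> n \<Longrightarrow> inv (BE j)"
proof (induction j)
  case (Suc j)
  then have "n - j \<in> {1..n}" by auto
  then show ?case using Suc inv_absorb[OF _ chain_tl] ord by simp
qed (simp add: inv_BK)

lemma inv_bag: "inv bag" by (simp add: bag_def inv_BE)

lemma bag_0: "bag 0 = []" using inv_bag by (simp add: inv_def)

lemma bag_Cons: "v \<in> {1..n} \<Longrightarrow> bag v = v # sep v"
  unfolding sep_def by (rule inv_Cons_tl[OF inv_bag])

lemmas distinct_bag = inv_props(1)[OF inv_bag] and bag_subset = inv_props(2)[OF inv_bag]
  and length_bag = inv_props(3,4)[OF inv_bag]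

lemma chain_sep: "v \<in> {1..n} \<Longrightarrow> chain (sep v)"
  unfolding sep_def by (rule chain_tl[OF inv_bag])

lemma sep_pos:
  assumes "inv B" "v \<in> {1..n}" "u \<in> set (tl (B v))"
  shows "pos u < pos v"
proof -
  have "distinct (B v)" using assms inv_props by simp
  then have "u \<noteq> v" using inv_Cons_tl[OF assms(1,2)] assms(3) by (metis distinct.simps(2))
  moreover have "u \<in> C v" using assms(3) by (rule subsetD[OF order_trans[OF list_tl_subset inv_set[OF assms(1,2)]]])
  then have "pos u \<le> pos v" "u \<in> {1..n}" using C_pos C_sub assms by blast+
  ultimately show ?thesis using pos_inj assms(2) by fastforce
qed

text \<open>The vertex eliminated in a round changes only the bag of a vertex preceding it.\<close>

lemma BE_stable:
  assumes "v \<in> {1..n}" "n - j \<le> pos v" "j \<le> j'" "j' \<le> n"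
  shows "BE j' v = BE j v"
  using assms(3,4)
proof (induction j' rule: dec_induct)
  case (step j')
  define u where "u = ord (n - j')"
  have u: "u \<in> {1..n}" "pos u = n - j'" using ord[of "n - j'"] step by (auto simp: u_def)
  have i: "inv (BE j')" using step inv_BE by simp
  define xs where "xs = tl (BE j' u)"
  have "absorb pos xs (BE j') v = BE j' v"
  proof (cases "xs = []")
    case False
    have "set xs \<subseteq> {1..n}" using chain_tl[OF i u(1)] by (simp add: chain_def xs_def)
    then have "last_max pos xs \<in> set xs" using last_max(2) False by blast
    then have "pos (last_max pos xs) < pos u" using sep_pos[OF i u(1)] by (simp add: xs_def)
    also have "\<dots> \<le> pos v" using u assms(2) step.hyps by simp
    finally show ?thesis by (auto simp: absorb_def)
  qed (simp add: absorb_0)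
  then show ?case using step by (simp add: xs_def u_def)
qed simp

lemma bag_eq_BE: "v \<in> {1..n} \<Longrightarrow> bag v = BE (n - pos v) v"
  unfolding bag_def by (rule BE_stable) auto

lemma absorb_mono: "set (B v) \<subseteq> set (absorb pos xs B v)"
  by (auto simp: absorb_def)

lemma BK_mono: "i \<le> i' \<Longrightarrow> set (BK i v) \<subseteq> set (BK i' v)"
  by (induction i' rule: dec_induct) (use absorb_mono in fastforce)+

lemma BE_mono: "i \<le> i' \<Longrightarrow> set (BE i v) \<subseteq> set (BE i' v)"
  by (induction i' rule: dec_induct) (use absorb_mono in fastforce)+

lemma K_subset_bag:
  assumes "i \<in> {1..m}"
  shows "K i \<subseteq> set (bag (vert i))"
proof -
  have "K i \<subseteq> set (BK i (vert i))"
    using assms by (cases i) (auto simp: absorb_def vert_def set_Kl)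
  also have "\<dots> \<subseteq> set (BK m (vert i))" using assms BK_mono by simp
  also have "\<dots> \<subseteq> set (bag (vert i))" using BE_mono[of 0 n] by (simp add: bag_def)
  finally show ?thesis .
qed

lemma sep_subset_bag:
  assumes "v \<in> {1..n}"
  shows "set (sep v) \<subseteq> set (bag (par v))"
proof -
  let ?j = "n - pos v"
  have p: "pos v \<in> {1..n}" "ord (pos v) = v" using pos[OF assms] by auto
  then have s: "sep v = tl (BE ?j (ord (n - ?j)))" using bag_eq_BE[OF assms] by (simp add: sep_def)
  have "set (sep v) \<subseteq> set (BE (Suc ?j) (par v))"
    unfolding par_def s by (auto simp: absorb_def)
  also have "\<dots> \<subseteq> set (bag (par v))" unfolding bag_def by (rule BE_mono) (use p in auto)
  finally show ?thesis .
qed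

lemma vert_le: "i \<in> {1..m} \<Longrightarrow> vert i \<le> n"
  unfolding vert_def by (rule last_max_le[OF chain_K])

lemma par_le: "v \<in> {1..n} \<Longrightarrow> par v \<le> n"
  unfolding par_def by (rule last_max_le[OF chain_sep])

lemma sep_Nil_par: "sep v = [] \<Longrightarrow> par v = 0"
  by (simp add: par_def last_max_def)

lemma par_in_sep: "v \<in> {1..n} \<Longrightarrow> sep v \<noteq> [] \<Longrightarrow> par v \<in> set (sep v)"
  unfolding par_def using last_max(2) chain_sep by (simp add: chain_def)

lemma par_pos:
  assumes "v \<in> {1..n}"
  shows "pos (par v) < pos v"
proof (cases "sep v = []")
  case True
  with assms pos[OF assms] pos0 show ?thesis by (simp add: sep_Nil_par)
next
  case False
  then show ?thesis using sep_pos[OF inv_bag assms] par_in_sep[OF assms] by (simp add: sep_def)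
qed

lemma sep_pos_less: "v \<in> {1..n} \<Longrightarrow> u \<in> set (sep v) \<Longrightarrow> pos u < pos v"
  unfolding sep_def by (rule sep_pos[OF inv_bag])

lemma BK_origin:
  "i \<le> m \<Longrightarrow> u \<in> set (BK i v) \<Longrightarrow> u = v \<or> (\<exists>i'\<in>{1..m}. vert i' = v \<and> u \<in> K i')"
proof (induction i)
  case (Suc i)
  then show ?case
    by (auto simp: absorb_def vert_def set_Kl split: if_splits dest!: Suc.IH)
qed (auto split: if_splits)

text \<open>Bags contain no more than they have to. This minimality is what the counting of subsets rests on.\<close>

lemma bag_origin:
  assumes "u \<in> set (bag v)"
  shows "u = v \<or> (\<exists>i\<in>{1..m}. vert i = v \<and> u \<in> K i) \<or> (\<exists>x\<in>{1..n}. par x = v \<and> u \<in> set (sep x))"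
proof -
  have "j \<le> n \<Longrightarrow> u \<in> set (BE j v) \<Longrightarrow> ?thesis" for j
  proof (induction j)
    case 0
    then show ?case using BK_origin[OF order_refl, of u v] unfolding BE.simps by blast
  next
    case (Suc j)
    let ?x = "ord (n - j)"
    have x: "?x \<in> {1..n}" "pos ?x = n - j" using ord[of "n - j"] Suc.prems by auto
    have "sep ?x = tl (BE j ?x)" using bag_eq_BE[OF x(1)] x(2) Suc.prems(1) by (simp add: sep_def)
    then have B: "BE (Suc j) v = (if v = par ?x then fold snoc_new (sep ?x) (BE j v) else BE j v)"
      by (simp add: absorb_def par_def)
    show ?case
    proof (cases "u \<in> set (BE j v)")
      case True
      then show ?thesis using Suc.IH Suc.prems(1) by linarith
    next
      case False
      then have "par ?x = v" "u \<in> set (sep ?x)"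
        using Suc.prems(2) unfolding B by (simp_all split: if_splits)
      then show ?thesis using x(1) by blast
    qed
  qed
  from this[OF order_refl] assms show ?thesis unfolding bag_def by blast
qed

subsection \<open>The total number of bag assignments\<close>

definition nK :: "nat \<Rightarrow> nat" where "nK v = card {i \<in> {1..m}. vert i = v}"
definition children :: "nat \<Rightarrow> nat set" where "children v = {x \<in> {1..n}. par x = v}"

lemma finite_children [simp]: "finite (children v)" by (simp add: children_def)

lemma sum_over_children:
  fixes f :: "nat \<Rightarrow> nat"
  shows "(\<Sum>v = 1..n. sum f (children v)) + sum f (children 0) = sum f {1..n}"
proof -
  have "sum f {1..n} = (\<Sum>v\<in>{0..n}. sum f {x \<in> {1..n}. par x = v})"
    by (rule sum.group[symmetric]) (use par_le in auto)
  also have "{0..n} = insert 0 {1..n}" by auto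
  finally show ?thesis by (simp add: children_def)
qed

definition isroot :: "nat \<Rightarrow> nat" where "isroot v = of_bool (par v = 0)"

lemma sum_roots: "sum isroot {1..n} = card (children 0)"
proof -
  have "{1..n} \<inter> {v. par v = 0} = children 0" by (auto simp: children_def)
  then show ?thesis by (simp add: isroot_def of_bool_def sum.If_cases)
qed

lemma sum_nK: "(\<Sum>v = 1..n. nK v) \<le> m"
proof -
  have "(\<Sum>v = 1..n. nK v) \<le> (\<Sum>v = 0..n. nK v)" by (rule sum_mono2) auto
  also have "\<dots> = (\<Sum>v = 0..n. \<Sum>i\<in>{i \<in> {1..m}. vert i = v}. 1)" by (simp add: nK_def)
  also have "\<dots> = (\<Sum>i\<in>{1..m}. 1)" by (rule sum.group) (use vert_le in auto)
  finally show ?thesis by simp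
qed

text \<open>Without a constraint at \<open>v\<close> its bag stems from the separators of its children. If there is just
  one child, then \<open>v\<close> lies in the separator of the child, which therefore contains the whole bag of \<open>v\<close>
  and is smaller than the bag of the child.\<close>

lemma branching_cases:
  assumes "v \<in> {1..n}"
  obtains "nK v = 0" "children v = {}" "bag v = [v]" "par v = 0"
  | x where "nK v = 0" "children v = {x}" "2 * 2 ^ length (bag v) \<le> (2::nat) ^ length (bag x)"
  | "2 \<le> 2 * nK v + card (children v)"
proof -
  consider "2 \<le> 2 * nK v + card (children v)" | "nK v = 0" "card (children v) = 0"
    | "nK v = 0" "card (children v) = 1" by linarith
  then show ?thesis
  proof cases
    case 1 then show ?thesis by (rule that(3))
  next
    case 2
    then have "set (bag v) \<subseteq> {v}" using bag_origin[of _ v] by (auto simp: nK_def children_def)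
    with bag_Cons[OF assms] distinct_bag[of v] assms have "bag v = [v]"
      by (cases "sep v") auto
    then show ?thesis using 2 that(1) sep_Nil_par[of v] by (simp add: sep_def)
  next
    case 3
    then obtain x where x: "children v = {x}" by (meson card_1_singletonE)
    then have x': "x \<in> {1..n}" "par x = v" by (auto simp: children_def)
    then have "sep x \<noteq> []" using sep_Nil_par assms by force
    then have "v \<in> set (sep x)" using par_in_sep x' by blast
    moreover have no: "{i \<in> {1..m}. vert i = v} = {}" using 3 by (simp add: nK_def)
    have "y = x" if "y \<in> {1..n}" "par y = v" for y
      using x that unfolding children_def by blast
    ultimately have "set (bag v) \<subseteq> set (sep x)"
      using bag_origin[of _ v] no by blast
    then have "length (bag v) \<le> length (sep x)"
      using distinct_bag[of v] assms by (metis card_length card_mono distinct_card finite_set le_trans atLeastAtMost_iff)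
    then have "2 ^ Suc (length (bag v)) \<le> (2::nat) ^ length (bag x)"
      using bag_Cons[OF x'(1)] by (intro power_increasing) auto
    then show ?thesis using 3 x that(2) by auto
  qed
qed

lemma bag_power_le: "v \<le> n \<Longrightarrow> 2 ^ length (bag v) \<le> (2::nat) ^ w"
  using length_bag by (intro power_increasing) auto

text \<open>With \<open>f v\<close> the number of subsets of the bag of \<open>v\<close> and \<open>W = 2\<^sup>w\<close>, each of the three cases for a vertex yields
  the local inequality below. On summation every vertex occurs as a child at most once, vertices and children cancel
  up to the children of \<open>0\<close>, and what remains is \<open>2 F \<le> F + 4 W m + 4 n\<close> for the sum \<open>F\<close> of all \<open>f v\<close>.\<close>

lemma sum_bag_powers: "(\<Sum>v = 1..n. 2 ^ length (bag v)) \<le> 4 * 2 ^ w * m + 4 * n"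
proof -
  define f where "f v = (2::nat) ^ length (bag v)" for v
  define W where "W = (2::nat) ^ w"
  \<comment> \<open>The last two terms cover the vertices without constraint and without children, which have parent \<open>0\<close> and \<open>f v = 2\<close>.\<close>
  have v: "2 * f v + 2 * W \<le> sum f (children v) + 2 * W * (2 * nK v + card (children v))
      + 2 * W * isroot v + 4" if "v \<in> {1..n}" for v
    using that
  proof (cases rule: branching_cases)
    case 3
    then have "2 * W * 2 \<le> 2 * W * (2 * nK v + card (children v))" by (intro mult_left_mono) auto
    moreover have "f v \<le> W" using that bag_power_le by (simp add: f_def W_def)
    ultimately show ?thesis by linarith
  qed (auto simp: f_def isroot_def)
  have "(\<Sum>v = 1..n. 2 * f v + 2 * W) \<le> (\<Sum>v = 1..n. sum f (children v) + 2 * W * (2 * nK v + card (children v))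
      + 2 * W * isroot v + 4)"
    by (rule sum_mono) (rule v)
  moreover have "sum isroot {1..n} = card (children 0)"
    by (rule sum_roots)
  ultimately have "2 * sum f {1..n} + 2 * W * n \<le> (\<Sum>v = 1..n. sum f (children v))
      + 2 * W * (2 * (\<Sum>v = 1..n. nK v) + (\<Sum>v = 1..n. card (children v))) + 2 * W * card (children 0) + 4 * n"
    by (simp add: sum.distrib sum_distrib_left[symmetric] sum_distrib_right[symmetric] algebra_simps)
  moreover have "(\<Sum>v = 1..n. sum f (children v)) \<le> sum f {1..n}" using sum_over_children[of f] by simp
  moreover have "(\<Sum>v = 1..n. card (children v)) + card (children 0) = n"
    using sum_over_children[of "\<lambda>_. 1"] by simp
  then have "2 * W * n = 2 * W * (\<Sum>v = 1..n. card (children v)) + 2 * W * card (children 0)"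
    by (metis distrib_left)
  moreover have "W * (\<Sum>v = 1..n. nK v) \<le> W * m" by (intro mult_left_mono sum_nK) simp
  ultimately have "sum f {1..n} \<le> 4 * W * m + 4 * n" by (simp only: algebra_simps; linarith)
  then show ?thesis by (simp add: f_def W_def)
qed

text \<open>The first child of \<open>v\<close> is paid by \<open>f v\<close> itself. Each further child costs at most \<open>W\<close>, and
  the number of further children is bounded by the number of constraints as before.\<close>

lemma sum_parent_bag_powers: "(\<Sum>v = 1..n. 2 ^ length (bag (par v))) \<le> 6 * 2 ^ w * m + 5 * n"
proof -
  define f where "f v = (2::nat) ^ length (bag v)" for v
  define W where "W = (2::nat) ^ w"
  have v: "card (children v) * f v + W \<le> f v + W * (2 * nK v + card (children v))
      + W * isroot v" if "v \<in> {1..n}" for v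
    using that
  proof (cases rule: branching_cases)
    case 3
    have fW: "f v \<le> W" using that bag_power_le by (simp add: f_def W_def)
    show ?thesis
    proof (cases "card (children v)")
      case 0
      then have "W * 2 \<le> W * (2 * nK v + card (children v))" using 3 by (intro mult_left_mono) auto
      moreover have "card (children v) * f v = 0" using 0 by simp
      ultimately show ?thesis by linarith
    next
      case (Suc k)
      have "k * f v \<le> k * W" using fW by (rule mult_left_mono) simp
      then show ?thesis unfolding Suc by (simp only: mult_Suc mult_Suc_right algebra_simps; linarith)
    qed
  qed (auto simp: f_def isroot_def)
  have "(\<Sum>v = 1..n. card (children v) * f v + W) \<le> (\<Sum>v = 1..n. f v + W * (2 * nK v + card (children v))
      + W * isroot v)"
    by (rule sum_mono) (rule v)
  moreover have "sum isroot {1..n} = card (children 0)"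
    by (rule sum_roots)
  ultimately have "(\<Sum>v = 1..n. card (children v) * f v) + W * n \<le> sum f {1..n}
      + W * (2 * (\<Sum>v = 1..n. nK v) + (\<Sum>v = 1..n. card (children v))) + W * card (children 0)"
    by (simp add: sum.distrib sum_distrib_left[symmetric] algebra_simps)
  moreover have n: "(\<Sum>v = 1..n. card (children v)) + card (children 0) = n"
    using sum_over_children[of "\<lambda>_. 1"] by simp
  then have "W * n = W * (\<Sum>v = 1..n. card (children v)) + W * card (children 0)"
    by (metis distrib_left)
  moreover have "W * (\<Sum>v = 1..n. nK v) \<le> W * m" by (intro mult_left_mono sum_nK) simp
  ultimately have "(\<Sum>v = 1..n. card (children v) * f v) \<le> sum f {1..n} + 2 * W * m"
    by (simp only: algebra_simps; linarith)
  moreover have "(\<Sum>v = 1..n. f (par v)) = (\<Sum>v = 1..n. card (children v) * f v) + card (children 0)"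
  proof -
    have "(\<Sum>x\<in>children v. f (par x)) = card (children v) * f v" for v
      by (simp add: children_def)
    moreover have "f 0 = 1" by (simp add: f_def bag_0)
    ultimately show ?thesis using sum_over_children[of "\<lambda>x. f (par x)"] by simp
  qed
  moreover have "card (children 0) \<le> n" using n by simp
  ultimately show ?thesis using sum_bag_powers by (simp add: f_def W_def)
qed

end

section \<open>Numbering the subsets of a list\<close>

definition sub :: "'a list \<Rightarrow> nat \<Rightarrow> 'a set" where
  "sub L i = {L ! k | k. k < length L \<and> bit i k}"

definition enc :: "'a list \<Rightarrow> 'a set \<Rightarrow> nat" where
  "enc L Y = horner_sum of_bool 2 (map (\<lambda>x. x \<in> Y) L)"

lemma sub_subset: "sub L i \<subseteq> set L"
  by (auto simp: sub_def)

lemma bit_enc: "bit (enc L Y) k \<longleftrightarrow> k < length L \<and> L ! k \<in> Y"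
  by (auto simp: enc_def bit_horner_sum_bit_iff)

lemma sub_enc: "sub L (enc L Y) = Y \<inter> set L"
  by (auto simp: sub_def bit_enc in_set_conv_nth)

lemma enc_less: "enc L Y < 2 ^ length L"
proof -
  have "enc L Y = take_bit (length L) (enc L Y)"
    by (rule bit_eqI) (auto simp: enc_def bit_horner_sum_bit_iff bit_take_bit_iff)
  also have "\<dots> < 2 ^ length L" by (rule take_bit_nat_less_exp)
  finally show ?thesis .
qed

lemma nth_in_sub: "distinct L \<Longrightarrow> k < length L \<Longrightarrow> L ! k \<in> sub L i \<longleftrightarrow> bit i k"
  by (auto simp: sub_def nth_eq_iff_index_eq)

lemma enc_sub:
  assumes "distinct L" "i < 2 ^ length L"
  shows "enc L (sub L i) = i"
proof -
  have "map (\<lambda>x. x \<in> sub L i) L = map (bit i) [0..<length L]"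
    by (rule nth_equalityI) (use assms nth_in_sub in auto)
  then have "enc L (sub L i) = take_bit (length L) i"
    by (simp add: enc_def horner_sum_bit_eq_take_bit)
  also have "\<dots> = i" using assms(2) by (simp add: take_bit_nat_eq_self_iff)
  finally show ?thesis .
qed

lemma enc_inter: "enc L (Y \<inter> set L) = enc L Y"
  unfolding enc_def by (rule arg_cong[where f = "horner_sum of_bool 2"]) (auto simp: map_eq_conv)

lemma enc_eq_sum: "enc L Y = (\<Sum>k<length L. of_bool (L ! k \<in> Y) * 2 ^ k)"
  unfolding enc_def horner_sum_eq_sum by (rule sum.cong) auto

lemma enc_Un: "A \<inter> B = {} \<Longrightarrow> enc L (A \<union> B) = enc L A + enc L B"
  unfolding enc_eq_sum sum.distrib[symmetric] by (rule sum.cong) auto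

lemma bij_sub: "distinct L \<Longrightarrow> bij_betw (sub L) {..<2 ^ length L} {Y. Y \<subseteq> set L}"
  by (rule bij_betw_byWitness[where f' = "enc L"])
    (auto simp: enc_sub sub_enc enc_less dest: subsetD[OF sub_subset])

lemma sum_sub: "distinct L \<Longrightarrow> (\<Sum>i<2 ^ length L. g (sub L i)) = (\<Sum>Y | Y \<subseteq> set L. g Y)"
  by (rule sum.reindex_bij_betw[OF bij_sub])

lemma enc_Cons_even: "x \<notin> Y \<Longrightarrow> enc (x # L) Y = 2 * enc L Y"
  and enc_Cons_odd: "x \<in> Y \<Longrightarrow> enc (x # L) Y = 2 * enc L Y + 1"
  by (simp_all add: enc_def)

section \<open>Sparse rows\<close>

text \<open>Sense, right-hand side, and the list of variables with their coefficients.\<close>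

type_synonym sparse_row = "sense \<times> int \<times> (nat \<times> int) list"

definition dense :: "sparse_row \<Rightarrow> lp_row" where
  "dense r = (case r of (sn, b, as) \<Rightarrow>
     \<lparr>row_coeff = (\<lambda>j. case map_of as j of None \<Rightarrow> 0 | Some a \<Rightarrow> real_of_int a), row_sense = sn, row_rhs = b\<rparr>)"

definition sparse_ok :: "nat \<Rightarrow> sparse_row \<Rightarrow> bool" where
  "sparse_ok d r \<longleftrightarrow> distinct (map fst (snd (snd r))) \<and> fst ` set (snd (snd r)) \<subseteq> {1..d} \<and>
     snd ` set (snd (snd r)) \<subseteq> {1, -1}"

definition row_code :: "sparse_row \<Rightarrow> int list" where
  "row_code r = (case r of (sn, b, as) \<Rightarrow>
     [sense_code sn, b, int (length as)] @ concat (map (\<lambda>(j, a). [int j, a]) as))"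

lemma dense_sum:
  assumes "distinct (map fst as)" "fst ` set as \<subseteq> {1..d}"
  shows "(\<Sum>j = 1..d. row_coeff (dense (sn, b, as)) j * z j) = (\<Sum>(j, a)\<leftarrow>as. real_of_int a * z j)"
  using assms
proof (induction as)
  case (Cons e as)
  obtain j a where e: "e = (j, a)" by (cases e)
  have "map_of as j = None" using Cons.prems(1) e by (simp add: map_of_eq_None_iff image_image)
  then have "row_coeff (dense (sn, b, e # as)) k * z k
      = (if k = j then real_of_int a * z k else 0) + row_coeff (dense (sn, b, as)) k * z k" for k
    by (simp add: dense_def e)
  then have "(\<Sum>k = 1..d. row_coeff (dense (sn, b, e # as)) k * z k)
      = (\<Sum>k = 1..d. if k = j then real_of_int a * z k else 0) + (\<Sum>k = 1..d. row_coeff (dense (sn, b, as)) k * z k)"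
    by (simp add: sum.distrib)
  also have "(\<Sum>k = 1..d. if k = j then real_of_int a * z k else 0) = real_of_int a * z j"
    using Cons.prems e by simp
  finally show ?case using Cons e by simp
qed (simp add: dense_def)

lemma row_encoding_dense:
  assumes "sparse_ok d r"
  shows "row_encoding d (dense r) (row_code r)"
proof -
  obtain sn b as where r: "r = (sn, b, as)" by (cases r)
  have "distinct (map fst as)" "fst ` set as \<subseteq> {1..d}" using assms by (auto simp: sparse_ok_def r)
  moreover have "\<forall>(j, a)\<in>set as. row_coeff (dense r) j = real_of_int a"
    using calculation(1) by (auto simp: dense_def r)
  moreover have "\<forall>j\<in>{1..d} - fst ` set as. row_coeff (dense r) j = 0"
    by (auto simp: dense_def r map_of_eq_None_iff[THEN iffD2])
  ultimately show ?thesis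
    unfolding row_encoding_def by (intro exI[of _ b] exI[of _ as]) (simp add: dense_def row_code_def r)
qed

lemma unit_row:
  assumes "sparse_ok d r"
  shows "row_coeff (dense r) j \<in> {0, 1, -1}"
proof -
  obtain sn b as where r: "r = (sn, b, as)" by (cases r)
  show ?thesis
  proof (cases "map_of as j")
    case (Some a)
    then have "(j, a) \<in> set as" by (rule map_of_SomeD)
    then have "a \<in> {1, -1}" using assms unfolding sparse_ok_def r by force
    then show ?thesis using Some by (auto simp: dense_def r)
  qed (simp add: dense_def r)
qed

lemma convex_lp_feasible: "convex (lp_feasible L)"
proof (rule convexI)
  fix x y and u v :: real
  assume x: "x \<in> lp_feasible L" and y: "y \<in> lp_feasible L" and uv: "0 \<le> u" "0 \<le> v" "u + v = 1"
  let ?d = "lp_nvars L"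
  have "sense_holds (row_sense r) (\<Sum>j = 1..?d. row_coeff r j * (u *\<^sub>R x + v *\<^sub>R y) j) (row_rhs r)"
    if r: "r \<in> set (lp_rows L)" for r
  proof -
    let ?a = "\<lambda>z. \<Sum>j = 1..?d. row_coeff r j * z j"
    have "?a (u *\<^sub>R x + v *\<^sub>R y) = u * ?a x + v * ?a y"
      by (simp add: scaleR_fun_def algebra_simps sum.distrib sum_distrib_left)
    moreover have "sense_holds (row_sense r) (?a x) (row_rhs r)" "sense_holds (row_sense r) (?a y) (row_rhs r)"
      using x y r by (auto simp: lp_feasible_def)
    then have "sense_holds (row_sense r) (u * ?a x + v * ?a y) (u * row_rhs r + v * row_rhs r)"
      using uv by (cases "row_sense r") (auto intro!: add_mono mult_left_mono)
    moreover have "u * row_rhs r + v * row_rhs r = row_rhs r" using uv by (metis distrib_right mult_1)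
    ultimately show ?thesis by simp
  qed
  moreover have "u * undefined + v * undefined = (undefined :: real)"
    using uv by (metis distrib_right mult_1)
  ultimately show "u *\<^sub>R x + v *\<^sub>R y \<in> lp_feasible L"
    using x y by (auto simp: lp_feasible_def PiE_iff extensional_def scaleR_fun_def)
qed

section \<open>Gluing local distributions\<close>

lemma sum_subsets_insert:
  fixes g :: "'a set \<Rightarrow> real"
  assumes "finite S" "x \<notin> S"
  shows "(\<Sum>X | X \<subseteq> insert x S \<and> P X. g X)
    = (\<Sum>X | X \<subseteq> S \<and> P X. g X) + (\<Sum>X | X \<subseteq> S \<and> P (insert x X). g (insert x X))"
proof -
  have "{X. X \<subseteq> insert x S \<and> P X} = {X. X \<subseteq> S \<and> P X} \<union> insert x ` {X. X \<subseteq> S \<and> P (insert x X)}"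
  proof (intro equalityI subsetI)
    fix X assume "X \<in> {X. X \<subseteq> insert x S \<and> P X}"
    then show "X \<in> {X. X \<subseteq> S \<and> P X} \<union> insert x ` {X. X \<subseteq> S \<and> P (insert x X)}"
      by (cases "x \<in> X") (auto intro!: image_eqI[of _ _ "X - {x}"] simp: insert_absorb)
  qed auto
  moreover have "inj_on (insert x) {X. X \<subseteq> S \<and> P (insert x X)}"
    using assms(2) by (intro inj_onI) (metis (mono_tags, lifting) insert_ident mem_Collect_eq subsetD)
  moreover have "finite {X. X \<subseteq> S \<and> P' X}" for P'
    by (rule finite_subset[of _ "Pow S"]) (use assms in auto)
  moreover have "{X. X \<subseteq> S \<and> P X} \<inter> insert x ` {X. X \<subseteq> S \<and> P (insert x X)} = {}"
    using assms(2) by auto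
  ultimately show ?thesis by (simp add: sum.union_disjoint sum.reindex)
qed

lemma sum_fibres:
  fixes g :: "'a set \<Rightarrow> real"
  assumes "finite S" "A \<subseteq> D" "finite D"
  shows "(\<Sum>X | X \<subseteq> S \<and> X \<inter> A = Z. g X) = (\<Sum>Y | Y \<subseteq> D \<and> Y \<inter> A = Z. \<Sum>X | X \<subseteq> S \<and> X \<inter> D = Y. g X)"
proof -
  have "(\<Sum>X | X \<subseteq> S \<and> X \<inter> A = Z. g X)
      = (\<Sum>Y | Y \<subseteq> D \<and> Y \<inter> A = Z. sum g {X \<in> {X. X \<subseteq> S \<and> X \<inter> A = Z}. X \<inter> D = Y})"
  proof (rule sum.group[symmetric])
    show "finite {X. X \<subseteq> S \<and> X \<inter> A = Z}" by (rule finite_subset[of _ "Pow S"]) (use assms in auto)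
    show "finite {Y. Y \<subseteq> D \<and> Y \<inter> A = Z}" by (rule finite_subset[of _ "Pow D"]) (use assms in auto)
  qed (use assms in blast)
  also have "\<dots> = (\<Sum>Y | Y \<subseteq> D \<and> Y \<inter> A = Z. \<Sum>X | X \<subseteq> S \<and> X \<inter> D = Y. g X)"
    by (intro sum.cong refl) (use assms in blast)
  finally show ?thesis .
qed

context elimination
begin

lemma set_bag: "v \<in> {1..n} \<Longrightarrow> set (bag v) = insert v (set (sep v))"
  using bag_Cons by (metis list.simps(15))

lemma notin_sep: "v \<in> {1..n} \<Longrightarrow> v \<notin> set (sep v)"
  using sep_pos_less by blast

text \<open>The vertices are added in the order of their numbers. The new distribution makes \<open>x\<close> a member with
  its conditional probability given the trace on the separator \<open>A\<close>. The old distribution has the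
  marginal \<open>mu\<close> on \<open>A\<close>, because \<open>A\<close> is contained in the bag of the parent of \<open>x\<close>, where the marginal rows apply.\<close>

lemma glue:
  fixes lam :: "nat \<Rightarrow> nat set \<Rightarrow> real"
  assumes root: "lam 0 {} = 1"
    and nonneg: "\<And>v Y. v \<le> n \<Longrightarrow> Y \<subseteq> set (bag v) \<Longrightarrow> 0 \<le> lam v Y"
    and marg: "\<And>v Z. v \<in> {1..n} \<Longrightarrow> Z \<subseteq> set (sep v) \<Longrightarrow>
      lam v Z + lam v (insert v Z) = (\<Sum>Y | Y \<subseteq> set (bag (par v)) \<and> Y \<inter> set (sep v) = Z. lam (par v) Y)"
  shows "\<exists>q. (\<forall>X\<subseteq>{1..n}. 0 \<le> q X) \<and>
    (\<forall>v\<le>n. \<forall>Y\<subseteq>set (bag v). (\<Sum>X | X \<subseteq> {1..n} \<and> X \<inter> set (bag v) = Y. q X) = lam v Y)"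
proof -
  define G where "G U q \<longleftrightarrow> (\<forall>X\<subseteq>U. 0 \<le> q X) \<and>
    (\<forall>v\<in>insert 0 U. \<forall>Y\<subseteq>set (bag v). (\<Sum>X | X \<subseteq> U \<and> X \<inter> set (bag v) = Y. q X) = lam v Y)" for U q
  have "finite U \<Longrightarrow> U \<subseteq> {1..n} \<longrightarrow> (\<forall>v\<in>U. set (sep v) \<subseteq> U) \<longrightarrow> (\<exists>q. G U q)" for U
  proof (induction U rule: finite_ranking_induct[where f = pos])
    case empty
    have "G {} (\<lambda>X. 1)" using root by (auto simp: G_def bag_0)
    then show ?case by blast
  next
    case (insert x S)
    show ?case
    proof (intro impI, cases "x \<in> S")
      case True
      assume "insert x S \<subseteq> {1..n}" "\<forall>v\<in>insert x S. set (sep v) \<subseteq> insert x S"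
      with True insert.IH show "\<exists>q. G (insert x S) q" by (simp add: insert_absorb)
    next
      case xS: False
      assume sub_n: "insert x S \<subseteq> {1..n}" and sep_in: "\<forall>v\<in>insert x S. set (sep v) \<subseteq> insert x S"
      have x: "x \<in> {1..n}" and Sn: "S \<subseteq> {1..n}" using sub_n by auto
      have closed: "set (sep v) \<subseteq> S" if "v \<in> insert x S" for v
      proof
        fix u assume u: "u \<in> set (sep v)"
        have v: "v \<in> {1..n}" using that x Sn by auto
        have "u \<in> insert x S" using sep_in that u by auto
        moreover have "pos u < pos v" using sep_pos_less[OF v u] .
        moreover have "pos v \<le> pos x" using that insert.hyps(2) by auto
        ultimately show "u \<in> S" by auto
      qed
      have "\<exists>q. G S q" using insert.IH Sn closed by simp
      then obtain q where Gq: "G S q" by blast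
      have q0: "0 \<le> q X" if "X \<subseteq> S" for X
        using Gq[unfolded G_def, THEN conjunct1, THEN spec, THEN mp, OF that] .
      have q: "(\<Sum>X | X \<subseteq> S \<and> X \<inter> set (bag v) = Y. q X) = lam v Y"
        if "v \<in> insert 0 S" "Y \<subseteq> set (bag v)" for v Y
        using Gq[unfolded G_def, THEN conjunct2, THEN bspec, OF that(1), THEN spec, THEN mp, OF that(2)] .
      define A where "A = set (sep x)"
      define D where "D = set (bag (par x))"
      define mu where "mu Z = lam x Z + lam x (insert x Z)" for Z
      \<comment> \<open>The quotient is the conditional probability of the membership of \<open>x\<close>. If the denominator is \<open>0\<close>, so is the factor \<open>q (X - {x})\<close>.\<close>
      define q' where "q' X = q (X - {x}) * (lam x (X \<inter> insert x A) / mu (X \<inter> A))" for X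
      have AD: "A \<subseteq> D" "finite D" using sep_subset_bag[OF x] by (auto simp: A_def D_def)
      have bx: "set (bag x) = insert x A" using set_bag[OF x] by (simp add: A_def)
      have xA: "x \<notin> A" using notin_sep[OF x] by (simp add: A_def)
      have pS: "par x \<in> insert 0 S"
        using par_in_sep[OF x] sep_Nil_par[of x] closed[of x] by (cases "sep x = []") auto
      have lam0: "0 \<le> lam x Z" "0 \<le> lam x (insert x Z)" if "Z \<subseteq> A" for Z
        using nonneg[of x Z] nonneg[of x "insert x Z"] x bx that by (auto simp: subset_insertI2 insert_mono)
      have muA: "(\<Sum>X | X \<subseteq> S \<and> X \<inter> A = Z. q X) = mu Z" if "Z \<subseteq> A" for Z
      proof -
        have "(\<Sum>X | X \<subseteq> S \<and> X \<inter> A = Z. q X) = (\<Sum>Y | Y \<subseteq> D \<and> Y \<inter> A = Z. \<Sum>X | X \<subseteq> S \<and> X \<inter> D = Y. q X)"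
          by (rule sum_fibres) (use insert.hyps(1) AD in auto)
        also have "\<dots> = (\<Sum>Y | Y \<subseteq> D \<and> Y \<inter> A = Z. lam (par x) Y)"
          by (rule sum.cong) (use q pS in \<open>auto simp: D_def\<close>)
        also have "\<dots> = mu Z" using marg[OF x, of Z] that by (simp add: A_def D_def mu_def)
        finally show ?thesis .
      qed
      have finS: "finite {X. X \<subseteq> S \<and> P X}" for P
        by (rule finite_subset[of _ "Pow S"]) (use insert.hyps(1) in auto)
      have q_zero: "q X = 0" if "X \<subseteq> S" "mu (X \<inter> A) = 0" for X
      proof -
        have "q X \<le> (\<Sum>X' | X' \<subseteq> S \<and> X' \<inter> A = X \<inter> A. q X')"
          using that(1) q0 finS by (intro member_le_sum) auto
        then show ?thesis using muA[of "X \<inter> A"] that q0[of X] by simp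
      qed
      have split: "q' X + q' (insert x X) = q X" if X: "X \<subseteq> S" for X
      proof -
        have xX: "x \<notin> X" using X xS by auto
        have "X \<inter> insert x A = X \<inter> A" "insert x X \<inter> insert x A = insert x (X \<inter> A)"
          "insert x X \<inter> A = X \<inter> A" "insert x X - {x} = X" "X - {x} = X" using xX xA by auto
        then have "q' X + q' (insert x X)
            = q X * ((lam x (X \<inter> A) + lam x (insert x (X \<inter> A))) / mu (X \<inter> A))"
          unfolding q'_def by (simp only: add_divide_distrib distrib_left)
        also have "\<dots> = q X * (mu (X \<inter> A) / mu (X \<inter> A))" by (simp only: mu_def)
        finally have "q' X + q' (insert x X) = q X * (mu (X \<inter> A) / mu (X \<inter> A))" .
        then show ?thesis using q_zero[OF X] by (cases "mu (X \<inter> A) = 0") auto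
      qed
      have "0 \<le> q' X" if "X \<subseteq> insert x S" for X
      proof -
        have "X \<inter> insert x A = X \<inter> A \<or> X \<inter> insert x A = insert x (X \<inter> A)" by auto
        then have "0 \<le> lam x (X \<inter> insert x A)" using lam0[of "X \<inter> A"] by auto
        moreover have "0 \<le> mu (X \<inter> A)" using lam0[of "X \<inter> A"] by (simp add: mu_def)
        moreover have "0 \<le> q (X - {x})" using that by (intro q0) auto
        ultimately show ?thesis by (simp add: q'_def)
      qed
      moreover have "(\<Sum>X | X \<subseteq> insert x S \<and> X \<inter> set (bag v) = Y. q' X) = lam v Y"
        if v: "v \<in> insert 0 (insert x S)" and Y: "Y \<subseteq> set (bag v)" for v Y
      proof (cases "v = x")
        case False
        then have v': "v \<in> insert 0 S" using v by simp
        have "set (bag v) \<subseteq> S"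
        proof (cases "v = 0")
          case False
          then have "v \<in> S" "v \<in> {1..n}" using v' Sn by auto
          then show ?thesis using set_bag[of v] closed[of v] by simp
        qed (simp add: bag_0)
        then have nx: "x \<notin> set (bag v)" using xS by auto
        then have "insert x X \<inter> set (bag v) = X \<inter> set (bag v)" for X by auto
        then have "(\<Sum>X | X \<subseteq> insert x S \<and> X \<inter> set (bag v) = Y. q' X)
            = (\<Sum>X | X \<subseteq> S \<and> X \<inter> set (bag v) = Y. q' X + q' (insert x X))"
          by (simp add: sum_subsets_insert[OF insert.hyps(1) xS] sum.distrib)
        also have "\<dots> = (\<Sum>X | X \<subseteq> S \<and> X \<inter> set (bag v) = Y. q X)"
          by (rule sum.cong) (use split in auto)
        finally show ?thesis using q[OF v' Y] by simp
      next
        case True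
        define Z where "Z = Y - {x}"
        have ZA: "Z \<subseteq> A" using Y True bx by (auto simp: Z_def)
        have key: "(\<Sum>X | X \<subseteq> S \<and> X \<inter> A = Z. q X * (lam x Y / mu Z)) = lam x Y"
        proof -
          have "(\<Sum>X | X \<subseteq> S \<and> X \<inter> A = Z. q X * (lam x Y / mu Z)) = mu Z * (lam x Y / mu Z)"
            by (simp only: sum_distrib_right[symmetric] muA[OF ZA])
          also have "\<dots> = lam x Y"
          proof (cases "mu Z = 0")
            case True
            then have "lam x Z = 0" "lam x (insert x Z) = 0" using lam0[OF ZA] by (auto simp: mu_def)
            moreover have "Y = Z \<or> Y = insert x Z" by (auto simp: Z_def)
            ultimately show ?thesis using True by auto
          qed simp
          finally show ?thesis .
        qed
        show ?thesis
        proof (cases "x \<in> Y")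
          case xY: True
          have "(\<Sum>X | X \<subseteq> insert x S \<and> X \<inter> insert x A = Y. q' X)
             = (\<Sum>X | X \<subseteq> S \<and> insert x X \<inter> insert x A = Y. q' (insert x X))"
          proof -
            have "{X. X \<subseteq> S \<and> X \<inter> insert x A = Y} = {}" using xS xY by auto
            then show ?thesis by (simp only: sum_subsets_insert[OF insert.hyps(1) xS] sum.empty add_0)
          qed
          also have "\<dots> = (\<Sum>X | X \<subseteq> S \<and> X \<inter> A = Z. q X * (lam x Y / mu Z))"
          proof (rule sum.cong)
            show "{X. X \<subseteq> S \<and> insert x X \<inter> insert x A = Y} = {X. X \<subseteq> S \<and> X \<inter> A = Z}"
              using xS xY xA by (auto simp: Z_def)
            fix X assume "X \<in> {X. X \<subseteq> S \<and> X \<inter> A = Z}"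
            then have "insert x X \<inter> insert x A = Y" "insert x X \<inter> A = Z" "insert x X - {x} = X"
              using xS xY xA by (auto simp: Z_def)
            then show "q' (insert x X) = q X * (lam x Y / mu Z)" by (simp only: q'_def)
          qed
          finally show ?thesis using key True bx by simp
        next
          case xY: False
          have "(\<Sum>X | X \<subseteq> insert x S \<and> X \<inter> insert x A = Y. q' X)
             = (\<Sum>X | X \<subseteq> S \<and> X \<inter> insert x A = Y. q' X)"
          proof -
            have "{X. X \<subseteq> S \<and> insert x X \<inter> insert x A = Y} = {}" using xS xY by auto
            then show ?thesis by (simp only: sum_subsets_insert[OF insert.hyps(1) xS] sum.empty add_0_right)
          qed
          also have "\<dots> = (\<Sum>X | X \<subseteq> S \<and> X \<inter> A = Z. q X * (lam x Y / mu Z))"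
          proof (rule sum.cong)
            show "{X. X \<subseteq> S \<and> X \<inter> insert x A = Y} = {X. X \<subseteq> S \<and> X \<inter> A = Z}"
              using xS xY xA by (auto simp: Z_def)
            fix X assume "X \<in> {X. X \<subseteq> S \<and> X \<inter> A = Z}"
            then have "X \<inter> insert x A = Y" "X \<inter> A = Z" "X - {x} = X"
              using xS xY xA by (auto simp: Z_def)
            then show "q' X = q X * (lam x Y / mu Z)" by (simp only: q'_def)
          qed
          finally show ?thesis using key True bx by simp
        qed
      qed
      ultimately show "\<exists>q. G (insert x S) q" unfolding G_def by blast
    qed
  qed
  from this[of "{1..n}"] chain_sep obtain q where "G {1..n} q" by (auto simp: chain_def)
  then have "\<forall>v\<in>insert 0 {1..n}. \<forall>Y\<subseteq>set (bag v).
      (\<Sum>X | X \<subseteq> {1..n} \<and> X \<inter> set (bag v) = Y. q X) = lam v Y" "\<forall>X\<subseteq>{1..n}. 0 \<le> q X"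
    unfolding G_def by blast+
  moreover have "v \<in> insert 0 {1..n}" if "v \<le> n" for v using that by auto
  ultimately show ?thesis by blast
qed

end

section \<open>The linear program\<close>

definition point :: "nat \<Rightarrow> nat set \<Rightarrow> nat \<Rightarrow> real" where
  "point n X = restrict (\<lambda>j. of_bool (j \<in> X)) {1..n}"

text \<open>\<open>acc i Y\<close> tells whether a 0-1 vector with set of ones \<open>Y\<close> satisfies constraint \<open>i\<close>.\<close>

locale elimination_lp = elimination +
  fixes acc :: "nat \<Rightarrow> nat set \<Rightarrow> bool"
  assumes acc_local: "acc i (Y \<inter> K i) = acc i Y"
begin

text \<open>The variables \<open>1, \<dots>, n\<close> are the designated ones. They are followed by one variable for the vertex \<open>0\<close> and by the
  blocks of the vertices \<open>1, \<dots>, n\<close>, one variable per subset of the bag.\<close>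

definition base :: "nat \<Rightarrow> nat" where
  "base v = (if v = 0 then n + 1 else n + 2 + (\<Sum>u\<in>{1..<v}. 2 ^ length (bag u)))"

definition nv :: nat where "nv = n + 1 + (\<Sum>u = 1..n. 2 ^ length (bag u))"

definition free :: "nat \<Rightarrow> nat list" where
  "free v = filter (\<lambda>x. x \<notin> set (sep v)) (bag (par v))"

definition bad :: "nat \<Rightarrow> bool" where
  "bad h \<longleftrightarrow> (\<exists>i\<in>{1..m}. \<exists>j<2 ^ length (bag (vert i)).
     h = base (vert i) + j \<and> \<not> acc i (sub (bag (vert i)) j))"

definition bound_row :: "nat \<Rightarrow> sparse_row" where
  "bound_row h = (if bad h then EQ else GE, 0, [(h, 1)])"

definition root_row :: sparse_row where "root_row = (EQ, 1, [(n + 1, 1)])"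

text \<open>As \<open>v\<close> is bit \<open>0\<close>, the odd numbers belong to the subsets containing \<open>v\<close>.\<close>

definition vertex_row :: "nat \<Rightarrow> sparse_row" where
  "vertex_row v = (EQ, 0, (v, 1) # map (\<lambda>i. (base v + (2 * i + 1), -1)) [0..<2 ^ length (sep v)])"

text \<open>The subsets of the bag of \<open>v\<close> with trace number \<open>i\<close> on the separator have the numbers \<open>2 * i\<close> and \<open>2 * i + 1\<close>.
  The subsets of the bag of the parent with this trace arise by adding the subsets of \<open>free v\<close>; on disjoint sets,
  numbers within the bag of the parent add up.\<close>

definition marg_row :: "nat \<Rightarrow> nat \<Rightarrow> sparse_row" where
  "marg_row v i = (EQ, 0, (base v + 2 * i, 1) # (base v + (2 * i + 1), 1) #
     map (\<lambda>j. (base (par v) + (enc (bag (par v)) (sub (sep v) i) + enc (bag (par v)) (sub (free v) j)), -1))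
       [0..<2 ^ length (free v)])"

definition vertex_block :: "nat \<Rightarrow> sparse_row list" where
  "vertex_block v = vertex_row v # map (marg_row v) [0..<2 ^ length (sep v)]"

definition rows :: "sparse_row list" where
  "rows = map bound_row [n + 1..<nv + 1] @ root_row # concat (map vertex_block [1..<n + 1])"

definition the_lp :: "(nat \<Rightarrow> real) \<Rightarrow> lp" where
  "the_lp c = \<lparr>lp_nvars = nv, lp_obj = (\<lambda>j. if j \<le> n then c j else 0), lp_rows = map dense rows\<rparr>"

lemma base_Suc: "v \<in> {1..n} \<Longrightarrow> base (Suc v) = base v + 2 ^ length (bag v)"
  by (simp add: base_def)

lemma base_mono: "1 \<le> u \<Longrightarrow> u < v \<Longrightarrow> base u + 2 ^ length (bag u) \<le> base v"
proof -
  assume u: "1 \<le> u" "u < v"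
  then have "(\<Sum>x\<in>{1..<Suc u}. 2 ^ length (bag x)) \<le> (\<Sum>x\<in>{1..<v}. 2 ^ length (bag x) :: nat)"
    by (intro sum_mono2) auto
  with u show ?thesis by (simp add: base_def)
qed

lemma base_bounds:
  assumes "v \<le> n"
  shows "n < base v" "base v + 2 ^ length (bag v) \<le> nv + 1"
proof -
  show "n < base v" by (simp add: base_def)
  show "base v + 2 ^ length (bag v) \<le> nv + 1"
  proof (cases "v = 0")
    case False
    have "(\<Sum>x\<in>{1..<Suc v}. 2 ^ length (bag x)) \<le> (\<Sum>x\<in>{1..n}. 2 ^ length (bag x) :: nat)"
      using assms by (intro sum_mono2) auto
    with False show ?thesis by (simp add: base_def nv_def)
  qed (simp add: base_def nv_def bag_0)
qed

lemma base_0_less: "1 \<le> v \<Longrightarrow> base 0 + 2 ^ length (bag 0) \<le> base v"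
  by (simp add: base_def bag_0)

lemma base_inj:
  assumes "base u + i = base v + j" "i < 2 ^ length (bag u)" "j < 2 ^ length (bag v)"
  shows "u = v \<and> i = j"
proof -
  have "base x + 2 ^ length (bag x) \<le> base y" if "x < y" for x y
    using base_mono[of x y] base_0_less[of y] that by (cases "x = 0") auto
  from this[of u v] this[of v u] assms show ?thesis by (cases u v rule: linorder_cases) auto
qed

lemma sep_len: "v \<in> {1..n} \<Longrightarrow> length (bag v) = Suc (length (sep v))"
  using bag_Cons by (metis length_Cons)

lemma distinct_sep: "v \<in> {1..n} \<Longrightarrow> distinct (sep v)"
  unfolding sep_def using distinct_bag[of v] distinct_tl by auto

lemma distinct_free: "v \<in> {1..n} \<Longrightarrow> distinct (free v)"
  unfolding free_def using distinct_bag par_le by simp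

lemma set_free: "set (free v) = set (bag (par v)) - set (sep v)"
  by (auto simp: free_def)

lemma marg_enc:
  "enc (bag (par v)) (sub (sep v) i) + enc (bag (par v)) (sub (free v) j)
     = enc (bag (par v)) (sub (sep v) i \<union> sub (free v) j)"
  by (rule enc_Un[symmetric]) (use sub_subset set_free in fastforce)

lemma bij_marg:
  assumes "v \<in> {1..n}" "i < 2 ^ length (sep v)"
  shows "bij_betw (\<lambda>j. sub (sep v) i \<union> sub (free v) j) {..<2 ^ length (free v)}
    {Y. Y \<subseteq> set (bag (par v)) \<and> Y \<inter> set (sep v) = sub (sep v) i}"
proof -
  have "bij_betw ((\<lambda>A. sub (sep v) i \<union> A) \<circ> sub (free v)) {..<2 ^ length (free v)}
    {Y. Y \<subseteq> set (bag (par v)) \<and> Y \<inter> set (sep v) = sub (sep v) i}"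
  proof (rule bij_betw_trans[OF bij_sub[OF distinct_free[OF assms(1)]]])
    show "bij_betw ((\<union>) (sub (sep v) i)) {Y. Y \<subseteq> set (free v)}
      {Y. Y \<subseteq> set (bag (par v)) \<and> Y \<inter> set (sep v) = sub (sep v) i}"
      by (rule bij_betw_byWitness[where f' = "\<lambda>Y. Y - set (sep v)"])
        (use sub_subset[of "sep v" i] sep_subset_bag[OF assms(1)] in \<open>auto simp: set_free\<close>)
  qed
  then show ?thesis by (simp add: comp_def)
qed

lemma marg_index_less:
  "v \<in> {1..n} \<Longrightarrow> enc (bag (par v)) (sub (sep v) i) + enc (bag (par v)) (sub (free v) j) < 2 ^ length (bag (par v))"
  unfolding marg_enc by (rule enc_less)

lemma index_range:
  fixes i :: nat
  assumes "v \<in> {1..n}" "i < 2 ^ length (sep v)"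
  shows "2 * i < 2 ^ length (bag v)" "2 * i + 1 < 2 ^ length (bag v)"
  using assms by (auto simp: sep_len)

lemma var_range: "v \<le> n \<Longrightarrow> i < 2 ^ length (bag v) \<Longrightarrow> base v + i \<in> {n<..nv}"
  using base_bounds[of v] by auto

lemma sparse_ok_vertex:
  assumes v: "v \<in> {1..n}"
  shows "sparse_ok nv (vertex_row v)"
proof -
  have "distinct (map (\<lambda>i. base v + (2 * i + 1)) [0..<2 ^ length (sep v)])"
    by (auto simp: distinct_map inj_on_def)
  moreover have "base v + (2 * i + 1) \<in> {n<..nv}" if "i < 2 ^ length (sep v)" for i
    using var_range[OF _ index_range(2)[OF v that]] v by auto
  ultimately show ?thesis
    using v by (fastforce simp: sparse_ok_def vertex_row_def comp_def nv_def)
qed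

lemma sparse_ok_marg:
  assumes v: "v \<in> {1..n}" and i: "i < 2 ^ length (sep v)"
  shows "sparse_ok nv (marg_row v i)"
proof -
  define g where "g j = base (par v) + (enc (bag (par v)) (sub (sep v) i) + enc (bag (par v)) (sub (free v) j))" for j
  define a where "a = base v + 2 * i"
  define b where "b = base v + (2 * i + 1)"
  have "par v \<noteq> v" using par_pos[OF v] by auto
  have r: "g j \<in> {n<..nv}" "g j \<noteq> a" "g j \<noteq> b" for j
    unfolding g_def a_def b_def using var_range[OF par_le[OF v] marg_index_less[OF v]] base_inj[OF _ marg_index_less[OF v]]
      index_range[OF v i] \<open>par v \<noteq> v\<close> by blast+
  have "inj_on g {..<2 ^ length (free v)}"
  proof (rule inj_onI)
    fix j j' assume j: "j \<in> {..<2 ^ length (free v)}" "j' \<in> {..<2 ^ length (free v)}" and "g j = g j'"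
    then have "sub (bag (par v)) (enc (bag (par v)) (sub (sep v) i \<union> sub (free v) j))
       = sub (bag (par v)) (enc (bag (par v)) (sub (sep v) i \<union> sub (free v) j'))"
      by (simp add: marg_enc g_def)
    moreover have "sub (sep v) i \<union> sub (free v) j \<subseteq> set (bag (par v))" for j
      using sub_subset[of "sep v" i] sub_subset[of "free v" j] sep_subset_bag[OF v] set_free by blast
    ultimately have "sub (sep v) i \<union> sub (free v) j = sub (sep v) i \<union> sub (free v) j'"
      unfolding sub_enc by (simp add: Int_absorb2)
    with bij_marg[OF v i] j show "j = j'" unfolding bij_betw_def inj_on_def by blast
  qed
  then have "distinct (map g [0..<2 ^ length (free v)])"
    by (auto simp: distinct_map lessThan_atLeast0)
  moreover have "a \<in> {n<..nv}" "b \<in> {n<..nv}" "a \<noteq> b" unfolding a_def b_def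
    using var_range[OF _ index_range(1)[OF v i]] var_range[OF _ index_range(2)[OF v i]] v by simp_all
  moreover have "snd (snd (marg_row v i)) = (a, 1) # (b, 1) # map (\<lambda>j. (g j, -1)) [0..<2 ^ length (free v)]"
    by (simp add: marg_row_def a_def b_def g_def)
  moreover have "Suc 0 \<le> g j" for j using r(1)[of j] by auto
  ultimately show ?thesis
    using r unfolding sparse_ok_def by (auto simp: comp_def)
qed

lemma rows_ok:
  assumes "r \<in> set rows"
  shows "sparse_ok nv r"
proof -
  consider h where "n + 1 \<le> h" "h \<le> nv" "r = bound_row h" | "r = root_row"
    | v where "v \<in> {1..n}" "r = vertex_row v"
    | v i where "v \<in> {1..n}" "i < 2 ^ length (sep v)" "r = marg_row v i"
    using assms unfolding rows_def vertex_block_def by fastforce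
  then show ?thesis
    by cases (auto simp: sparse_ok_vertex sparse_ok_marg, auto simp: sparse_ok_def bound_row_def root_row_def nv_def)
qed

abbreviation lam :: "(nat \<Rightarrow> real) \<Rightarrow> nat \<Rightarrow> nat set \<Rightarrow> real" where
  "lam z v Y \<equiv> z (base v + enc (bag v) Y)"

lemma enc_even_odd:
  assumes "v \<in> {1..n}" "i < 2 ^ length (sep v)"
  shows "enc (bag v) (sub (sep v) i) = 2 * i" "enc (bag v) (insert v (sub (sep v) i)) = 2 * i + 1"
proof -
  have v: "v \<notin> sub (sep v) i" using notin_sep[OF assms(1)] sub_subset[of "sep v" i] by auto
  have e: "enc (sep v) (sub (sep v) i) = i" using enc_sub distinct_sep assms by blast
  have "enc (sep v) (insert v (sub (sep v) i)) = enc (sep v) (sub (sep v) i)"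
    using enc_inter[of "sep v" "insert v (sub (sep v) i)"] enc_inter[of "sep v" "sub (sep v) i"] notin_sep[OF assms(1)]
    by simp
  then show "enc (bag v) (sub (sep v) i) = 2 * i" "enc (bag v) (insert v (sub (sep v) i)) = 2 * i + 1"
    unfolding bag_Cons[OF assms(1)] using v e by (simp_all add: enc_Cons_even enc_Cons_odd)
qed

lemma all_sub:
  assumes "distinct L"
  shows "(\<forall>i<2 ^ length L. P (sub L i)) \<longleftrightarrow> (\<forall>Y\<subseteq>set L. P Y)"
proof -
  have "(\<forall>i<2 ^ length L. P (sub L i)) \<longleftrightarrow> (\<forall>Y\<in>sub L ` {..<2 ^ length L}. P Y)"
    unfolding ball_simps by (simp only: Ball_def lessThan_iff)
  also have "sub L ` {..<2 ^ length L} = {Y. Y \<subseteq> set L}"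
    using bij_sub[OF assms] by (simp add: bij_betw_def)
  finally show ?thesis by simp
qed

lemma holds_iff:
  assumes "sparse_ok nv (sn, b, as)"
  shows "sense_holds (row_sense (dense (sn, b, as))) (\<Sum>j = 1..nv. row_coeff (dense (sn, b, as)) j * z j)
     (row_rhs (dense (sn, b, as))) \<longleftrightarrow> sense_holds sn (\<Sum>(j, a)\<leftarrow>as. real_of_int a * z j) (real_of_int b)"
  using assms dense_sum[of as nv sn b z] by (simp add: sparse_ok_def) (simp add: dense_def)

definition satisfies :: "(nat \<Rightarrow> real) \<Rightarrow> sparse_row \<Rightarrow> bool" where
  "satisfies z r = (case r of (sn, b, as) \<Rightarrow> sense_holds sn (\<Sum>(j, a)\<leftarrow>as. real_of_int a * z j) (real_of_int b))"

lemma feasible_satisfies: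
  "z \<in> lp_feasible (the_lp c) \<longleftrightarrow> z \<in> {1..nv} \<rightarrow>\<^sub>E UNIV \<and> (\<forall>r\<in>set rows. satisfies z r)"
proof -
  have "sense_holds (row_sense (dense r)) (\<Sum>j = 1..nv. row_coeff (dense r) j * z j) (row_rhs (dense r))
      \<longleftrightarrow> satisfies z r" if "r \<in> set rows" for r
    using holds_iff[of "fst r" "fst (snd r)" "snd (snd r)" z] rows_ok[OF that]
    by (simp add: satisfies_def case_prod_beta)
  then show ?thesis by (auto simp: lp_feasible_def the_lp_def)
qed

lemma satisfies_vertex:
  assumes "v \<in> {1..n}"
  shows "satisfies z (vertex_row v) \<longleftrightarrow> z v = (\<Sum>Z | Z \<subseteq> set (sep v). lam z v (insert v Z))"
proof -
  have "(\<Sum>Z | Z \<subseteq> set (sep v). lam z v (insert v Z)) = (\<Sum>i<2 ^ length (sep v). lam z v (insert v (sub (sep v) i)))"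
    by (rule sum_sub[OF distinct_sep[OF assms], symmetric])
  also have "\<dots> = (\<Sum>i<2 ^ length (sep v). z (base v + (2 * i + 1)))"
    by (rule sum.cong) (use enc_even_odd[OF assms] in auto)
  also have "\<dots> = (\<Sum>i\<leftarrow>[0..<2 ^ length (sep v)]. z (base v + (2 * i + 1)))"
    by (simp add: interv_sum_list_conv_sum_set_nat lessThan_atLeast0)
  finally show ?thesis
    by (auto simp: satisfies_def vertex_row_def comp_def uminus_sum_list_map[symmetric, unfolded comp_def])
qed

lemma satisfies_marg:
  assumes "v \<in> {1..n}" "i < 2 ^ length (sep v)"
  shows "satisfies z (marg_row v i) \<longleftrightarrow> lam z v (sub (sep v) i) + lam z v (insert v (sub (sep v) i))
     = (\<Sum>Y | Y \<subseteq> set (bag (par v)) \<and> Y \<inter> set (sep v) = sub (sep v) i. lam z (par v) Y)"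
proof -
  have "(\<Sum>Y | Y \<subseteq> set (bag (par v)) \<and> Y \<inter> set (sep v) = sub (sep v) i. lam z (par v) Y)
     = (\<Sum>j<2 ^ length (free v). lam z (par v) (sub (sep v) i \<union> sub (free v) j))"
    by (rule sum.reindex_bij_betw[OF bij_marg[OF assms], symmetric])
  also have "\<dots> = (\<Sum>j\<leftarrow>[0..<2 ^ length (free v)].
      z (base (par v) + (enc (bag (par v)) (sub (sep v) i) + enc (bag (par v)) (sub (free v) j))))"
    by (simp add: interv_sum_list_conv_sum_set_nat lessThan_atLeast0 marg_enc)
  finally show ?thesis
    unfolding enc_even_odd[OF assms]
    by (auto simp: satisfies_def marg_row_def comp_def uminus_sum_list_map[symmetric, unfolded comp_def])
qed

lemma bad_iff:
  assumes "v \<le> n" "Y \<subseteq> set (bag v)"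
  shows "bad (base v + enc (bag v) Y) \<longleftrightarrow> (\<exists>i\<in>{1..m}. vert i = v \<and> \<not> acc i Y)"
proof
  assume "bad (base v + enc (bag v) Y)"
  then obtain i j where ij: "i \<in> {1..m}" "j < 2 ^ length (bag (vert i))"
    "base v + enc (bag v) Y = base (vert i) + j" "\<not> acc i (sub (bag (vert i)) j)" by (auto simp: bad_def)
  from base_inj[OF ij(3) enc_less ij(2)] have "v = vert i" "enc (bag v) Y = j" by auto
  then show "\<exists>i\<in>{1..m}. vert i = v \<and> \<not> acc i Y"
    using ij sub_enc[of "bag v" Y] assms(2) by (intro bexI[of _ i]) (auto simp: Int_absorb2)
next
  assume "\<exists>i\<in>{1..m}. vert i = v \<and> \<not> acc i Y"
  then show "bad (base v + enc (bag v) Y)"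
    using sub_enc[of "bag v" Y] assms(2) enc_less unfolding bad_def by (metis Int_absorb2)
qed

text \<open>The rows read in terms of subsets instead of their numbers.\<close>

lemma feasible_iff:
  "z \<in> lp_feasible (the_lp c) \<longleftrightarrow> z \<in> {1..nv} \<rightarrow>\<^sub>E UNIV \<and>
     (\<forall>h\<in>{n<..nv}. 0 \<le> z h \<and> (bad h \<longrightarrow> z h = 0)) \<and> lam z 0 {} = 1 \<and>
     (\<forall>v\<in>{1..n}. z v = (\<Sum>Z | Z \<subseteq> set (sep v). lam z v (insert v Z)) \<and>
       (\<forall>Z\<subseteq>set (sep v). lam z v Z + lam z v (insert v Z)
          = (\<Sum>Y | Y \<subseteq> set (bag (par v)) \<and> Y \<inter> set (sep v) = Z. lam z (par v) Y)))"
proof -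
  have b: "satisfies z (bound_row h) \<longleftrightarrow> 0 \<le> z h \<and> (bad h \<longrightarrow> z h = 0)" for h
    by (auto simp: satisfies_def bound_row_def)
  have r: "satisfies z root_row \<longleftrightarrow> lam z 0 {} = 1"
    by (simp add: satisfies_def root_row_def base_def enc_def bag_0)
  have "(\<forall>r\<in>set rows. satisfies z r) \<longleftrightarrow> (\<forall>h\<in>{n<..nv}. satisfies z (bound_row h)) \<and> satisfies z root_row \<and>
     (\<forall>v\<in>{1..n}. satisfies z (vertex_row v) \<and> (\<forall>i<2 ^ length (sep v). satisfies z (marg_row v i)))"
  proof -
    have "set rows = bound_row ` {n<..nv} \<union> {root_row} \<union>
        (\<Union>v\<in>{1..n}. insert (vertex_row v) (marg_row v ` {..<2 ^ length (sep v)}))"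
    proof -
      have "{n + 1..<nv + 1} = {n<..nv}" "{1..<n + 1} = {1..n}" by auto
      then show ?thesis by (simp only: rows_def vertex_block_def set_append set_map set_upt list.set
            set_concat image_image atLeast0LessThan) auto
    qed
    then show ?thesis by (simp only: ball_Un ball_simps image_iff lessThan_iff Ball_def UN_iff insert_iff) blast
  qed
  also have "\<dots> \<longleftrightarrow> (\<forall>h\<in>{n<..nv}. 0 \<le> z h \<and> (bad h \<longrightarrow> z h = 0)) \<and> lam z 0 {} = 1 \<and>
     (\<forall>v\<in>{1..n}. z v = (\<Sum>Z | Z \<subseteq> set (sep v). lam z v (insert v Z)) \<and>
       (\<forall>Z\<subseteq>set (sep v). lam z v Z + lam z v (insert v Z)
          = (\<Sum>Y | Y \<subseteq> set (bag (par v)) \<and> Y \<inter> set (sep v) = Z. lam z (par v) Y)))"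
    unfolding b r using satisfies_vertex satisfies_marg
      all_sub[OF distinct_sep, where P = "\<lambda>Z. lam z v Z + lam z v (insert v Z)
          = (\<Sum>Y | Y \<subseteq> set (bag (par v)) \<and> Y \<inter> set (sep v) = Z. lam z (par v) Y)" for v]
    by simp
  finally show ?thesis unfolding feasible_satisfies by simp
qed

definition solutions :: "nat set set" where
  "solutions = {X. X \<subseteq> {1..n} \<and> (\<forall>i\<in>{1..m}. acc i X)}"

lemma acc_bag: "i \<in> {1..m} \<Longrightarrow> acc i (X \<inter> set (bag (vert i))) = acc i X"
  using acc_local[of i "X \<inter> set (bag (vert i))"] acc_local[of i X] K_subset_bag[of i]
  by (metis Int_assoc inf.absorb_iff2)

text \<open>The variables of \<open>v\<close> describe the distribution concentrated on \<open>X \<inter> set (bag v)\<close>.\<close>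

lemma solution_lifts:
  assumes X: "X \<in> solutions"
  shows "point n X \<in> (\<lambda>z. restrict z {1..n}) ` lp_feasible (the_lp c)"
proof -
  define z where "z = restrict (\<lambda>h. if h \<le> n then of_bool (h \<in> X) else
    of_bool (\<exists>v\<le>n. h = base v + enc (bag v) (X \<inter> set (bag v))) :: real) {1..nv}"
  have lam: "lam z v Y = of_bool (Y = X \<inter> set (bag v))" if "v \<le> n" "Y \<subseteq> set (bag v)" for v Y
  proof -
    have "base v + enc (bag v) Y = base u + enc (bag u) (X \<inter> set (bag u)) \<longleftrightarrow> u = v \<and> Y = X \<inter> set (bag v)" for u
      using base_inj[OF _ enc_less enc_less] sub_enc[of "bag v"] that(2)
      by (metis Int_absorb2 inf_assoc inf_idem)
    moreover have "n < base v + enc (bag v) Y" "base v + enc (bag v) Y \<le> nv" "1 \<le> base v + enc (bag v) Y"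
      using var_range[OF that(1) enc_less[of "bag v" Y]] by auto
    ultimately show ?thesis using that(1) by (simp add: z_def)
  qed
  have "z \<in> lp_feasible (the_lp c)"
    unfolding feasible_iff
  proof (intro conjI ballI allI impI)
    show "z \<in> {1..nv} \<rightarrow>\<^sub>E UNIV" by (simp add: z_def)
    show "lam z 0 {} = 1" using lam[of 0 "{}"] by (simp add: bag_0)
    fix v assume v: "v \<in> {1..n}"
    have "(\<Sum>Z | Z \<subseteq> set (sep v). lam z v (insert v Z)) = (\<Sum>Z | Z \<subseteq> set (sep v). of_bool (insert v Z = X \<inter> set (bag v)))"
    proof (rule sum.cong[OF refl])
      fix Z assume "Z \<in> {Z. Z \<subseteq> set (sep v)}"
      then show "lam z v (insert v Z) = of_bool (insert v Z = X \<inter> set (bag v))"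
        using v set_bag[OF v] by (intro lam) auto
    qed
    also have "\<dots> = (\<Sum>Z | Z \<subseteq> set (sep v). if Z = X \<inter> set (sep v) then of_bool (v \<in> X) else 0)"
      by (rule sum.cong) (use notin_sep[OF v] set_bag[OF v] in auto)
    also have "\<dots> = of_bool (v \<in> X)" by (simp add: sum.delta)
    also have "\<dots> = z v" using v by (auto simp: z_def nv_def)
    finally show "z v = (\<Sum>Z | Z \<subseteq> set (sep v). lam z v (insert v Z))" ..
    fix Z assume Z: "Z \<subseteq> set (sep v)"
    have "lam z v Z + lam z v (insert v Z) = of_bool (Z = X \<inter> set (bag v)) + of_bool (insert v Z = X \<inter> set (bag v))"
    proof -
      have "Z \<subseteq> set (bag v)" "insert v Z \<subseteq> set (bag v)" using Z set_bag[OF v] by auto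
      then show ?thesis using lam[of v Z] lam[of v "insert v Z"] v by simp
    qed
    also have "\<dots> = of_bool (Z = X \<inter> set (sep v))"
    proof -
      have vZ: "v \<notin> Z" "v \<notin> X \<inter> set (sep v)" using Z notin_sep[OF v] by auto
      have XB: "X \<inter> set (bag v) = (if v \<in> X then insert v (X \<inter> set (sep v)) else X \<inter> set (sep v))"
        using set_bag[OF v] by auto
      show ?thesis
      proof (cases "v \<in> X")
        case True
        then have "Z \<noteq> X \<inter> set (bag v)" using XB vZ by auto
        moreover have "insert v Z = X \<inter> set (bag v) \<longleftrightarrow> Z = X \<inter> set (sep v)"
          using insert_ident[OF vZ] XB True by simp
        ultimately show ?thesis by simp
      next
        case False
        then have "insert v Z \<noteq> X \<inter> set (bag v)" by auto
        then show ?thesis using XB False by simp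
      qed
    qed
    also have "\<dots> = (\<Sum>Y | Y \<subseteq> set (bag (par v)) \<and> Y \<inter> set (sep v) = Z. if Y = X \<inter> set (bag (par v)) then 1 else 0)"
    proof -
      have "X \<inter> set (bag (par v)) \<inter> set (sep v) = X \<inter> set (sep v)" using sep_subset_bag[OF v] by auto
      then show ?thesis by (subst sum.delta) auto
    qed
    also have "\<dots> = (\<Sum>Y | Y \<subseteq> set (bag (par v)) \<and> Y \<inter> set (sep v) = Z. lam z (par v) Y)"
      by (rule sum.cong) (use lam[OF par_le[OF v]] in auto)
    finally show "lam z v Z + lam z v (insert v Z)
      = (\<Sum>Y | Y \<subseteq> set (bag (par v)) \<and> Y \<inter> set (sep v) = Z. lam z (par v) Y)" .
  next
    fix h assume h: "h \<in> {n<..nv}"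
    then show "0 \<le> z h" by (simp add: z_def)
    assume "bad h"
    show "z h = 0"
    proof (rule ccontr)
      assume "z h \<noteq> 0"
      then obtain v where v: "v \<le> n" "h = base v + enc (bag v) (X \<inter> set (bag v))"
        using h by (auto simp: z_def split: if_splits)
      with \<open>bad h\<close> bad_iff[of v "X \<inter> set (bag v)"] obtain i where
        "i \<in> {1..m}" "vert i = v" "\<not> acc i (X \<inter> set (bag v))" by auto
      with acc_bag[of i X] X show False by (auto simp: solutions_def)
    qed
  qed
  moreover have "point n X = restrict z {1..n}"
    by (rule ext) (auto simp: point_def z_def nv_def restrict_def)
  ultimately show ?thesis by blast
qed

text \<open>A set \<open>X\<close> violating constraint \<open>i\<close> has probability \<open>0\<close>: its trace on the bag at which the constraint is
  placed violates the constraint too, and the variable of that trace is forced to \<open>0\<close>.\<close>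

lemma feasible_projects:
  assumes "z \<in> lp_feasible (the_lp c)"
  shows "restrict z {1..n} \<in> convex hull (point n ` solutions)"
proof -
  note z = assms[unfolded feasible_iff]
  have nonneg: "0 \<le> lam z v Y" if "v \<le> n" for v Y
    using z var_range[OF that enc_less] by blast
  have "\<exists>q. (\<forall>X\<subseteq>{1..n}. 0 \<le> q X) \<and>
    (\<forall>v\<le>n. \<forall>Y\<subseteq>set (bag v). (\<Sum>X | X \<subseteq> {1..n} \<and> X \<inter> set (bag v) = Y. q X) = lam z v Y)"
  proof (rule glue)
    show "lam z 0 {} = 1" using z by simp
    show "lam z v Z + lam z v (insert v Z)
        = (\<Sum>Y | Y \<subseteq> set (bag (par v)) \<and> Y \<inter> set (sep v) = Z. lam z (par v) Y)"
      if "v \<in> {1..n}" "Z \<subseteq> set (sep v)" for v Z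
      using z that by simp
  qed (rule nonneg)
  then obtain q where G: "(\<forall>X\<subseteq>{1..n}. 0 \<le> q X) \<and>
    (\<forall>v\<le>n. \<forall>Y\<subseteq>set (bag v). (\<Sum>X | X \<subseteq> {1..n} \<and> X \<inter> set (bag v) = Y. q X) = lam z v Y)" ..
  have q0: "0 \<le> q X" if "X \<subseteq> {1..n}" for X
    using G[THEN conjunct1, THEN spec, THEN mp, OF that] .
  have q: "(\<Sum>X | X \<subseteq> {1..n} \<and> X \<inter> set (bag v) = Y. q X) = lam z v Y"
    if "v \<le> n" "Y \<subseteq> set (bag v)" for v Y
    using G[THEN conjunct2, THEN spec, THEN mp, OF that(1), THEN spec, THEN mp, OF that(2)] .
  have fin: "finite {X. X \<subseteq> {1..n} \<and> P X}" for P
    by (rule finite_subset[of _ "Pow {1..n}"]) auto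
  have fin': "finite {X. X \<subseteq> {1..n}}" using fin[of "\<lambda>_. True"] by simp
  have zero: "q X = 0" if X: "X \<subseteq> {1..n}" "X \<notin> solutions" for X
  proof -
    from X obtain i where i: "i \<in> {1..m}" "\<not> acc i X" by (auto simp: solutions_def)
    let ?v = "vert i" let ?Y = "X \<inter> set (bag ?v)"
    have "bad (base ?v + enc (bag ?v) ?Y)"
      using bad_iff[of ?v ?Y] vert_le[OF i(1)] acc_bag[OF i(1), of X] i by auto
    then have "lam z ?v ?Y = 0" using z var_range[OF vert_le[OF i(1)] enc_less] by blast
    then have "(\<Sum>X' | X' \<subseteq> {1..n} \<and> X' \<inter> set (bag ?v) = ?Y. q X') = 0"
      using q[OF vert_le[OF i(1)], of ?Y] by simp
    moreover have "q X \<le> (\<Sum>X' | X' \<subseteq> {1..n} \<and> X' \<inter> set (bag ?v) = ?Y. q X')"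
      using X q0 fin by (intro member_le_sum) auto
    ultimately show "q X = 0" using q0[OF X(1)] by simp
  qed
  have sub: "solutions \<subseteq> {X. X \<subseteq> {1..n}}" by (auto simp: solutions_def)
  have total: "(\<Sum>X\<in>solutions. q X) = 1"
  proof -
    have "(\<Sum>X\<in>solutions. q X) = (\<Sum>X | X \<subseteq> {1..n}. q X)"
      by (rule sum.mono_neutral_left[OF fin' sub]) (use zero in auto)
    also have "\<dots> = lam z 0 {}" using q[of 0 "{}"] by (simp add: bag_0)
    finally show ?thesis using z by simp
  qed
  have coord: "z v = (\<Sum>X\<in>solutions. q X * of_bool (v \<in> X))" if v: "v \<in> {1..n}" for v
  proof -
    have "(\<Sum>X\<in>solutions. q X * of_bool (v \<in> X)) = (\<Sum>X | X \<subseteq> {1..n}. q X * of_bool (v \<in> X))"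
      by (rule sum.mono_neutral_left[OF fin' sub]) (use zero in auto)
    also have "\<dots> = (\<Sum>X | X \<subseteq> {1..n} \<and> X \<inter> {v} = {v}. q X)"
      by (rule sum.mono_neutral_cong_right[OF fin']) auto
    also have "\<dots> = (\<Sum>Y | Y \<subseteq> set (bag v) \<and> Y \<inter> {v} = {v}. \<Sum>X | X \<subseteq> {1..n} \<and> X \<inter> set (bag v) = Y. q X)"
      by (rule sum_fibres) (use set_bag[OF v] in auto)
    also have "\<dots> = (\<Sum>Y | Y \<subseteq> set (bag v) \<and> Y \<inter> {v} = {v}. lam z v Y)"
      by (rule sum.cong) (use q v in auto)
    also have "\<dots> = (\<Sum>Z | Z \<subseteq> set (sep v). lam z v (insert v Z))"
    proof (rule sum.reindex_bij_betw[symmetric, where h = "insert v"])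
      show "bij_betw (insert v) {Z. Z \<subseteq> set (sep v)} {Y. Y \<subseteq> set (bag v) \<and> Y \<inter> {v} = {v}}"
        by (rule bij_betw_byWitness[where f' = "\<lambda>Y. Y - {v}"])
          (use notin_sep[OF v] set_bag[OF v] in auto)
    qed
    finally show ?thesis using z v by simp
  qed
  have "restrict z {1..n} = (\<Sum>X\<in>solutions. q X *\<^sub>R point n X)"
  proof
    fix v
    have "(\<Sum>X\<in>solutions. q X *\<^sub>R point n X) v = (\<Sum>X\<in>solutions. q X * point n X v)"
      using finite_subset[OF sub fin'] by (induction rule: finite_induct) (auto simp: scaleR_fun_def)
    also have "\<dots> = restrict z {1..n} v"
    proof (cases "v \<in> {1..n}")
      case True
      then show ?thesis using coord by (simp add: point_def)
    next
      case False
      then have "(\<Sum>X\<in>solutions. q X * point n X v) = (\<Sum>X\<in>solutions. q X) * undefined"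
        unfolding point_def sum_distrib_right by (intro sum.cong) auto
      then show ?thesis using False total by auto
    qed
    finally show "restrict z {1..n} v = (\<Sum>X\<in>solutions. q X *\<^sub>R point n X) v" ..
  qed
  also have "\<dots> \<in> convex hull (point n ` solutions)"
    by (rule convex_sum[OF finite_subset[OF sub fin'] convex_convex_hull total])
      (use q0 sub in \<open>auto intro: hull_inc\<close>)
  finally show ?thesis .
qed

lemma projection:
  "(\<lambda>z. restrict z {1..n}) ` lp_feasible (the_lp c) = convex hull (point n ` solutions)"
proof
  show "(\<lambda>z. restrict z {1..n}) ` lp_feasible (the_lp c) \<subseteq> convex hull (point n ` solutions)"
    using feasible_projects by blast
  show "convex hull (point n ` solutions) \<subseteq> (\<lambda>z. restrict z {1..n}) ` lp_feasible (the_lp c)"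
  proof (rule hull_minimal)
    show "point n ` solutions \<subseteq> (\<lambda>z. restrict z {1..n}) ` lp_feasible (the_lp c)"
      using solution_lifts by blast
    show "convex ((\<lambda>z. restrict z {1..n}) ` lp_feasible (the_lp c))"
    proof (rule convexI, elim imageE)
      fix x y x' y' and u v :: real
      assume uv: "0 \<le> u" "0 \<le> v" "u + v = 1" and x: "x = restrict x' {1..n}" "x' \<in> lp_feasible (the_lp c)"
        and y: "y = restrict y' {1..n}" "y' \<in> lp_feasible (the_lp c)"
      have "u * undefined + v * undefined = (undefined :: real)" using uv by (metis distrib_right mult_1)
      then have "u *\<^sub>R x + v *\<^sub>R y = restrict (u *\<^sub>R x' + v *\<^sub>R y') {1..n}"
        by (auto simp: x y scaleR_fun_def restrict_def fun_eq_iff)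
      moreover have "u *\<^sub>R x' + v *\<^sub>R y' \<in> lp_feasible (the_lp c)"
        using convexD[OF convex_lp_feasible x(2) y(2) uv] .
      ultimately show "u *\<^sub>R x + v *\<^sub>R y \<in> (\<lambda>z. restrict z {1..n}) ` lp_feasible (the_lp c)" by blast
    qed
  qed
qed

lemma unit_coefficients_the_lp: "unit_coefficients (the_lp c)"
  using unit_row[OF rows_ok] by (auto simp: unit_coefficients_def the_lp_def)

lemma lp_encoding_the_lp:
  "lp_encoding (the_lp c) ([int nv, int (length rows)] @ concat (map row_code rows))"
  unfolding lp_encoding_def
  by (intro exI[of _ "map row_code rows"])
    (auto simp: the_lp_def list_all2_conv_all_nth intro!: row_encoding_dense rows_ok)

lemma length_rows: "length rows = (nv - n) + 1 + (\<Sum>v = 1..n. 1 + 2 ^ length (sep v))"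
  by (simp add: rows_def vertex_block_def length_concat comp_def interv_sum_list_conv_sum_set_nat
      atLeastLessThanSuc_atLeastAtMost del: upt_Suc)

lemma size_the_lp:
  assumes "1 \<le> n" "w = Suc \<omega>"
  shows "nv \<le> 6 * 2 ^ \<omega> * n" "length rows \<le> 6 * 2 ^ \<omega> * n"
proof -
  have b: "2 ^ length (bag v) \<le> 2 * (2::nat) ^ \<omega>" "2 ^ length (sep v) \<le> (2::nat) ^ \<omega>" if "v \<in> {1..n}" for v
    using bag_power_le[of v] sep_len[OF that] that assms(2) by auto
  have "(\<Sum>v = 1..n. 2 ^ length (bag v)) \<le> (\<Sum>v = 1..n. 2 * (2::nat) ^ \<omega>)"
    by (rule sum_mono) (rule b)
  then have 1: "(\<Sum>v = 1..n. 2 ^ length (bag v)) \<le> 2 * 2 ^ \<omega> * n" by (simp add: mult.commute)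
  have "(\<Sum>v = 1..n. 1 + 2 ^ length (sep v)) \<le> (\<Sum>v = 1..n. 1 + (2::nat) ^ \<omega>)"
    by (rule sum_mono) (use b in simp)
  then have 2: "(\<Sum>v = 1..n. 1 + 2 ^ length (sep v)) \<le> n + 2 ^ \<omega> * n" by (simp add: mult.commute)
  have 3: "n \<le> 2 ^ \<omega> * n" by simp
  show "nv \<le> 6 * 2 ^ \<omega> * n" using 1 3 assms(1) unfolding nv_def by (simp only: mult.assoc; linarith)
  show "length rows \<le> 6 * 2 ^ \<omega> * n"
    using 1 2 3 assms(1) unfolding length_rows nv_def by (simp only: mult.assoc; linarith)
qed

end

section \<open>A program logic with running clocks\<close>

inductive_simps exec_Assign_iff: "exec orc (Assign x e) s t q s'"
inductive_simps exec_Store_iff: "exec orc (Store a e f) s t q s'"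
inductive_simps exec_Emit_iff: "exec orc (Emit e) s t q s'"
inductive_simps exec_Query_iff: "exec orc (Query x e a) s t q s'"
inductive_simps exec_Seq_iff: "exec orc (Seq p p') s t q s'"
inductive_simps exec_Cond_iff: "exec orc (Cond b p p') s t q s'"

text \<open>Predicates take the time and the number of queries elapsed since the start of the whole run. In this way sequencing
  is composition, and bounds on time and queries are ordinary parts of loop invariants.\<close>

definition wp ::
  "(int \<Rightarrow> (int \<Rightarrow> int) \<Rightarrow> bool) \<Rightarrow> prog \<Rightarrow> (state \<Rightarrow> nat \<Rightarrow> nat \<Rightarrow> bool) \<Rightarrow> state \<Rightarrow> nat \<Rightarrow> nat \<Rightarrow> bool"
  where "wp orc p R s t q \<longleftrightarrow> (\<exists>t' q' s'. exec orc p s t' q' s' \<and> R s' (t + t') (q + q'))"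

lemma wp_Assign [simp]:
  "wp orc (Assign x e) R s t q \<longleftrightarrow> R (set_reg x (eval_expr e s) s) (Suc t) q"
  by (simp add: wp_def exec_Assign_iff)

lemma wp_Store [simp]:
  "wp orc (Store a e f) R s t q \<longleftrightarrow>
    R (s\<lparr>arrs := (arrs s)(a := (arrs s a)(eval_expr e s := eval_expr f s))\<rparr>) (Suc t) q"
  by (simp add: wp_def exec_Store_iff)

lemma wp_Emit [simp]:
  "wp orc (Emit e) R s t q \<longleftrightarrow> R (s\<lparr>outp := outp s @ [eval_expr e s]\<rparr>) (Suc t) q"
  by (simp add: wp_def exec_Emit_iff)

lemma wp_Query [simp]:
  "wp orc (Query x e a) R s t q \<longleftrightarrow>
    R (set_reg x (if orc (eval_expr e s) (arrs s a) then 1 else 0) s) (Suc t) (Suc q)"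
  by (simp add: wp_def exec_Query_iff)

lemma wp_Seq [simp]: "wp orc (Seq p p') R s t q \<longleftrightarrow> wp orc p (wp orc p' R) s t q"
proof
  assume "wp orc (Seq p p') R s t q"
  then obtain t1 q1 s1 t2 q2 s2 where "exec orc p s t1 q1 s1" "exec orc p' s1 t2 q2 s2"
    "R s2 (t + (t1 + t2)) (q + (q1 + q2))"
    unfolding wp_def exec_Seq_iff by blast
  then show "wp orc p (wp orc p' R) s t q"
    unfolding wp_def by (metis add.assoc)
next
  assume "wp orc p (wp orc p' R) s t q"
  then obtain t1 q1 s1 t2 q2 s2 where "exec orc p s t1 q1 s1" "exec orc p' s1 t2 q2 s2"
    "R s2 (t + t1 + t2) (q + q1 + q2)"
    unfolding wp_def by blast
  then show "wp orc (Seq p p') R s t q"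
    unfolding wp_def by (metis add.assoc exec_Seq)
qed

lemma wp_Cond [simp]:
  "wp orc (Cond b p p') R s t q \<longleftrightarrow>
    (if eval_test b s then wp orc p R s (Suc t) q else wp orc p' R s (Suc t) q)"
proof -
  have *: "(\<exists>t' q' s'. (\<exists>t1. t' = t1 + 1 \<and> E t1 q' s') \<and> R s' (t + t') (q + q')) \<longleftrightarrow>
     (\<exists>t' q' s'. E t' q' s' \<and> R s' (Suc t + t') (q + q'))" for E
    by (rule iffI) (auto, (metis add_Suc_right)+)
  show ?thesis using *[of "exec orc p s"] *[of "exec orc p' s"]
    unfolding wp_def exec_Cond_iff by (cases "eval_test b s") simp_all
qed

primrec changed_regs :: "prog \<Rightarrow> string set" where
  "changed_regs (Assign x e) = {x}"
| "changed_regs (Store a e f) = {}"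
| "changed_regs (Emit e) = {}"
| "changed_regs (Query x e a) = {x}"
| "changed_regs (Seq p p') = changed_regs p \<union> changed_regs p'"
| "changed_regs (Cond b p p') = changed_regs p \<union> changed_regs p'"
| "changed_regs (While b p) = changed_regs p"

primrec changed_arrs :: "prog \<Rightarrow> string set" where
  "changed_arrs (Assign x e) = {}"
| "changed_arrs (Store a e f) = {a}"
| "changed_arrs (Emit e) = {}"
| "changed_arrs (Query x e a) = {}"
| "changed_arrs (Seq p p') = changed_arrs p \<union> changed_arrs p'"
| "changed_arrs (Cond b p p') = changed_arrs p \<union> changed_arrs p'"
| "changed_arrs (While b p) = changed_arrs p"

primrec silent :: "prog \<Rightarrow> bool" where
  "silent (Assign x e) = True"
| "silent (Store a e f) = True"
| "silent (Emit e) = False"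
| "silent (Query x e a) = True"
| "silent (Seq p p') = (silent p \<and> silent p')"
| "silent (Cond b p p') = (silent p \<and> silent p')"
| "silent (While b p) = silent p"

text \<open>The frame condition. The rules for composition and for loops supply it, so that invariants need
  only speak of what a program changes.\<close>

definition agree :: "prog \<Rightarrow> state \<Rightarrow> state \<Rightarrow> bool" where
  "agree p s s' \<longleftrightarrow> (\<forall>x. x \<notin> changed_regs p \<longrightarrow> regs s' x = regs s x) \<and>
     (\<forall>a. a \<notin> changed_arrs p \<longrightarrow> arrs s' a = arrs s a) \<and> (silent p \<longrightarrow> outp s' = outp s)"

lemma agree_refl [simp]: "agree p s s" by (simp add: agree_def)

lemma agree_trans: "agree p s s' \<Longrightarrow> agree p s' s'' \<Longrightarrow> agree p s s''"
  by (simp add: agree_def)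

lemma exec_agree: "exec orc p s t q s' \<Longrightarrow> agree p s s'"
  by (induction rule: exec.induct) (auto simp: agree_def set_reg_def)

lemma wp_conseq:
  assumes "wp orc p M s t q" "\<And>s' t' q'. agree p s s' \<Longrightarrow> M s' t' q' \<Longrightarrow> R s' t' q'"
  shows "wp orc p R s t q"
  using assms exec_agree unfolding wp_def by blast

lemma wp_cut:
  assumes "wp orc p M s t q"
    "\<And>s' t' q'. agree p s s' \<Longrightarrow> M s' t' q' \<Longrightarrow> wp orc p' R s' t' q'"
  shows "wp orc (Seq p p') R s t q"
  using wp_conseq[OF assms] by simp

lemma wp_While_unfold:
  assumes "if eval_test b s then wp orc p (wp orc (While b p) R) s (Suc t) q else R s (Suc t) q"
  shows "wp orc (While b p) R s t q"
proof (cases "eval_test b s")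
  case True
  with assms obtain t1 q1 s1 t2 q2 s2 where
    "exec orc p s t1 q1 s1" "exec orc (While b p) s1 t2 q2 s2" "R s2 (Suc t + t1 + t2) (q + q1 + q2)"
    unfolding wp_def by auto
  moreover from this True have "exec orc (While b p) s (t1 + t2 + 1) (q1 + q2) s2"
    by (blast intro: exec_WhileTrue)
  ultimately show ?thesis
    unfolding wp_def by (intro exI[of _ "t1 + t2 + 1"] exI[of _ "q1 + q2"] exI[of _ s2]) (simp add: ac_simps)
next
  case False
  then have "exec orc (While b p) s 1 0 s" by (rule exec_WhileFalse)
  with assms False show ?thesis unfolding wp_def by (auto intro!: exI)
qed

lemma wp_While:
  fixes V :: "state \<Rightarrow> nat"
  assumes "I s t q"
    "\<And>s' t' q'. agree p s s' \<Longrightarrow> I s' t' q' \<Longrightarrow> eval_test b s' \<Longrightarrow>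
       wp orc p (\<lambda>s'' t'' q''. I s'' t'' q'' \<and> V s'' < V s') s' (Suc t') q'"
    "\<And>s' t' q'. agree p s s' \<Longrightarrow> I s' t' q' \<Longrightarrow> \<not> eval_test b s' \<Longrightarrow> R s' (Suc t') q'"
  shows "wp orc (While b p) R s t q"
proof -
  have "agree p s s' \<Longrightarrow> I s' t' q' \<Longrightarrow> wp orc (While b p) R s' t' q'" for s' t' q'
  proof (induction "V s'" arbitrary: s' t' q' rule: less_induct)
    case less
    show ?case
    proof (rule wp_While_unfold, cases "eval_test b s'")
      case True
      have "wp orc p (wp orc (While b p) R) s' (Suc t') q'"
        by (rule wp_conseq[OF assms(2)[OF less.prems True]])
          (use less agree_trans in blast)
      with True show "if eval_test b s' then wp orc p (wp orc (While b p) R) s' (Suc t') q'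
        else R s' (Suc t') q'" by simp
    next
      case False
      with assms(3) less.prems show "if eval_test b s' then wp orc p (wp orc (While b p) R) s' (Suc t') q'
        else R s' (Suc t') q'" by simp
    qed
  qed
  with assms(1) show ?thesis by simp
qed

lemma wp_While_count:
  fixes l u :: nat
  assumes "J l s t q" "l \<le> u"
    "\<And>k s' t' q'. l \<le> k \<Longrightarrow> k < u \<Longrightarrow> agree p s s' \<Longrightarrow> J k s' t' q' \<Longrightarrow>
       eval_test b s' \<and> wp orc p (J (Suc k)) s' (Suc t') q'"
    "\<And>s' t' q'. agree p s s' \<Longrightarrow> J u s' t' q' \<Longrightarrow> \<not> eval_test b s' \<and> R s' (Suc t') q'"
  shows "wp orc (While b p) R s t q"
proof -
  have "l \<le> k \<Longrightarrow> k \<le> u \<Longrightarrow> agree p s s' \<Longrightarrow> J k s' t' q' \<Longrightarrow> wp orc (While b p) R s' t' q'" for k s' t' q'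
  proof (induction "u - k" arbitrary: k s' t' q')
    case 0
    with assms(4)[of s' t' q'] show ?case by (intro wp_While_unfold) simp
  next
    case (Suc d)
    then have k: "k < u" by simp
    note step = assms(3)[OF Suc.prems(1) k Suc.prems(3,4)]
    have "wp orc p (wp orc (While b p) R) s' (Suc t') q'"
    proof (rule wp_conseq[OF conjunct2[OF step]])
      fix s'' t'' q'' assume "agree p s' s''" "J (Suc k) s'' t'' q''"
      moreover from this have "agree p s s''" using Suc.prems(3) agree_trans by blast
      moreover have "d = u - Suc k" using Suc.hyps(2) by simp
      ultimately show "wp orc (While b p) R s'' t'' q''"
        using Suc.hyps(1)[of "Suc k" s'' t'' q''] Suc.prems(1) k by simp
    qed
    with step show ?case by (intro wp_While_unfold) simp
  qed
  from this[of l s t q] assms(1,2) show ?thesis by simp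
qed

definition count :: "string \<Rightarrow> expr \<Rightarrow> expr \<Rightarrow> prog \<Rightarrow> prog" where
  "count x a e p = Seq (Assign x a) (While (Less (Reg x) e) (Seq p (Assign x (Add (Reg x) (Const 1)))))"

lemma regs_set_reg [simp]: "regs (set_reg x k s) = (regs s)(x := k)"
  and arrs_set_reg [simp]: "arrs (set_reg x k s) = arrs s"
  and outp_set_reg [simp]: "outp (set_reg x k s) = outp s"
  by (simp_all add: set_reg_def)

lemma changed_regs_count [simp]: "changed_regs (count x a e p) = insert x (changed_regs p)"
  and changed_arrs_count [simp]: "changed_arrs (count x a e p) = changed_arrs p"
  and silent_count [simp]: "silent (count x a e p) = silent p"
  by (auto simp: count_def)

text \<open>The invariant has to be insensitive to the counter register, which it gets as the separate argument
  \<open>k\<close>. The clock shows one more unit for each test and each increment.\<close>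

lemma wp_count:
  fixes l u :: nat
  assumes "eval_expr a s = int l" "l \<le> u"
    and e: "\<And>s'. agree (count x a e p) s s' \<Longrightarrow> eval_expr e s' = int u"
    and x: "x \<notin> changed_regs p"
    and J0: "\<And>c. J l (set_reg x c s) (Suc t) q"
    and step: "\<And>k s' t' q'. l \<le> k \<Longrightarrow> k < u \<Longrightarrow> agree (count x a e p) s s' \<Longrightarrow>
       regs s' x = int k \<Longrightarrow> J k s' t' q' \<Longrightarrow>
       wp orc p (\<lambda>s'' t'' q''. \<forall>c. J (Suc k) (set_reg x c s'') (Suc t'') q'') s' (Suc t') q'"
    and fin: "\<And>s' t' q'. agree (count x a e p) s s' \<Longrightarrow> J u s' t' q' \<Longrightarrow> R s' (Suc t') q'"
  shows "wp orc (count x a e p) R s t q"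
proof -
  let ?p = "Seq p (Assign x (Add (Reg x) (Const 1)))"
  let ?s = "set_reg x (int l) s"
  have ag: "agree (count x a e p) s s'" if "agree ?p ?s s'" for s'
    using that by (auto simp: agree_def)
  have "wp orc (While (Less (Reg x) e) ?p) R ?s (Suc t) q"
  proof (rule wp_While_count[where l = l and u = u and J = "\<lambda>k s' t' q'. regs s' x = int k \<and> J k s' t' q'"])
    show "regs ?s x = int l \<and> J l ?s (Suc t) q"
      using J0 by simp
  next
    fix k s' t' q' assume k: "l \<le> k" "k < u" and a: "agree ?p ?s s'"
      and J: "regs s' x = int k \<and> J k s' t' q'"
    have "wp orc p (\<lambda>s'' t'' q''. \<forall>c. J (Suc k) (set_reg x c s'') (Suc t'') q'') s' (Suc t') q'"
      using J by (intro step[OF k ag[OF a]]) auto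
    then have "wp orc p (wp orc (Assign x (Add (Reg x) (Const 1)))
        (\<lambda>s' t' q'. regs s' x = int (Suc k) \<and> J (Suc k) s' t' q')) s' (Suc t') q'"
      by (rule wp_conseq) (use x J in \<open>simp add: agree_def\<close>)
    then show "eval_test (Less (Reg x) e) s' \<and>
        wp orc ?p (\<lambda>s' t' q'. regs s' x = int (Suc k) \<and> J (Suc k) s' t' q') s' (Suc t') q'"
      using e[OF ag[OF a]] J k by simp
  next
    fix s' t' q' assume a: "agree ?p ?s s'" and "regs s' x = int u \<and> J u s' t' q'"
    then show "\<not> eval_test (Less (Reg x) e) s' \<and> R s' (Suc t') q'"
      using e[OF ag[OF a]] fin[OF ag[OF a]] by simp
  qed (rule assms(2))
  then show ?thesis by (simp add: count_def assms(1))
qed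

section \<open>The construction as a program\<close>

text \<open>The arrays \<open>koff\<close> and \<open>toff\<close> hold the addresses of the sets \<open>K i\<close> and of the bags \<open>Q t\<close> in the input;
  \<open>head\<close>, \<open>nxt\<close>, \<open>dst\<close> the adjacency lists of the tree; \<open>qu\<close>, \<open>vis\<close> the queue and the visited nodes of the
  search; \<open>pos\<close> and \<open>ord\<close> the numbering of the vertices and its inverse. The elimination bag of \<open>v\<close> has
  \<open>len\<close> cells of \<open>bag\<close> from address \<open>off\<close> on; \<open>vert\<close> gives the vertex at which a constraint is placed and
  \<open>par\<close> the parent. The variables of \<open>v\<close> start at \<open>base\<close>, and \<open>bad\<close> marks those that are forced to \<open>0\<close>.
  The powers of two are tabulated in \<open>pw\<close>.\<close>

notation Assign (infix "::=" 61)
notation Seq (infixr ";;" 60)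
abbreviation skip :: prog where "skip \<equiv> Assign ''z'' (Const 0)"
abbreviation incr :: "string \<Rightarrow> prog" where "incr x \<equiv> Assign x (Add (Reg x) (Const 1))"
abbreviation plus1 :: "expr \<Rightarrow> expr" where "plus1 e \<equiv> Add e (Const 1)"

definition read_sizes :: prog where
  "read_sizes = ''n'' ::= Fetch ''input'' (Const 0) ;; ''m'' ::= Fetch ''input'' (Const 1) ;;
     ''N'' ::= Fetch ''input'' (Const 2) ;; ''a'' ::= Const 3"

text \<open>The input consists of length-prefixed lists; register \<open>a\<close> moves from the start of one list to the start of the next.\<close>

definition locate :: "string \<Rightarrow> string \<Rightarrow> prog" where
  "locate arr bound = count ''i'' (Const 1) (plus1 (Reg bound))
     (Store arr (Reg ''i'') (Reg ''a'') ;;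
      ''a'' ::= Add (Reg ''a'') (plus1 (Fetch ''input'' (Reg ''a''))))"

text \<open>Every edge is stored as two half-edges. The half-edges at a node form a list linked
  by \<open>nxt\<close> that starts at \<open>head\<close> and ends with \<open>0\<close>.\<close>

definition add_half_edge :: "string \<Rightarrow> string \<Rightarrow> prog" where
  "add_half_edge x y = incr ''h'' ;; Store ''dst'' (Reg ''h'') (Reg y) ;;
     Store ''nxt'' (Reg ''h'') (Fetch ''head'' (Reg x)) ;; Store ''head'' (Reg x) (Reg ''h'')"

definition read_edges :: prog where
  "read_edges = ''e'' ::= Fetch ''input'' (Reg ''a'') ;; ''h'' ::= Const 0 ;;
     count ''i'' (Const 0) (Reg ''e'')
       (''x'' ::= Fetch ''input'' (plus1 (Reg ''a'')) ;;
        ''y'' ::= Fetch ''input'' (Add (Reg ''a'') (Const 2)) ;;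
        ''a'' ::= Add (Reg ''a'') (Const 2) ;; add_half_edge ''x'' ''y'' ;; add_half_edge ''y'' ''x'')"

definition visit_neighbours :: prog where
  "visit_neighbours = ''h'' ::= Fetch ''head'' (Reg ''x'') ;;
     While (Neg (Equal (Reg ''h'') (Const 0)))
       (''d'' ::= Fetch ''dst'' (Reg ''h'') ;;
        Cond (Equal (Fetch ''vis'' (Reg ''d'')) (Const 0))
          (Store ''vis'' (Reg ''d'') (Const 1) ;; incr ''tail'' ;; Store ''qu'' (Reg ''tail'') (Reg ''d'')) skip ;;
        ''h'' ::= Fetch ''nxt'' (Reg ''h''))"

definition search_tree :: prog where
  "search_tree = Store ''vis'' (Const 1) (Const 1) ;; Store ''qu'' (Const 1) (Const 1) ;; ''tail'' ::= Const 1 ;;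
     ''i'' ::= Const 1 ;; While (Less (Reg ''i'') (plus1 (Reg ''tail'')))
       (''x'' ::= Fetch ''qu'' (Reg ''i'') ;; visit_neighbours ;; incr ''i'')"

text \<open>Position \<open>0\<close> marks a vertex that has not been met yet.\<close>

definition number_vertices :: prog where
  "number_vertices = ''c'' ::= Const 0 ;; count ''i'' (Const 1) (plus1 (Reg ''N''))
     (''a'' ::= Fetch ''toff'' (Fetch ''qu'' (Reg ''i'')) ;;
      count ''j'' (Const 0) (Fetch ''input'' (Reg ''a''))
        (''x'' ::= Fetch ''input'' (Add (plus1 (Reg ''a'')) (Reg ''j'')) ;;
         Cond (Equal (Fetch ''pos'' (Reg ''x'')) (Const 0))
           (incr ''c'' ;; Store ''pos'' (Reg ''x'') (Reg ''c'') ;; Store ''ord'' (Reg ''c'') (Reg ''x'')) skip))"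

text \<open>The bag of \<open>v\<close> has its cells from \<open>v * (n + 1)\<close> on. It never outgrows the \<open>n + 1\<close> cells up to the next bag.\<close>

definition initial_bags :: prog where
  "initial_bags = ''o'' ::= Const 0 ;; count ''i'' (Const 1) (plus1 (Reg ''n''))
     (''o'' ::= Add (Reg ''o'') (plus1 (Reg ''n'')) ;; Store ''off'' (Reg ''i'') (Reg ''o'') ;;
      Store ''len'' (Reg ''i'') (Const 1) ;; Store ''bag'' (Reg ''o'') (Reg ''i''))"

definition powers_of_two :: prog where
  "powers_of_two = Store ''pw'' (Const 0) (Const 1) ;; count ''i'' (Const 0) (Reg ''n'')
     (Store ''pw'' (plus1 (Reg ''i'')) (Add (Fetch ''pw'' (Reg ''i'')) (Fetch ''pw'' (Reg ''i''))))"

text \<open>The list is copied to \<open>tmp\<close>, because a separator is read from the very array that is going to be changed.\<close>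

definition find_last :: "string \<Rightarrow> prog" where
  "find_last A = ''p'' ::= Const 0 ;; count ''i'' (Const 0) (Reg ''b'')
     (''x'' ::= Fetch A (Add (Reg ''o'') (Reg ''i'')) ;; Store ''tmp'' (Reg ''i'') (Reg ''x'') ;;
      Cond (Less (Fetch ''pos'' (Reg ''p'')) (Fetch ''pos'' (Reg ''x''))) (''p'' ::= Reg ''x'') skip)"

definition insert_vertex :: prog where
  "insert_vertex = ''j'' ::= Const 0 ;;
     While (Conj (Less (Reg ''j'') (Fetch ''len'' (Reg ''p'')))
         (Neg (Equal (Fetch ''bag'' (Add (Fetch ''off'' (Reg ''p'')) (Reg ''j''))) (Reg ''x''))))
       (incr ''j'') ;;
     Cond (Equal (Reg ''j'') (Fetch ''len'' (Reg ''p'')))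
       (Store ''bag'' (Add (Fetch ''off'' (Reg ''p'')) (Reg ''j'')) (Reg ''x'') ;;
        Store ''len'' (Reg ''p'') (plus1 (Reg ''j''))) skip"

definition absorb_list :: "string \<Rightarrow> prog" where
  "absorb_list A = find_last A ;;
     count ''i'' (Const 0) (Reg ''b'') (''x'' ::= Fetch ''tmp'' (Reg ''i'') ;; insert_vertex)"

definition absorb_constraints :: prog where
  "absorb_constraints = count ''r'' (Const 1) (plus1 (Reg ''m''))
     (''o'' ::= plus1 (Fetch ''koff'' (Reg ''r'')) ;; ''b'' ::= Fetch ''input'' (Fetch ''koff'' (Reg ''r'')) ;;
      absorb_list ''input'' ;; Store ''vert'' (Reg ''r'') (Reg ''p''))"

definition absorb_separators :: prog where
  "absorb_separators = count ''r'' (Const 0) (Reg ''n'')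
     (''v'' ::= Fetch ''ord'' (Sub (Reg ''n'') (Reg ''r'')) ;;
      ''o'' ::= plus1 (Fetch ''off'' (Reg ''v'')) ;; ''b'' ::= Sub (Fetch ''len'' (Reg ''v'')) (Const 1) ;;
      absorb_list ''bag'' ;; Store ''par'' (Reg ''v'') (Reg ''p''))"

definition lay_out :: prog where
  "lay_out = Store ''base'' (Const 0) (plus1 (Reg ''n'')) ;; ''h'' ::= Add (Reg ''n'') (Const 2) ;; ''e'' ::= Const 0 ;;
     count ''r'' (Const 1) (plus1 (Reg ''n''))
       (Store ''base'' (Reg ''r'') (Reg ''h'') ;;
        ''h'' ::= Add (Reg ''h'') (Fetch ''pw'' (Fetch ''len'' (Reg ''r''))) ;;
        ''e'' ::= Add (Reg ''e'') (plus1 (Fetch ''pw'' (Sub (Fetch ''len'' (Reg ''r'')) (Const 1))))) ;;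
     ''nv'' ::= Sub (Reg ''h'') (Const 1) ;; Emit (Reg ''nv'') ;;
     Emit (Add (plus1 (Sub (Reg ''nv'') (Reg ''n''))) (Reg ''e''))"

text \<open>Runs through the binary digits of \<open>ge\<close> from the highest one. The subset of the list with this number
  is written to \<open>y\<close>, as a 0-1 vector on the list, and the sum of the weights \<open>wt\<close> of its members to \<open>acc\<close>.\<close>

definition decode :: "string \<Rightarrow> expr \<Rightarrow> expr \<Rightarrow> expr \<Rightarrow> prog" where
  "decode A oe be ge = ''rem'' ::= ge ;; ''acc'' ::= Const 0 ;; ''k'' ::= be ;;
     While (Less (Const 0) (Reg ''k''))
       (''k'' ::= Sub (Reg ''k'') (Const 1) ;; ''x'' ::= Fetch A (Add oe (Reg ''k'')) ;;
        Cond (Less (Reg ''rem'') (Fetch ''pw'' (Reg ''k'')))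
          (Store ''y'' (Reg ''x'') (Const 0))
          (Store ''y'' (Reg ''x'') (Const 1) ;; ''rem'' ::= Sub (Reg ''rem'') (Fetch ''pw'' (Reg ''k'')) ;;
           ''acc'' ::= Add (Reg ''acc'') (Fetch ''wt'' (Reg ''x''))))"

text \<open>The queries for a constraint run over all subsets of the bag at which the constraint is placed, since the
  variables to be forced to \<open>0\<close> belong to these subsets.\<close>

definition query_constraints :: prog where
  "query_constraints = count ''r'' (Const 1) (plus1 (Reg ''m''))
     (''v'' ::= Fetch ''vert'' (Reg ''r'') ;; ''o'' ::= Fetch ''off'' (Reg ''v'') ;; ''b'' ::= Fetch ''len'' (Reg ''v'') ;;
      count ''i'' (Const 0) (Fetch ''pw'' (Reg ''b''))
        (decode ''bag'' (Reg ''o'') (Reg ''b'') (Reg ''i'') ;; Query ''d'' (Reg ''r'') ''y'' ;;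
         Cond (Equal (Reg ''d'') (Const 0))
           (Store ''bad'' (Add (Fetch ''base'' (Reg ''v'')) (Reg ''i'')) (Const 1)) skip))"

text \<open>An inequality \<open>\<ge> 0\<close>, with sense code \<open>1\<close>, becomes an equation, with code \<open>0\<close>, for forbidden subsets. The five last
  commands write the row for vertex \<open>0\<close>, whose only variable is \<open>n + 1\<close>.\<close>

definition emit_bounds :: prog where
  "emit_bounds = count ''r'' (plus1 (Reg ''n'')) (plus1 (Reg ''nv''))
     (Emit (Sub (Const 1) (Fetch ''bad'' (Reg ''r''))) ;; Emit (Const 0) ;; Emit (Const 1) ;;
      Emit (Reg ''r'') ;; Emit (Const 1)) ;;
     Emit (Const 0) ;; Emit (Const 1) ;; Emit (Const 1) ;; Emit (plus1 (Reg ''n'')) ;; Emit (Const 1)"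

definition emit_vertex_row :: prog where
  "emit_vertex_row =
     ''o'' ::= plus1 (Fetch ''off'' (Reg ''r'')) ;; ''b'' ::= Sub (Fetch ''len'' (Reg ''r'')) (Const 1) ;;
     ''a'' ::= Fetch ''base'' (Reg ''r'') ;;
     Emit (Const 0) ;; Emit (Const 0) ;; Emit (plus1 (Fetch ''pw'' (Reg ''b''))) ;; Emit (Reg ''r'') ;; Emit (Const 1) ;;
     count ''i'' (Const 0) (Fetch ''pw'' (Reg ''b''))
       (Emit (plus1 (Add (Reg ''a'') (Add (Reg ''i'') (Reg ''i'')))) ;; Emit (Const (-1)))"

text \<open>The members of the separator of \<open>r\<close> are marked with \<open>r\<close>, which no earlier vertex has used as its mark. The
  weights are the values of the bits in the numbering of subsets of the bag of the parent.\<close>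

definition split_parent :: prog where
  "split_parent = ''p'' ::= Fetch ''par'' (Reg ''r'') ;;
     count ''i'' (Const 0) (Reg ''b'') (Store ''mark'' (Fetch ''bag'' (Add (Reg ''o'') (Reg ''i''))) (Reg ''r'')) ;;
     ''f'' ::= Const 0 ;;
     count ''i'' (Const 0) (Fetch ''len'' (Reg ''p''))
       (''x'' ::= Fetch ''bag'' (Add (Fetch ''off'' (Reg ''p'')) (Reg ''i'')) ;;
        Store ''wt'' (Reg ''x'') (Fetch ''pw'' (Reg ''i'')) ;;
        Cond (Equal (Fetch ''mark'' (Reg ''x'')) (Reg ''r'')) skip
          (Store ''free'' (Reg ''f'') (Reg ''x'') ;; incr ''f''))"

definition emit_marg_rows :: prog where
  "emit_marg_rows = count ''i'' (Const 0) (Fetch ''pw'' (Reg ''b''))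
     (decode ''bag'' (Reg ''o'') (Reg ''b'') (Reg ''i'') ;; ''u'' ::= Add (Fetch ''base'' (Reg ''p'')) (Reg ''acc'') ;;
      Emit (Const 0) ;; Emit (Const 0) ;; Emit (Add (Fetch ''pw'' (Reg ''f'')) (Const 2)) ;;
      Emit (Add (Reg ''a'') (Add (Reg ''i'') (Reg ''i''))) ;; Emit (Const 1) ;;
      Emit (plus1 (Add (Reg ''a'') (Add (Reg ''i'') (Reg ''i'')))) ;; Emit (Const 1) ;;
      count ''j'' (Const 0) (Fetch ''pw'' (Reg ''f''))
        (decode ''free'' (Const 0) (Reg ''f'') (Reg ''j'') ;; Emit (Add (Reg ''u'') (Reg ''acc'')) ;; Emit (Const (-1))))"

definition emit_vertices :: prog where
  "emit_vertices = count ''r'' (Const 1) (plus1 (Reg ''n'')) (emit_vertex_row ;; split_parent ;; emit_marg_rows)"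

definition construct :: prog where
  "construct = read_sizes ;; locate ''koff'' ''m'' ;; locate ''toff'' ''N'' ;; read_edges ;;
     search_tree ;; number_vertices ;; initial_bags ;; powers_of_two ;;
     absorb_constraints ;; absorb_separators ;; lay_out ;; query_constraints ;; emit_bounds ;; emit_vertices"

section \<open>Locating the lists of the input\<close>

lemma locate_wp:
  fixes off cd :: "nat \<Rightarrow> nat"
  assumes "arr \<noteq> ''input''" "bound \<noteq> ''i''" "bound \<noteq> ''a''"
    and "regs s bound = int b" "regs s ''a'' = int (off 1)"
    and off: "\<And>i. 1 \<le> i \<Longrightarrow> i \<le> b \<Longrightarrow> off (Suc i) = off i + cd i + 1"
    and cd: "\<And>i. 1 \<le> i \<Longrightarrow> i \<le> b \<Longrightarrow> arrs s ''input'' (int (off i)) = int (cd i)"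
  shows "wp orc (locate arr bound) (\<lambda>s' t' q'. q' = q \<and> t' = t + 4 * b + 2 \<and>
     (\<forall>i\<in>{1..b}. arrs s' arr (int i) = int (off i)) \<and> regs s' ''a'' = int (off (Suc b))) s t q"
  unfolding locate_def
proof (rule wp_count[where l = 1 and u = "Suc b" and J = "\<lambda>k s' t' q'. q' = q \<and> t' + 4 = t + 4 * k + 1 \<and>
     (\<forall>i. 1 \<le> i \<and> i < k \<longrightarrow> arrs s' arr (int i) = int (off i)) \<and> regs s' ''a'' = int (off k)"])
  fix k s' t' q'
  assume "1 \<le> k" "k < Suc b" and a: "agree (count ''i'' (Const 1) (plus1 (Reg bound))
         (Store arr (Reg ''i'') (Reg ''a'') ;; ''a'' ::= Add (Reg ''a'') (plus1 (Fetch ''input'' (Reg ''a''))))) s s'"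
    and "regs s' ''i'' = int k" "q' = q \<and> t' + 4 = t + 4 * k + 1 \<and>
     (\<forall>i. 1 \<le> i \<and> i < k \<longrightarrow> arrs s' arr (int i) = int (off i)) \<and> regs s' ''a'' = int (off k)"
  moreover have "arrs s' ''input'' = arrs s ''input''" using a assms(1) by (simp add: agree_def)
  ultimately show "wp orc (Store arr (Reg ''i'') (Reg ''a'') ;; ''a'' ::= Add (Reg ''a'') (plus1 (Fetch ''input'' (Reg ''a''))))
        (\<lambda>s'' t'' q''. \<forall>c. q'' = q \<and> Suc t'' + 4 = t + 4 * Suc k + 1 \<and>
         (\<forall>i. 1 \<le> i \<and> i < Suc k \<longrightarrow> arrs (set_reg ''i'' c s'') arr (int i) = int (off i)) \<and>
         regs (set_reg ''i'' c s'') ''a'' = int (off (Suc k))) s' (Suc t') q'"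
    using off[of k] cd[of k] assms(1) by (auto simp: less_Suc_eq)
next
  fix s' assume "agree (count ''i'' (Const 1) (plus1 (Reg bound))
         (Store arr (Reg ''i'') (Reg ''a'') ;; ''a'' ::= Add (Reg ''a'') (plus1 (Fetch ''input'' (Reg ''a''))))) s s'"
  then show "eval_expr (plus1 (Reg bound)) s' = int (Suc b)"
    using assms(2-4) by (simp add: agree_def)
qed (use assms in \<open>auto simp: less_Suc_eq_le\<close>)

section \<open>Searching the tree\<close>

text \<open>The last half-edge at \<open>x\<close> before \<open>k\<close>, or \<open>0\<close>: the link that half-edge \<open>k\<close> finds in \<open>head\<close>.\<close>

primrec prevh :: "(nat \<Rightarrow> nat) \<Rightarrow> nat \<Rightarrow> nat \<Rightarrow> nat" where
  "prevh src x 0 = 0"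
| "prevh src x (Suc k) = (if 1 \<le> k \<and> src k = x then k else prevh src x k)"

lemma prevh_props:
  "prevh src x k = 0 \<or> 1 \<le> prevh src x k \<and> prevh src x k < k \<and> src (prevh src x k) = x"
  "1 \<le> g \<Longrightarrow> g < k \<Longrightarrow> src g = x \<Longrightarrow> g \<le> prevh src x k"
  by (induction k) (auto simp: less_Suc_eq)

definition half_src :: "(nat \<times> nat) list \<Rightarrow> nat \<Rightarrow> nat" where
  "half_src es h = (if odd h then fst (es ! ((h - 1) div 2)) else snd (es ! ((h - 1) div 2)))"
definition half_dst :: "(nat \<times> nat) list \<Rightarrow> nat \<Rightarrow> nat" where
  "half_dst es h = (if odd h then snd (es ! ((h - 1) div 2)) else fst (es ! ((h - 1) div 2)))"

lemma half_simps:
  "half_src es (Suc (2 * i)) = fst (es ! i)" "half_src es (Suc (Suc (2 * i))) = snd (es ! i)"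
  "half_dst es (Suc (2 * i)) = snd (es ! i)" "half_dst es (Suc (Suc (2 * i))) = fst (es ! i)"
  by (simp_all add: half_src_def half_dst_def)

lemma half_cases:
  assumes "h \<in> {1..2 * M}"
  obtains i where "i < M" "h = Suc (2 * i)" | i where "i < M" "h = Suc (Suc (2 * i))"
proof (cases "odd h")
  case True
  then obtain i where "h = 2 * i + 1" by (elim oddE)
  with assms that(1)[of i] show ?thesis by auto
next
  case False
  then have "even h" by simp
  then obtain i where "h = 2 * i" by (elim evenE)
  with assms that(2)[of "i - 1"] show ?thesis by auto
qed

definition adjacency :: "(nat \<times> nat) list \<Rightarrow> nat \<Rightarrow> state \<Rightarrow> bool" where
  "adjacency es H s \<longleftrightarrow> (\<forall>x. arrs s ''head'' (int x) = int (prevh (half_src es) x (Suc H))) \<and>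
     (\<forall>h. 1 \<le> h \<longrightarrow> h \<le> H \<longrightarrow> arrs s ''nxt'' (int h) = int (prevh (half_src es) (half_src es h) h) \<and>
        arrs s ''dst'' (int h) = int (half_dst es h))"

lemma adjacency_set_reg [simp]: "adjacency es H (set_reg x c s) = adjacency es H s"
  by (simp add: adjacency_def)

lemma add_half_edge_wp:
  assumes "adjacency es H s" "regs s ''h'' = int H" "regs s x = int (half_src es (Suc H))"
    "regs s y = int (half_dst es (Suc H))" "x \<noteq> ''h''" "y \<noteq> ''h''"
  shows "wp orc (add_half_edge x y) (\<lambda>s' t' q'. adjacency es (Suc H) s' \<and> regs s' ''h'' = int (Suc H) \<and>
     t' = t + 4 \<and> q' = q) s t q"
  using assms by (auto simp: add_half_edge_def adjacency_def le_Suc_eq of_nat_Suc[symmetric] add.commute simp del: of_nat_Suc)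

lemma read_edges_wp:
  assumes "regs s ''a'' = int a" "arrs s ''input'' (int a) = int (length es)"
    and inp: "\<And>i. i < length es \<Longrightarrow> arrs s ''input'' (int (a + 1 + 2 * i)) = int (fst (es ! i)) \<and>
         arrs s ''input'' (int (a + 2 + 2 * i)) = int (snd (es ! i))"
    and "\<And>x. arrs s ''head'' (int x) = 0"
  shows "wp orc read_edges (\<lambda>s' t' q'. adjacency es (2 * length es) s' \<and> t' = t + 13 * length es + 4 \<and> q' = q) s t q"
  unfolding read_edges_def wp_Seq wp_Assign
proof (rule wp_count[where l = 0 and u = "length es" and J = "\<lambda>k s' t' q'. q' = q \<and> t' = t + 13 * k + 3 \<and>
     adjacency es (2 * k) s' \<and> regs s' ''h'' = int (2 * k) \<and> regs s' ''a'' = int (a + 2 * k)"], goal_cases)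
  case (6 k s' t' q')
  have i: "arrs s' ''input'' = arrs s ''input''" using 6(3) by (simp add: agree_def add_half_edge_def)
  have i1: "arrs s' ''input'' (1 + regs s' ''a'') = int (half_src es (Suc (2 * k)))"
    and i2: "arrs s' ''input'' (2 + regs s' ''a'') = int (half_dst es (Suc (2 * k)))"
    using inp[OF 6(2)] 6(5) unfolding i half_simps by (simp_all add: algebra_simps)
  show ?case
    unfolding wp_Seq wp_Assign
    apply (rule wp_conseq[OF add_half_edge_wp[where H = "2 * k" and es = es]])
    using 6(5) i1 i2
         apply (simp_all add: adjacency_def add.commute)[6]
    apply (rule wp_conseq[OF add_half_edge_wp[where H = "Suc (2 * k)" and es = es]])
    using 6(5) i1 i2
         apply (simp_all add: half_simps agree_def add_half_edge_def add.commute add.left_commute)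
    done
qed (use assms in \<open>auto simp: agree_def add_half_edge_def adjacency_def\<close>)

definition queued :: "nat list \<Rightarrow> state \<Rightarrow> bool" where
  "queued q s \<longleftrightarrow> regs s ''tail'' = int (length q) \<and> (\<forall>i<length q. arrs s ''qu'' (int (Suc i)) = int (q ! i)) \<and>
     (\<forall>d. arrs s ''vis'' (int d) \<noteq> 0 \<longleftrightarrow> d \<in> set q)"

text \<open>\<open>A h\<close> collects the half-edges at \<open>x\<close> that have been handled when \<open>h\<close> is next in the list.\<close>

lemma visit_neighbours_wp:
  fixes es :: "(nat \<times> nat) list"
  defines "H \<equiv> {1..2 * length es}"
  assumes adj: "adjacency es (2 * length es) s" and "queued q s" "distinct q" "regs s ''x'' = int x"
  shows "wp orc visit_neighbours (\<lambda>s' t' k'. k' = k \<and>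
     t' \<le> t + 7 * card {h \<in> H. half_src es h = x} + 2 \<and>
     (\<exists>zs. queued (q @ zs) s' \<and> distinct (q @ zs) \<and> set (q @ zs) = set q \<union> half_dst es ` {h \<in> H. half_src es h = x})) s t k"
proof -
  let ?src = "half_src es"
  define A where "A h = {g \<in> H. ?src g = x \<and> h < g}" for h
  have A0: "A 0 = {h \<in> H. ?src h = x}" by (auto simp: A_def H_def)
  have Afin: "finite (A h)" for h by (simp add: A_def H_def)
  have Anext: "A (prevh ?src x h) = insert h (A h)" if "h \<in> H" "?src h = x" for h
  proof (intro equalityI subsetI)
    fix g assume g: "g \<in> A (prevh ?src x h)"
    have "\<not> g < h" using prevh_props(2)[where g = g and k = h and src = ?src and x = x] g
      by (auto simp: A_def H_def)
    then show "g \<in> insert h (A h)" using g by (auto simp: A_def)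
  next
    fix g assume "g \<in> insert h (A h)"
    moreover have "prevh ?src x h < h"
      using prevh_props(1)[where k = h and src = ?src and x = x] that by (auto simp: H_def)
    ultimately show "g \<in> A (prevh ?src x h)" using that by (auto simp: A_def)
  qed
  have Aend: "A (prevh ?src x (Suc (2 * length es))) = {}"
  proof -
    have "g \<le> prevh ?src x (Suc (2 * length es))" if "g \<in> H" "?src g = x" for g
      using that by (intro prevh_props(2)) (auto simp: H_def)
    then show ?thesis unfolding A_def by (metis (mono_tags, lifting) Collect_empty_eq leD)
  qed
    define I where "I s' t' k' \<longleftrightarrow> k' = k \<and>
      (\<exists>h zs. regs s' ''h'' = int h \<and> (h = 0 \<or> h \<in> H \<and> ?src h = x) \<and> t' \<le> t + 7 * card (A h) + 1 \<and>
        queued (q @ zs) s' \<and> distinct (q @ zs) \<and> set (q @ zs) = set q \<union> half_dst es ` A h)" for s' t' k'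
  show ?thesis unfolding visit_neighbours_def wp_Seq wp_Assign
  proof (rule wp_While[where V = "\<lambda>s. nat (regs s ''h'')" and I = I], goal_cases)
    case 1
    let ?h = "prevh ?src x (Suc (2 * length es))"
    have "?h = 0 \<or> ?h \<in> H \<and> ?src ?h = x"
      using prevh_props(1)[where src = ?src and x = x and k = "Suc (2 * length es)"] by (auto simp: H_def simp del: prevh.simps)
    moreover have "arrs s ''head'' (int x) = int ?h" using adj by (simp add: adjacency_def del: prevh.simps)
    ultimately show ?case using assms Aend unfolding I_def
      by (intro conjI exI[of _ ?h] exI[of _ "[]"]) (simp_all add: queued_def del: prevh.simps)
  next
    case (2 s' t' q')
    from 2(2) obtain h zs where h: "regs s' ''h'' = int h" "h = 0 \<or> h \<in> H \<and> ?src h = x" "t' \<le> t + 7 * card (A h) + 1"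
      "queued (q @ zs) s'" "distinct (q @ zs)" "set (q @ zs) = set q \<union> half_dst es ` A h" "q' = k" unfolding I_def by blast
    with 2(3) have hH: "h \<in> H" "?src h = x" by auto
    let ?d = "half_dst es h" and ?h = "prevh ?src x h"
    have ar: "arrs s' ''nxt'' = arrs s ''nxt''" "arrs s' ''dst'' = arrs s ''dst''"
      using 2(1) by (simp_all add: agree_def)
    have nx: "arrs s' ''nxt'' (int h) = int ?h" "arrs s' ''dst'' (int h) = int ?d"
      using adj hH unfolding ar by (auto simp: adjacency_def H_def)
    have h': "?h = 0 \<or> ?h \<in> H \<and> ?src ?h = x" "?h < h"
      using prevh_props(1)[where src = ?src and x = x and k = h] hH by (auto simp: H_def)
    have "h \<notin> A h" by (simp add: A_def)
    then have c: "card (A ?h) = Suc (card (A h))" using Anext[OF hH] Afin by simp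
    have vis: "arrs s' ''vis'' (int ?d) \<noteq> 0 \<longleftrightarrow> ?d \<in> set (q @ zs)" using h(4) by (simp add: queued_def)
    have I: "I s'' t'' k" if "regs s'' ''h'' = int ?h" "t'' \<le> t' + 7" "queued (q @ zs') s''"
      "distinct (q @ zs')" "set (q @ zs') = set q \<union> half_dst es ` A ?h" for s'' t'' zs'
    proof -
      have "t'' \<le> t + 7 * card (A ?h) + 1" using that(2) h(3) c by simp
      then show ?thesis unfolding I_def using that h'(1) by blast
    qed
    have hn: "nat (regs s'' ''h'') < nat (regs s' ''h'')" if "regs s'' ''h'' = int ?h" for s''
      using that h(1) h'(2) by simp
    show ?case
    proof (cases "?d \<in> set (q @ zs)")
      case True
      have eq: "set (q @ zs) = set q \<union> half_dst es ` A ?h" unfolding Anext[OF hH] using h(6) True by auto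
      have v1: "arrs s' ''vis'' (int ?d) \<noteq> 0" using vis True by simp
      show ?thesis
        by (simp add: h(1) nx v1 h(7), intro conjI I[where zs' = zs] h(5) eq)
          (use h(1,4) h'(2) in \<open>simp_all add: queued_def\<close>)
    next
      case False
      have qd: "queued (q @ zs @ [?d]) s''" if "regs s'' ''tail'' = int (Suc (length (q @ zs)))"
        "arrs s'' ''qu'' = (arrs s' ''qu'')(int (Suc (length (q @ zs))) := int ?d)"
        "arrs s'' ''vis'' = (arrs s' ''vis'')(int ?d := 1)" for s''
        using that h(4) unfolding queued_def by (auto simp: nth_append less_Suc_eq)
      have eq: "set (q @ zs @ [?d]) = set q \<union> half_dst es ` A ?h" unfolding Anext[OF hH] using h(6) by auto
      have di: "distinct (q @ zs @ [?d])" using False h(5) by auto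
      have "regs s' ''tail'' = int (length (q @ zs))" using h(4) by (simp add: queued_def)
      moreover have "arrs s' ''vis'' (int ?d) = 0" using vis False by simp
      ultimately show ?thesis
        by (simp add: h(1) nx h(7), intro conjI I[where zs' = "zs @ [?d]"] di eq qd)
          (use h(1) h'(2) in \<open>simp_all add: ac_simps\<close>)
    qed
  next
    case (3 s' t' q')
    then show ?case using A0 by (auto simp: I_def)
  qed
qed

text \<open>When the queue is exhausted, the queued nodes are closed under adjacency, hence they are all nodes. Time is
  charged to the nodes taken from the queue and to the half-edges \<open>D q j\<close> at them, of which there are at most
  \<open>2 * length es\<close> altogether.\<close>

lemma search_tree_wp:
  fixes es :: "(nat \<times> nat) list" and N :: nat
  assumes adj: "adjacency es (2 * length es) s"
    and tree: "is_tree {1..N} ET" and ET: "set (map (\<lambda>(s, t). {s, t}) es) = ET"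
    and vis: "\<And>d. arrs s ''vis'' (int d) = 0"
  shows "wp orc search_tree (\<lambda>s' t' k'. k' = k \<and> t' \<le> t + 6 * N + 14 * length es + 5 \<and>
     (\<exists>q. search_order {1..N} ET q \<and> (\<forall>i<N. arrs s' ''qu'' (int (Suc i)) = int (q ! i)))) s t k"
proof -
  define H where "H = {1..2 * length es}"
  let ?src = "half_src es" and ?dst = "half_dst es"
  have edge: "{?src h, ?dst h} \<in> ET" if "h \<in> H" for h
    using that unfolding H_def ET[symmetric]
    by (cases rule: half_cases) (auto simp: half_simps case_prod_beta insert_commute intro!: image_eqI[OF _ nth_mem])
  have edge': "\<exists>h\<in>H. ?src h = a \<and> ?dst h = b" if "{a, b} \<in> ET" for a b
  proof -
    from that ET obtain u v where "(u, v) \<in> set es" "{a, b} = {u, v}" by auto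
    then obtain i where i: "i < length es" "es ! i = (u, v)" "{a, b} = {u, v}" by (auto simp: in_set_conv_nth)
    then consider "a = u" "b = v" | "a = v" "b = u" by (auto simp: doubleton_eq_iff)
    then show ?thesis
    proof cases
      case 1
      then show ?thesis using i by (intro bexI[of _ "Suc (2 * i)"]) (auto simp: half_simps H_def)
    next
      case 2
      then show ?thesis using i by (intro bexI[of _ "Suc (Suc (2 * i))"]) (auto simp: half_simps H_def)
    qed
  qed
  have in_N: "?dst h \<in> {1..N}" if "h \<in> H" for h
    using edge[OF that] tree by (auto simp: is_tree_def doubleton_eq_iff)
  have conn: "induces_connected ET {1..N}" using tree by (simp add: is_tree_def)
  then have N1: "1 \<le> N" by (auto simp: induces_connected_def)
  define D where "D q j = {h \<in> H. ?src h \<in> set (take j q)}" for q j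
  have finD: "finite (D q j)" for q j by (simp add: D_def H_def)
  define J where "J j s' t' k' \<longleftrightarrow> k' = k \<and> regs s' ''i'' = int j \<and> (\<exists>q. queued q s' \<and> distinct q \<and> q \<noteq> [] \<and> hd q = 1 \<and>
      set q \<subseteq> {1..N} \<and> j \<le> Suc (length q) \<and> (\<forall>i<length q. 0 < i \<longrightarrow> (\<exists>j<i. {q ! j, q ! i} \<in> ET)) \<and>
      ?dst ` D q (j - 1) \<subseteq> set q \<and> t' + 6 \<le> t + 6 * j + 7 * card (D q (j - 1)) + 4)" for j s' t' k'
  have full: "set q = {1..N}" if "set q \<subseteq> {1..N}" "q \<noteq> []" "?dst ` D q (length q) \<subseteq> set q" for q
  proof (rule ccontr)
    assume "set q \<noteq> {1..N}"
    with that(1) obtain y where y: "y \<in> {1..N}" "y \<notin> set q" by blast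
    have "hd q \<in> set q" using that(2) by simp
    with connected_crossing[OF conn _ _ y, of "hd q"] that(1) obtain a b where
      ab: "a \<in> set q" "b \<notin> set q" "{a, b} \<in> ET" by blast
    with edge'[OF ab(3)] that(3) show False by (auto simp: D_def)
  qed
  have len: "length q \<le> N" if "distinct q" "set q \<subseteq> {1..N}" for q :: "nat list"
    using card_mono[OF _ that(2)] distinct_card[OF that(1)] by simp
  \<comment> \<open>The loop does not stop early: a queue without unprocessed nodes is closed under adjacency and thus has all \<open>N\<close> nodes.\<close>
  have prog: "j \<le> length q" if "j < Suc N" "1 \<le> j" "distinct q" "q \<noteq> []" "set q \<subseteq> {1..N}" "j \<le> Suc (length q)"
      "?dst ` D q (j - 1) \<subseteq> set q" for q j
  proof (rule ccontr)
    assume "\<not> j \<le> length q"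
    with that(6) have "j = Suc (length q)" by simp
    with full[of q] that have "set q = {1..N}" by auto
    with distinct_card[OF that(3)] have "length q = N" by simp
    with \<open>j = Suc (length q)\<close> that(1) show False by simp
  qed
  show ?thesis unfolding search_tree_def wp_Seq wp_Assign wp_Store
  proof (rule wp_While_count[where l = 1 and u = "Suc N" and J = J], goal_cases)
    case 1
    show ?case unfolding J_def
      by (intro conjI exI[of _ "[1]"]) (use vis N1 in \<open>auto simp: queued_def D_def\<close>)
  next
    case 2
    show ?case by simp
  next
    case (3 j s' t' k')
    then obtain q where q: "queued q s'" "distinct q" "q \<noteq> []" "hd q = 1" "set q \<subseteq> {1..N}" "j \<le> Suc (length q)"
      "\<forall>i<length q. 0 < i \<longrightarrow> (\<exists>j<i. {q ! j, q ! i} \<in> ET)" "?dst ` D q (j - 1) \<subseteq> set q"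
      "t' + 6 \<le> t + 6 * j + 7 * card (D q (j - 1)) + 4" and k: "k' = k" and i: "regs s' ''i'' = int j"
      unfolding J_def by blast
    have jq: "j \<le> length q" by (rule prog) (use 3 q in auto)
    have t: "eval_test (Less (Reg ''i'') (plus1 (Reg ''tail''))) s'"
      using jq q(1) i by (simp add: queued_def)
    define x where "x = q ! (j - 1)"
    have x: "arrs s' ''qu'' (int j) = int x" "x \<in> set q"
      using q(1) jq 3(1) unfolding queued_def x_def by (auto dest!: spec[of _ "j - 1"])
    have adj': "adjacency es (2 * length es) s'"
      using adj 3(3) by (simp add: agree_def adjacency_def visit_neighbours_def)
    have "wp orc visit_neighbours (wp orc (incr ''i'') (J (Suc j))) (set_reg ''x'' (int x) s') (Suc (Suc t')) k"
    proof (rule wp_conseq[OF visit_neighbours_wp[where es = es and x = x and q = q]], goal_cases)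
      case (5 s'' t'' k'')
      then obtain zs where zs: "queued (q @ zs) s''" "distinct (q @ zs)"
        "set (q @ zs) = set q \<union> ?dst ` {h \<in> H. ?src h = x}"
        and t'': "t'' \<le> Suc (Suc t') + 7 * card {h \<in> H. ?src h = x} + 2" and k'': "k'' = k"
        unfolding H_def by blast
      have regi: "regs s'' ''i'' = int j" using 5(1) i by (simp add: agree_def visit_neighbours_def)
      have tk: "take j (q @ zs) = take (j - 1) q @ [x]"
        using jq 3(1) take_Suc_conv_app_nth[of "j - 1" q] by (simp add: x_def)
      have D: "D (q @ zs) j = D q (j - 1) \<union> {h \<in> H. ?src h = x}" unfolding D_def tk by auto
      have "x \<notin> set (take (j - 1) q)"
      proof
        assume "x \<in> set (take (j - 1) q)"
        then obtain i where "i < j - 1" "q ! i = q ! (j - 1)" using jq by (auto simp: in_set_conv_nth x_def)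
        moreover from this have "i < length q" "j - 1 < length q" using jq 3(1) by auto
        ultimately show False using nth_eq_iff_index_eq[OF q(2)] by auto
      qed
      then have cD: "card (D (q @ zs) j) = card (D q (j - 1)) + card {h \<in> H. ?src h = x}"
        unfolding D by (intro card_Un_disjoint finD) (auto simp: D_def H_def)
      have par: "\<exists>j'<i. {(q @ zs) ! j', (q @ zs) ! i} \<in> ET" if i: "i < length (q @ zs)" "0 < i" for i
      proof (cases "i < length q")
        case True
        with q(7) i(2) obtain j' where "j' < i" "{q ! j', q ! i} \<in> ET" by blast
        with True show ?thesis by (intro exI[of _ j']) (simp add: nth_append)
      next
        case False
        then have "(q @ zs) ! i \<in> set zs" using i by (simp add: nth_append)
        then have "(q @ zs) ! i \<notin> set q" "(q @ zs) ! i \<in> set (q @ zs)" using zs(2) by auto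
        then obtain h where "h \<in> H" "?src h = x" "(q @ zs) ! i = ?dst h" using zs(3) by blast
        then have "{x, (q @ zs) ! i} \<in> ET" using edge by auto
        moreover have "j - 1 < length q" using jq 3(1) by auto
        then have "(q @ zs) ! (j - 1) = x" by (simp add: nth_append x_def)
        ultimately show ?thesis using False jq 3(1) by (intro exI[of _ "j - 1"]) auto
      qed
      have "J (Suc j) (set_reg ''i'' (int (Suc j)) s'') (Suc t'') k"
        unfolding J_def
      proof (intro conjI exI[of _ "q @ zs"])
        show "queued (q @ zs) (set_reg ''i'' (int (Suc j)) s'')" using zs(1) by (simp add: queued_def)
        show "set (q @ zs) \<subseteq> {1..N}" unfolding zs(3) using q(5) in_N by blast
        show "?dst ` D (q @ zs) (Suc j - 1) \<subseteq> set (q @ zs)"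
          unfolding zs(3) diff_Suc_1 D using q(8) by blast
        show "Suc t'' + 6 \<le> t + 6 * Suc j + 7 * card (D (q @ zs) (Suc j - 1)) + 4"
          unfolding diff_Suc_1 cD using t'' q(9) by simp
      qed (use zs(2) q(3,4) jq par in auto)
      then show ?case using regi k'' by (simp add: add.commute)
    qed (use adj' q x in \<open>auto simp: queued_def\<close>)
    then show ?case using t x i k by simp
  next
    case (4 s' t' k')
    then obtain q where q: "queued q s'" "distinct q" "q \<noteq> []" "set q \<subseteq> {1..N}" "Suc N \<le> Suc (length q)"
      "\<forall>i<length q. 0 < i \<longrightarrow> (\<exists>j<i. {q ! j, q ! i} \<in> ET)" "?dst ` D q N \<subseteq> set q"
      "t' + 6 \<le> t + 6 * Suc N + 7 * card (D q N) + 4" and k: "k' = k" and i: "regs s' ''i'' = int (Suc N)"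
      unfolding J_def by auto
    have lq: "length q = N" using len[OF q(2,4)] q(5) by simp
    then have "set q = {1..N}" using full[OF q(4,3)] q(7) by simp
    then have "search_order {1..N} ET q" using q(2,6) by (auto simp: search_order_def)
    moreover have "card (D q N) \<le> 2 * length es"
    proof -
      have "card (D q N) \<le> card H" by (rule card_mono) (auto simp: D_def H_def)
      then show ?thesis by (simp add: H_def)
    qed
    moreover have "\<forall>i<N. arrs s' ''qu'' (int (Suc i)) = int (q ! i)" "regs s' ''tail'' = int N"
      using q(1) lq by (auto simp: queued_def)
    ultimately show ?case using q(8) k i by auto
  qed
qed

section \<open>Numbering the vertices\<close>

definition numbered :: "nat list \<Rightarrow> state \<Rightarrow> bool" where
  "numbered vs s \<longleftrightarrow> regs s ''c'' = int (length vs) \<and>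
     (\<forall>i<length vs. arrs s ''pos'' (int (vs ! i)) = int (Suc i) \<and> arrs s ''ord'' (int (Suc i)) = int (vs ! i)) \<and>
     (\<forall>x. x \<notin> set vs \<longrightarrow> arrs s ''pos'' (int x) = 0)"

lemma numbered_snoc:
  assumes "numbered vs s" "x \<notin> set vs"
    and "regs s' ''c'' = int (Suc (length vs))"
    and "arrs s' ''pos'' = (arrs s ''pos'')(int x := int (Suc (length vs)))"
    and "arrs s' ''ord'' = (arrs s ''ord'')(int (Suc (length vs)) := int x)"
  shows "numbered (vs @ [x]) s'"
proof -
  have "vs ! i \<noteq> x" if "i < length vs" for i using that assms(2) by auto
  then show ?thesis using assms unfolding numbered_def
    by (auto simp: nth_append less_Suc_eq simp del: of_nat_Suc)
qed

lemma number_bag_wp: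
  assumes "numbered vs s" "regs s ''a'' = int a" "arrs s ''input'' (int a) = int (length xs)"
    and inp: "\<And>j. j < length xs \<Longrightarrow> arrs s ''input'' (int (a + 1 + j)) = int (xs ! j)"
  shows "wp orc (count ''j'' (Const 0) (Fetch ''input'' (Reg ''a''))
        (''x'' ::= Fetch ''input'' (Add (plus1 (Reg ''a'')) (Reg ''j'')) ;;
         Cond (Equal (Fetch ''pos'' (Reg ''x'')) (Const 0))
           (incr ''c'' ;; Store ''pos'' (Reg ''x'') (Reg ''c'') ;; Store ''ord'' (Reg ''c'') (Reg ''x'')) skip))
     (\<lambda>s' t' k'. k' = k \<and> t' \<le> t + 7 * length xs + 2 \<and> numbered (fold snoc_new xs vs) s') s t k"
proof (rule wp_count[where l = 0 and u = "length xs" and J = "\<lambda>j s' t' k'. k' = k \<and> t' \<le> t + 7 * j + 1 \<and>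
      numbered (fold snoc_new (take j xs) vs) s'"], goal_cases)
  case (6 j s' t' q')
  define ws where "ws = fold snoc_new (take j xs) vs"
  define x where "x = xs ! j"
  have ws': "fold snoc_new (take (Suc j) xs) vs = snoc_new x ws"
    using 6(2) by (simp add: take_Suc_conv_app_nth ws_def x_def)
  have s': "numbered ws s'" "q' = k" "t' \<le> t + 7 * j + 1" using 6(5) by (simp_all add: ws_def)
  have "arrs s' ''input'' = arrs s ''input''" "regs s' ''a'' = int a"
    using 6(3) assms(2) by (simp_all add: agree_def)
  then have x: "arrs s' ''input'' (regs s' ''a'' + 1 + int j) = int x"
    using inp[OF 6(2)] by (simp add: x_def algebra_simps)
  show ?case
  proof (cases "x \<in> set ws")
    case True
    then obtain i where "i < length ws" "ws ! i = x" by (auto simp: in_set_conv_nth)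
    then have "arrs s' ''pos'' (int x) = int (Suc i)" using s'(1) by (auto simp: numbered_def)
    then have p: "arrs s' ''pos'' (int x) \<noteq> 0" by simp
    have "snoc_new x ws = ws" using True by (simp add: snoc_new_def)
    then show ?thesis using p x 6(4) s' unfolding ws' by (simp add: numbered_def)
  next
    case False
    then have p: "arrs s' ''pos'' (int x) = 0" using s'(1) by (simp add: numbered_def)
    have c: "regs s' ''c'' = int (length ws)" using s'(1) by (simp add: numbered_def)
    have "snoc_new x ws = ws @ [x]" using False by (simp add: snoc_new_def)
    then show ?thesis using p x 6(4) s'(2,3) unfolding ws'
      by (auto simp: c add.commute intro!: numbered_snoc[OF s'(1) False])
  qed
qed (use assms in \<open>auto simp: agree_def numbered_def\<close>)

lemma number_vertices_wp:
  fixes bl :: "nat \<Rightarrow> nat list" and toff :: "nat \<Rightarrow> nat"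
  assumes "regs s ''N'' = int N" and qu: "\<And>i. i < N \<Longrightarrow> arrs s ''qu'' (int (Suc i)) = int (q ! i)"
    and q: "length q = N"
    and toff: "\<And>x. x \<in> set q \<Longrightarrow> arrs s ''toff'' (int x) = int (toff x)"
    and inp: "\<And>x. x \<in> set q \<Longrightarrow> arrs s ''input'' (int (toff x)) = int (length (bl x))"
      "\<And>x j. x \<in> set q \<Longrightarrow> j < length (bl x) \<Longrightarrow> arrs s ''input'' (int (toff x + 1 + j)) = int (bl x ! j)"
    and w: "\<And>x. x \<in> set q \<Longrightarrow> length (bl x) \<le> w"
    and pos0: "\<And>x. arrs s ''pos'' (int x) = 0"
  shows "wp orc number_vertices (\<lambda>s' t' k'. k' = k \<and> t' \<le> t + N * (7 * w + 5) + 3 \<and>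
     numbered (fold snoc_new (concat (map bl q)) []) s') s t k"
  unfolding number_vertices_def wp_Seq wp_Assign
proof (rule wp_count[where l = 1 and u = "Suc N" and J = "\<lambda>i s' t' k'. k' = k \<and> t' \<le> t + (i - 1) * (7 * w + 5) + 2 \<and>
      numbered (fold snoc_new (concat (map bl (take (i - 1) q))) []) s'"], goal_cases)
  case (6 i s' t' q')
  define x where "x = q ! (i - 1)"
  have i: "i - 1 < N" "Suc (i - 1) = i" using 6(1,2) by auto
  have x: "x \<in> set q" using i q by (simp add: x_def)
  have tk: "take i q = take (i - 1) q @ [x]"
    using take_Suc_conv_app_nth[of "i - 1" q] i q by (simp add: x_def)
  have ar: "arrs s' ''input'' = arrs s ''input''" "arrs s' ''toff'' = arrs s ''toff''" "arrs s' ''qu'' = arrs s ''qu''"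
    using 6(3) by (simp_all add: agree_def)
  have a: "arrs s' ''toff'' (arrs s' ''qu'' (regs s' ''i'')) = int (toff x)"
    using 6(4) qu[OF i(1)] toff[OF x] i(2) unfolding ar by (simp add: x_def)
  have m: "i * (7 * w + 5) = (i - 1) * (7 * w + 5) + (7 * w + 5)"
    using i(2) by (metis add.commute mult_Suc)
  show ?case unfolding wp_Seq wp_Assign
    apply (rule wp_conseq[OF number_bag_wp[where a = "toff x" and xs = "bl x" and
          vs = "fold snoc_new (concat (map bl (take (i - 1) q))) []"]])
    subgoal using 6(5) by (simp add: numbered_def)
    subgoal using a by simp
    subgoal using inp(1)[OF x] by (simp add: ar)
    subgoal using inp(2)[OF x] by (simp add: ar)
    subgoal using 6(5) m w[OF x] by (auto simp: tk numbered_def)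
    done
qed (use assms in \<open>auto simp: agree_def numbered_def\<close>)

section \<open>Bags in memory\<close>

definition blocks :: "nat \<Rightarrow> (nat \<Rightarrow> nat list) \<Rightarrow> state \<Rightarrow> bool" where
  "blocks n B s \<longleftrightarrow> (\<forall>v\<le>n. arrs s ''off'' (int v) = int (v * Suc n) \<and> arrs s ''len'' (int v) = int (length (B v)) \<and>
     length (B v) \<le> Suc n \<and> (\<forall>k<length (B v). arrs s ''bag'' (int (v * Suc n + k)) = int (B v ! k)))"

lemma blocks_set_reg [simp]: "blocks n B (set_reg x c s) = blocks n B s"
  by (simp add: blocks_def)

lemma address_inj:
  fixes n :: nat
  assumes "v * Suc n + k = v' * Suc n + k'" "k < Suc n" "k' < Suc n"
  shows "v = v' \<and> k = k'"
proof -
  have "(v * Suc n + k) div Suc n = v" "(v' * Suc n + k') div Suc n = v'"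
    using div_mult_self3[of "Suc n" v k] div_mult_self3[of "Suc n" v' k'] assms(2,3)
    by (simp_all del: mult_Suc_right)
  with assms(1) have "v = v'" by simp
  with assms(1) show ?thesis by simp
qed

lemma initial_bags_wp:
  assumes "regs s ''n'' = int n" "arrs s ''off'' 0 = 0" "arrs s ''len'' 0 = 0"
  shows "wp orc initial_bags (\<lambda>s' t' k'. k' = k \<and> t' \<le> t + 6 * n + 3 \<and>
     blocks n (\<lambda>v. if v = 0 then [] else [v]) s') s t k"
  unfolding initial_bags_def wp_Seq wp_Assign
proof (rule wp_count[where l = 1 and u = "Suc n" and J = "\<lambda>i s' t' k'. k' = k \<and> t' + 6 \<le> t + 6 * i + 2 \<and>
      regs s' ''o'' = int ((i - 1) * Suc n) \<and> arrs s' ''off'' 0 = 0 \<and> arrs s' ''len'' 0 = 0 \<and>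
      (\<forall>v. 1 \<le> v \<longrightarrow> v < i \<longrightarrow> arrs s' ''off'' (int v) = int (v * Suc n) \<and> arrs s' ''len'' (int v) = 1 \<and>
         arrs s' ''bag'' (int (v * Suc n)) = int v)"], goal_cases)
  case (6 i s' t' q')
  have n: "regs s' ''n'' = int n" using 6(3) assms(1) by (simp add: agree_def)
  obtain i' where i': "i = Suc i'" using 6(1) by (cases i) auto
  have "int i' * (1 + int n) + (int n + 1) = int (Suc i' * Suc n)" by (simp add: algebra_simps)
  moreover have "v * Suc n = Suc i' * Suc n \<longleftrightarrow> v = Suc i'" for v by (metis mult_right_cancel nat.distinct(1))
  then have "int v * (1 + int n) = int (Suc i' * Suc n) \<longleftrightarrow> v = Suc i'" for v
    by (metis of_nat_Suc of_nat_eq_iff of_nat_mult)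
  ultimately show ?case using 6(4,5) n unfolding i'
    by (auto simp: less_Suc_eq simp del: mult_Suc mult_Suc_right) simp
next
  case (7 s' t' q')
  then show ?case by (auto simp: blocks_def less_Suc_eq_le)
qed (use assms in \<open>auto simp: agree_def\<close>)

lemma powers_of_two_wp:
  assumes "regs s ''n'' = int n"
  shows "wp orc powers_of_two (\<lambda>s' t' k'. k' = k \<and> t' \<le> t + 3 * n + 3 \<and>
     (\<forall>i\<le>n. arrs s' ''pw'' (int i) = 2 ^ i)) s t k"
  unfolding powers_of_two_def wp_Seq wp_Store
proof (rule wp_count[where l = 0 and u = n and J = "\<lambda>i s' t' k'. k' = k \<and> t' \<le> t + 3 * i + 2 \<and>
      (\<forall>j\<le>i. arrs s' ''pw'' (int j) = 2 ^ j)"], goal_cases)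
  case (6 i s' t' q')
  then show ?case by (auto simp: le_Suc_eq)
qed (use assms in \<open>auto simp: agree_def\<close>)

section \<open>Absorbing a list\<close>

lemma find_last_wp:
  assumes "regs s ''b'' = int (length xs)" "regs s ''o'' = int a" "A \<noteq> ''tmp''"
    and A: "\<And>i. i < length xs \<Longrightarrow> arrs s A (int (a + i)) = int (xs ! i)"
    and pos: "\<And>v. v \<in> insert 0 (set xs) \<Longrightarrow> arrs s ''pos'' (int v) = int (pos v)"
  shows "wp orc (find_last A) (\<lambda>s' t' k'. k' = k \<and> t' \<le> t + 6 * length xs + 3 \<and>
     regs s' ''p'' = int (last_max pos xs) \<and> (\<forall>i<length xs. arrs s' ''tmp'' (int i) = int (xs ! i))) s t k"
  unfolding find_last_def wp_Seq wp_Assign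
proof (rule wp_count[where l = 0 and u = "length xs" and J = "\<lambda>i s' t' k'. k' = k \<and> t' \<le> t + 6 * i + 2 \<and>
      regs s' ''p'' = int (last_max pos (take i xs)) \<and> (\<forall>j<i. arrs s' ''tmp'' (int j) = int (xs ! j))"], goal_cases)
  case (6 i s' t' q')
  have ar: "arrs s' A = arrs s A" "arrs s' ''pos'' = arrs s ''pos''" "regs s' ''o'' = int a"
    using 6(3) assms(2,3) by (simp_all add: agree_def)
  define p where "p = last_max pos (take i xs)"
  define x where "x = xs ! i"
  have lm: "last_max pos (take (Suc i) xs) = (if pos p < pos x then x else p)"
    using 6(2) by (simp add: take_Suc_conv_app_nth last_max_def p_def x_def)
  have "p \<in> insert 0 (set (take i xs))"
    using foldl_max[of pos 0 "take i xs"] unfolding last_max_def p_def by blast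
  then have "p \<in> insert 0 (set xs)" using set_take_subset[of i xs] by blast
  moreover have "x \<in> set xs" using 6(2) by (simp add: x_def)
  ultimately have "arrs s ''pos'' (int p) = int (pos p)" "arrs s ''pos'' (int x) = int (pos x)"
    using pos by auto
  then show ?case using 6(4,5) A[OF 6(2)] assms(3) unfolding lm
    by (auto simp: ar p_def[symmetric] x_def[symmetric] less_Suc_eq)
qed (use assms in \<open>auto simp: agree_def last_max_def\<close>)

lemma blocks_snoc:
  assumes "blocks n B s" "p \<le> n" "length (B p) \<le> n"
    and "arrs s' ''off'' = arrs s ''off''"
    and "arrs s' ''len'' = (arrs s ''len'')(int p := int (Suc (length (B p))))"
    and "arrs s' ''bag'' = (arrs s ''bag'')(int (p * Suc n + length (B p)) := int x)"
  shows "blocks n (B(p := B p @ [x])) s'"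
proof -
  have ne: "int (v * Suc n + k) \<noteq> int (p * Suc n + length (B p))" if "v \<noteq> p \<or> k < length (B p)" "k < Suc n" for v k
    using address_inj[of v n k p "length (B p)"] that assms(3) by (metis less_Suc_eq_le less_irrefl of_nat_eq_iff)
  show ?thesis unfolding blocks_def
  proof (intro allI impI)
    fix v assume v: "v \<le> n"
    have B: "arrs s ''off'' (int v) = int (v * Suc n)" "arrs s ''len'' (int v) = int (length (B v))"
      "length (B v) \<le> Suc n" "\<And>k. k < length (B v) \<Longrightarrow> arrs s ''bag'' (int (v * Suc n + k)) = int (B v ! k)"
      using assms(1) v by (auto simp: blocks_def simp del: mult_Suc_right of_nat_add of_nat_mult)
    have "arrs s' ''bag'' (int (v * Suc n + k)) = int ((B(p := B p @ [x])) v ! k)"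
      if k: "k < length ((B(p := B p @ [x])) v)" for k
    proof (cases "v = p \<and> k = length (B p)")
      case True
      then show ?thesis by (simp add: assms(6) del: mult_Suc_right of_nat_add of_nat_mult)
    next
      case False
      with k have kl: "k < length (B v)" by (auto split: if_splits)
      then have "k < Suc n" using B(3) by simp
      then have "int (v * Suc n + k) \<noteq> int (p * Suc n + length (B p))" using ne[of v k] kl False by auto
      then have "arrs s' ''bag'' (int (v * Suc n + k)) = arrs s ''bag'' (int (v * Suc n + k))"
        unfolding assms(6) by (rule fun_upd_other)
      then show ?thesis using B(4)[OF kl] kl
        by (cases "v = p") (simp_all add: nth_append del: mult_Suc_right of_nat_add of_nat_mult)
    qed
    then show "arrs s' ''off'' (int v) = int (v * Suc n) \<and>
         arrs s' ''len'' (int v) = int (length ((B(p := B p @ [x])) v)) \<and> length ((B(p := B p @ [x])) v) \<le> Suc n \<and>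
         (\<forall>k<length ((B(p := B p @ [x])) v). arrs s' ''bag'' (int (v * Suc n + k)) = int ((B(p := B p @ [x])) v ! k))"
      using B assms(3-5) by auto
  qed
qed

lemma insert_vertex_wp:
  assumes B: "blocks n B s" and p: "p \<le> n" "regs s ''p'' = int p" and x: "regs s ''x'' = int x"
    and room: "x \<notin> set (B p) \<Longrightarrow> length (B p) \<le> n"
  shows "wp orc insert_vertex (\<lambda>s' t' k'. k' = k \<and> t' \<le> t + 2 * length (B p) + 5 \<and>
     blocks n (B(p := snoc_new x (B p))) s') s t k"
proof -
  have Bp: "arrs s ''off'' (int p) = int (p * Suc n)" "arrs s ''len'' (int p) = int (length (B p))"
     "\<And>k. k < length (B p) \<Longrightarrow> arrs s ''bag'' (int (p * Suc n) + int k) = int (B p ! k)"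
    using B p(1) by (auto simp: blocks_def)
  show ?thesis unfolding insert_vertex_def wp_Seq wp_Assign
  proof (rule wp_While[where V = "\<lambda>s. length (B p) - nat (regs s ''j'')" and I = "\<lambda>s' t' k'. k' = k \<and>
     (\<exists>j\<le>length (B p). regs s' ''j'' = int j \<and> (\<forall>i<j. B p ! i \<noteq> x) \<and> t' \<le> t + 2 * j + 1)"], goal_cases)
    case 1
    show ?case by auto
  next
    case (2 s' t' q')
    then obtain j where j: "j \<le> length (B p)" "regs s' ''j'' = int j" "\<forall>i<j. B p ! i \<noteq> x" "t' \<le> t + 2 * j + 1" "q' = k"
      by blast
    have ag: "arrs s' = arrs s" "regs s' ''p'' = int p" "regs s' ''x'' = int x"
      using 2(1) p x by (auto simp: agree_def)
    have jl: "j < length (B p)" "B p ! j \<noteq> x" using 2(3) j Bp by (auto simp: ag)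
    then show ?case using j by (auto intro!: exI[of _ "Suc j"] simp: less_Suc_eq)
  next
    case (3 s' t' q')
    then obtain j where j: "j \<le> length (B p)" "regs s' ''j'' = int j" "\<forall>i<j. B p ! i \<noteq> x" "t' \<le> t + 2 * j + 1" "q' = k"
      by blast
    have ag: "arrs s' = arrs s" "regs s' ''p'' = int p" "regs s' ''x'' = int x"
      using 3(1) p x by (auto simp: agree_def)
    have B': "blocks n B s'" using B by (simp add: blocks_def ag)
    show ?case
    proof (cases "j = length (B p)")
      case True
      then have new: "x \<notin> set (B p)" using j(3) by (auto simp: in_set_conv_nth)
      then have sn: "snoc_new x (B p) = B p @ [x]" by (simp add: snoc_new_def)
      show ?thesis using True j Bp
        by (auto simp: ag sn algebra_simps intro!: blocks_snoc[OF B' p(1) room[OF new]])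
    next
      case False
      then have "j < length (B p)" using j(1) by simp
      moreover from this have "B p ! j = x" using 3(3) j Bp by (auto simp: ag)
      ultimately have "x \<in> set (B p)" by auto
      then have "B(p := snoc_new x (B p)) = B" by (simp add: snoc_new_def)
      then show ?thesis using False j Bp B' by (simp add: ag)
    qed
  qed
qed

lemma length_fold_snoc_new: "length xs \<le> length (fold snoc_new ws xs)"
  using fold_snoc_new_append[of ws xs] by auto

lemma absorb_list_wp:
  assumes "regs s ''b'' = int (length xs)" "regs s ''o'' = int a" "A \<noteq> ''tmp''"
    and A: "\<And>i. i < length xs \<Longrightarrow> arrs s A (int (a + i)) = int (xs ! i)"
    and pos: "\<And>v. v \<in> insert 0 (set xs) \<Longrightarrow> arrs s ''pos'' (int v) = int (pos v)"
    and B: "blocks n B s" and p: "last_max pos xs \<le> n"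
    and dist: "distinct (B (last_max pos xs))" "set (B (last_max pos xs)) \<subseteq> {1..n}" "set xs \<subseteq> {1..n}"
    and w: "length (fold snoc_new xs (B (last_max pos xs))) \<le> w"
  shows "wp orc (absorb_list A) (\<lambda>s' t' k'. k' = k \<and> t' \<le> t + length xs * (2 * w + 14) + 5 \<and>
     regs s' ''p'' = int (last_max pos xs) \<and> blocks n (absorb pos xs B) s') s t k"
proof -
  define p where "p = last_max pos xs"
  define C where "C i = B(p := fold snoc_new (take i xs) (B p))" for i
  show ?thesis unfolding absorb_list_def
  proof (rule wp_cut[OF find_last_wp[where xs = xs and a = a and pos = pos]], goal_cases)
    case (6 s1 t1 q1)
    have ag: "regs s1 ''b'' = int (length xs)" using 6(1) assms(1) by (simp add: agree_def find_last_def)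
    have B1: "blocks n B s1" using 6(1) B by (simp add: agree_def find_last_def blocks_def)
    show ?case
    proof (rule wp_count[where l = 0 and u = "length xs" and J = "\<lambda>i s' t' k'. k' = k \<and>
         t' \<le> t1 + i * (2 * w + 8) + 1 \<and> regs s' ''p'' = int p \<and> blocks n (C i) s'"], goal_cases)
      case (6 i s' t' q')
      have tmp: "arrs s' ''tmp'' (int i) = int (xs ! i)"
        using 6(2,3) \<open>q1 = k \<and> _\<close> by (simp add: agree_def insert_vertex_def)
      have take: "take (Suc i) xs = take i xs @ [xs ! i]" using 6(2) by (rule take_Suc_conv_app_nth)
      have Ci: "C i p = fold snoc_new (take i xs) (B p)" by (simp add: C_def)
      have CS: "C (Suc i) = (C i)(p := snoc_new (xs ! i) (C i p))" by (simp add: C_def take)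
      have "length (C i p) \<le> length (fold snoc_new (drop i xs) (C i p))" by (rule length_fold_snoc_new)
      also have "fold snoc_new (drop i xs) (C i p) = fold snoc_new xs (B p)"
        unfolding Ci by (metis append_take_drop_id comp_apply fold_append)
      finally have len: "length (C i p) \<le> w" using w by (simp add: p_def)
      have d: "distinct (C i p)" "set (C i p) \<subseteq> {1..n}"
        using dist set_take_subset[of i xs] unfolding Ci by (auto simp: p_def)
      then have "length (C i p) \<le> n"
        using card_mono[OF _ d(2)] distinct_card[OF d(1)] by simp
      then show ?case unfolding wp_Seq wp_Assign
        using 6(4,5) tmp p
        by (intro wp_conseq[OF insert_vertex_wp[where n = n and B = "C i" and p = p and x = "xs ! i"]])
          (use len in \<open>auto simp: p_def[symmetric] CS agree_def insert_vertex_def\<close>)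
    next
      case (7 s' t' q')
      have "C (length xs) = absorb pos xs B" by (simp add: C_def absorb_def p_def)
      then show ?case using 7(2) \<open>q1 = k \<and> _\<close> by (auto simp: p_def algebra_simps)
    qed (use 6 ag B1 in \<open>auto simp: agree_def insert_vertex_def p_def C_def\<close>)
  qed (use assms in auto)
qed

section \<open>Elimination in memory\<close>

lemma blocks_nth:
  assumes "blocks n B s" "v \<le> n"
  shows "arrs s ''off'' (int v) = int (v * Suc n)" "arrs s ''len'' (int v) = int (length (B v))"
    "k < length (B v) \<Longrightarrow> arrs s ''bag'' (int (v * Suc n + k)) = int (B v ! k)"
  using assms unfolding blocks_def by (simp_all del: of_nat_add of_nat_mult mult_Suc_right)

lemma blocks_store [simp]:
  "a \<notin> {''off'', ''len'', ''bag''} \<Longrightarrow> blocks n B (s\<lparr>arrs := (arrs s)(a := f)\<rparr>) = blocks n B s"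
  by (auto simp: blocks_def)

context elimination
begin

lemma absorb_length: "inv B \<Longrightarrow> chain xs \<Longrightarrow> length (fold snoc_new xs (B (last_max pos xs))) \<le> w"
  using inv_props(3)[OF inv_absorb last_max_le, of B xs xs] by (simp add: absorb_def)

lemma length_Kl:
  assumes "i \<in> {1..m}"
  shows "length (Kl i) \<le> w"
proof -
  have "card (K i) \<le> card (set (bag (vert i)))" by (rule card_mono) (use K_subset_bag[OF assms] in auto)
  also have "\<dots> \<le> length (bag (vert i))" by (rule card_length)
  finally show ?thesis using length_bag(1)[OF vert_le[OF assms]] by simp
qed

lemma absorb_constraints_wp:
  fixes koff :: "nat \<Rightarrow> nat"
  assumes "regs s ''m'' = int m"
    and koff: "\<And>i. i \<in> {1..m} \<Longrightarrow> arrs s ''koff'' (int i) = int (koff i)"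
    and inp: "\<And>i. i \<in> {1..m} \<Longrightarrow> arrs s ''input'' (int (koff i)) = int (length (Kl i))"
      "\<And>i j. i \<in> {1..m} \<Longrightarrow> j < length (Kl i) \<Longrightarrow> arrs s ''input'' (int (koff i + 1 + j)) = int (Kl i ! j)"
    and pos: "\<And>v. v \<le> n \<Longrightarrow> arrs s ''pos'' (int v) = int (pos v)"
    and B: "blocks n (BK 0) s"
  shows "wp orc absorb_constraints (\<lambda>s' t' k'. k' = k \<and> t' \<le> t + m * (w * (2 * w + 14) + 10) + 2 \<and>
     blocks n (BK m) s' \<and> (\<forall>i\<in>{1..m}. arrs s' ''vert'' (int i) = int (vert i))) s t k"
  unfolding absorb_constraints_def
proof (rule wp_count[where l = 1 and u = "Suc m" and J = "\<lambda>r s' t' k'. k' = k \<and>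
     t' \<le> t + (r - 1) * (w * (2 * w + 14) + 10) + 1 \<and>
     blocks n (BK (r - 1)) s' \<and> (\<forall>i. 1 \<le> i \<longrightarrow> i < r \<longrightarrow> arrs s' ''vert'' (int i) = int (vert i))"], goal_cases)
  case (6 r s' t' q')
  have r: "r \<in> {1..m}" "Suc (r - 1) = r" "r - 1 \<le> m" using 6(1,2) by auto
  have ar: "arrs s' ''input'' = arrs s ''input''" "arrs s' ''pos'' = arrs s ''pos''" "arrs s' ''koff'' = arrs s ''koff''"
    using 6(3) by (simp_all add: agree_def absorb_list_def find_last_def insert_vertex_def)
  have i: "inv (BK (r - 1))" by (rule inv_BK[OF r(3)])
  note ch = chain_K[OF r(1)]
  have lm: "last_max pos (Kl r) \<le> n" by (rule last_max_le[OF ch])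
  have st: "BK r = absorb pos (Kl r) (BK (r - 1))" using r(2) by (metis BK.simps(2))
  have Kn: "set (Kl r) \<subseteq> {1..n}" using ch by (simp add: chain_def)
  have "length (Kl r) * (2 * w + 14) \<le> w * (2 * w + 14)" using length_Kl[OF r(1)] by (rule mult_le_mono1)
  moreover have "r * (w * (2 * w + 14) + 10) = (r - 1) * (w * (2 * w + 14) + 10) + (w * (2 * w + 14) + 10)"
    using r(2) by (metis add.commute mult_Suc)
  ultimately have tm: "t' + length (Kl r) * (2 * w + 14) + 10 \<le> t + r * (w * (2 * w + 14) + 10) + 1"
    using 6(5) by linarith
  show ?case unfolding wp_Seq wp_Assign
    apply (rule wp_conseq[OF absorb_list_wp[where xs = "Kl r" and a = "koff r + 1" and pos = pos and n = n
            and B = "BK (r - 1)" and w = w]])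
    subgoal using 6(4) koff[OF r(1)] inp(1)[OF r(1)] by (simp add: ar)
    subgoal using 6(4) koff[OF r(1)] by (simp add: ar)
    subgoal by simp
    subgoal for i using inp(2)[OF r(1), of i] by (simp add: ar)
    subgoal for v using pos[of v] Kn by (auto simp: ar)
    subgoal using 6(5) by simp
    subgoal by (rule lm)
    subgoal by (rule inv_props(1)[OF i lm])
    subgoal by (rule inv_props(2)[OF i lm])
    subgoal by (rule Kn)
    subgoal by (rule absorb_length[OF i ch])
    subgoal for s'' t'' q''
      using 6(4,5) tm
      by (auto simp: st vert_def less_Suc_eq agree_def absorb_list_def find_last_def insert_vertex_def blocks_def)
    done
next
  case (7 s' t' q')
  then show ?case by (auto simp: less_Suc_eq_le)
qed (use assms in \<open>auto simp: agree_def absorb_list_def find_last_def insert_vertex_def\<close>)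

lemma sum_ord:
  fixes g :: "nat \<Rightarrow> nat"
  shows "(\<Sum>i<n. g (ord (n - i))) = sum g {1..n}"
proof (rule sum.reindex_bij_betw)
  show "bij_betw (\<lambda>i. ord (n - i)) {..<n} {1..n}"
  proof (rule bij_betw_byWitness[where f' = "\<lambda>v. n - pos v"])
    show "\<forall>i\<in>{..<n}. n - pos (ord (n - i)) = i"
    proof
      fix i assume "i \<in> {..<n}"
      then have "n - i \<in> {1..n}" by auto
      then show "n - pos (ord (n - i)) = i" using ord[of "n - i"] \<open>i \<in> {..<n}\<close> by auto
    qed
    show "\<forall>v\<in>{1..n}. ord (n - (n - pos v)) = v"
    proof
      fix v assume "v \<in> {1..n}"
      from pos[OF this] show "ord (n - (n - pos v)) = v" by auto
    qed
    show "(\<lambda>i. ord (n - i)) ` {..<n} \<subseteq> {1..n}"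
    proof (rule image_subsetI)
      fix i assume "i \<in> {..<n}"
      then have "n - i \<in> {1..n}" by auto
      from ord[OF this] show "ord (n - i) \<in> {1..n}" by simp
    qed
    show "(\<lambda>v. n - pos v) ` {1..n} \<subseteq> {..<n}"
    proof (rule image_subsetI)
      fix v assume "v \<in> {1..n}"
      from pos[OF this] show "n - pos v \<in> {..<n}" by auto
    qed
  qed
qed

text \<open>The time for a vertex depends on its separator. As every vertex is eliminated once, the total is a sum over all vertices.\<close>

lemma absorb_separators_wp:
  assumes "regs s ''n'' = int n"
    and ord': "\<And>c. c \<in> {1..n} \<Longrightarrow> arrs s ''ord'' (int c) = int (ord c)"
    and pos': "\<And>v. v \<le> n \<Longrightarrow> arrs s ''pos'' (int v) = int (pos v)"
    and B: "blocks n (BK m) s"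
  shows "wp orc absorb_separators (\<lambda>s' t' k'. k' = k \<and>
     t' \<le> t + (\<Sum>v = 1..n. length (sep v) * (2 * w + 14) + 12) + 2 \<and>
     blocks n bag s' \<and> (\<forall>v\<in>{1..n}. arrs s' ''par'' (int v) = int (par v))) s t k"
  unfolding absorb_separators_def
proof (rule wp_count[where l = 0 and u = n and J = "\<lambda>r s' t' k'. k' = k \<and>
     t' \<le> t + (\<Sum>i<r. length (sep (ord (n - i))) * (2 * w + 14) + 12) + 1 \<and>
     blocks n (BE r) s' \<and> (\<forall>v\<in>{1..n}. n - r < pos v \<longrightarrow> arrs s' ''par'' (int v) = int (par v))"], goal_cases)
  case (6 r s' t' q')
  define v where "v = ord (n - r)"
  have nr: "n - r \<in> {1..n}" using 6(2) by auto
  have v: "v \<in> {1..n}" "pos v = n - r" using ord[OF nr] by (auto simp: v_def)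
  have ar: "arrs s' ''pos'' = arrs s ''pos''" "arrs s' ''ord'' = arrs s ''ord''" "regs s' ''n'' = int n"
    using 6(3) assms(1) by (simp_all add: agree_def absorb_list_def find_last_def insert_vertex_def)
  have nri: "int n - int r = int (n - r)" using 6(2) by linarith
  have ov: "arrs s' ''ord'' (int n - int r) = int v" unfolding nri ar v_def by (rule ord'[OF nr])
  have i: "inv (BE r)" using inv_BE 6(2) by simp
  define xs where "xs = tl (BE r v)"
  have sv: "sep v = xs" using bag_eq_BE[OF v(1)] v(2) 6(2) by (simp add: sep_def xs_def)
  have Bv: "BE r v = v # xs" unfolding xs_def by (rule inv_Cons_tl[OF i v(1)])
  have ch: "chain xs" unfolding xs_def by (rule chain_tl[OF i v(1)])
  have lm: "last_max pos xs \<le> n" by (rule last_max_le[OF ch])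
  have st: "BE (Suc r) = absorb pos xs (BE r)" by (simp add: xs_def v_def)
  have xn: "set xs \<subseteq> {1..n}" using ch by (simp add: chain_def)
  have bl: "blocks n (BE r) s'" using 6(5) by simp
  note bn = blocks_nth[OF bl, of v]
  have vn: "v \<le> n" using v(1) by simp
  have pv: "n - Suc r < pos u \<longleftrightarrow> n - r < pos u \<or> u = v" if "u \<in> {1..n}" for u
  proof -
    have "pos u = n - r \<longleftrightarrow> u = v" using pos_inj[OF that v(1)] v(2) by auto
    moreover have "n - Suc r < pos u \<longleftrightarrow> n - r \<le> pos u" using 6(2) by linarith
    ultimately show ?thesis by auto
  qed
  show ?case unfolding wp_Seq wp_Assign
    apply (rule wp_conseq[OF absorb_list_wp[where xs = xs and a = "v * Suc n + 1" and pos = pos and n = n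
            and B = "BE r" and w = w]])
    subgoal using 6(4) ov bn(2)[OF vn] by (simp add: ar Bv)
    subgoal using 6(4) ov bn(1)[OF vn] by (simp add: ar)
    subgoal by simp
    subgoal for i using bn(3)[OF vn, of "Suc i"] by (simp add: Bv)
    subgoal for u using pos'[of u] xn by (auto simp: ar)
    subgoal using bl by simp
    subgoal by (rule lm)
    subgoal by (rule inv_props(1)[OF i lm])
    subgoal by (rule inv_props(2)[OF i lm])
    subgoal by (rule xn)
    subgoal by (rule absorb_length[OF i ch])
    subgoal premises P for s'' t'' q''
    proof -
      have rv: "regs s'' ''v'' = int v"
        using P(1) ov 6(4) by (simp add: ar agree_def absorb_list_def find_last_def insert_vertex_def)
      have pr: "arrs s'' ''par'' = arrs s' ''par''"
        using P(1) by (simp add: agree_def absorb_list_def find_last_def insert_vertex_def)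
      have pp: "regs s'' ''p'' = int (par v)" using P(2) by (simp add: par_def sv)
      have tm: "(\<Sum>i<Suc r. length (sep (ord (n - i))) * (2 * w + 14) + 12)
          = (\<Sum>i<r. length (sep (ord (n - i))) * (2 * w + 14) + 12) + (length xs * (2 * w + 14) + 12)"
        by (simp add: v_def[symmetric] sv)
      have bl': "blocks n (BE (Suc r)) s''" unfolding st using P(2) by blast
      have "\<forall>u\<in>{1..n}. n - Suc r < pos u \<longrightarrow>
          ((arrs s' ''par'')(int v := int (par v))) (int u) = int (par u)"
        using 6(5) pv by auto
      then show ?thesis
        unfolding wp_Store tm using P(2) 6(5) bl' by (auto simp: rv pr pp simp del: BE.simps)
    qed
    done
next
  case (7 s' t' q')
  then show ?case using pos sum_ord[of "\<lambda>v. length (sep v) * (2 * w + 14) + 12"]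
    by (auto simp: bag_def Suc_le_eq)
next
  case (5 c)
  have "\<not> n - 0 < pos v" if "v \<in> {1..n}" for v using pos[OF that] by auto
  then show ?case using B by auto
qed (use assms pos in \<open>auto simp: agree_def absorb_list_def find_last_def insert_vertex_def\<close>)

end

section \<open>Decoding a subset number\<close>

text \<open>Comparing the remainder with \<open>2\<^sup>k\<close> reads off digit \<open>k\<close>, if the higher digits have been removed.\<close>

lemma bit_threshold:
  fixes g :: nat
  shows "take_bit (Suc k) g < 2 ^ k \<longleftrightarrow> \<not> bit g k"
    "take_bit (Suc k) g = take_bit k g + of_bool (bit g k) * 2 ^ k"
proof -
  show 2: "take_bit (Suc k) g = take_bit k g + of_bool (bit g k) * 2 ^ k"
    by (simp add: take_bit_Suc_from_most)
  have "take_bit k g < 2 ^ k" by (rule take_bit_nat_less_exp)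
  with 2 show "take_bit (Suc k) g < 2 ^ k \<longleftrightarrow> \<not> bit g k" by auto
qed

text \<open>The remainder is \<open>take_bit k g\<close> when the digits from \<open>k\<close> on have been treated.\<close>

lemma decode_wp:
  fixes L :: "nat list"
  assumes "A \<noteq> ''y''" and oe: "\<And>s'. agree (decode A oe be ge) s s' \<Longrightarrow> eval_expr oe s' = int a"
    and be: "\<And>s'. agree (decode A oe be ge) s s' \<Longrightarrow> eval_expr be s' = int (length L)"
    and ge: "eval_expr ge s = int g" and g: "g < 2 ^ length L" and L: "distinct L"
    and A: "\<And>k. k < length L \<Longrightarrow> arrs s A (int (a + k)) = int (L ! k)"
    and pw: "\<And>k. k < length L \<Longrightarrow> arrs s ''pw'' (int k) = 2 ^ k"
  shows "wp orc (decode A oe be ge) (\<lambda>s' t' k'. k' = k0 \<and> t' \<le> t + 7 * length L + 4 \<and>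
     (\<forall>k<length L. arrs s' ''y'' (int (L ! k)) = of_bool (bit g k)) \<and>
     regs s' ''acc'' = (\<Sum>k<length L. of_bool (bit g k) * arrs s ''wt'' (int (L ! k)))) s t k0"
proof -
  define T where "T k = (\<Sum>k'\<in>{k..<length L}. of_bool (bit g k') * arrs s ''wt'' (int (L ! k')))" for k
  let ?s = "set_reg ''k'' (int (length L)) (set_reg ''acc'' 0 (set_reg ''rem'' (int g) s))"
  have be0: "eval_expr be (set_reg ''acc'' 0 (set_reg ''rem'' (int g) s)) = int (length L)"
    by (rule be) (simp add: agree_def decode_def)
  show ?thesis unfolding decode_def wp_Seq wp_Assign ge eval_expr.simps be0
  proof (rule wp_While[where V = "\<lambda>s. nat (regs s ''k'')" and I = "\<lambda>s' t' k'. k' = k0 \<and> (\<exists>k\<le>length L. regs s' ''k'' = int k \<and>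
      t' + 7 * k \<le> t + 7 * length L + 3 \<and> regs s' ''rem'' = int (take_bit k g) \<and> regs s' ''acc'' = T k \<and>
      (\<forall>k'<length L. k \<le> k' \<longrightarrow> arrs s' ''y'' (int (L ! k')) = of_bool (bit g k')))"], goal_cases)
    case 1
    have "take_bit (length L) g = g" using g by (simp add: take_bit_nat_eq_self_iff)
    then show ?case by (auto simp: T_def)
  next
    case (2 s' t' q')
    from 2(2) obtain k where k: "k \<le> length L" "regs s' ''k'' = int k" "t' + 7 * k \<le> t + 7 * length L + 3"
      "regs s' ''rem'' = int (take_bit k g)" "regs s' ''acc'' = T k" "q' = k0"
      "\<And>k'. k' < length L \<Longrightarrow> k \<le> k' \<Longrightarrow> arrs s' ''y'' (int (L ! k')) = of_bool (bit g k')" by blast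
    with 2(3) obtain j where j: "k = Suc j" by (cases k) auto
    have ag: "agree (decode A oe be ge) s s'" using 2(1) by (simp add: agree_def decode_def)
    have agj: "agree (decode A oe be ge) s (set_reg ''k'' c s')" for c using ag by (simp add: agree_def decode_def)
    have ar: "arrs s' A = arrs s A" "arrs s' ''pw'' = arrs s ''pw''" "arrs s' ''wt'' = arrs s ''wt''"
      using ag assms(1) by (simp_all add: agree_def decode_def)
    have jl: "j < length L" using k(1) j by simp
    note oej = oe[OF agj]
    have Aj: "arrs s' A (int a + int j) = int (L ! j)" using A[OF jl] by (simp add: ar)
    have pj: "arrs s' ''pw'' (int j) = int (2 ^ j)" using pw[OF jl] by (simp add: ar)
    have Tj: "T j = of_bool (bit g j) * arrs s ''wt'' (int (L ! j)) + T (Suc j)"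
      unfolding T_def by (rule sum.atLeast_Suc_lessThan[OF jl])
    have ne: "L ! k' \<noteq> L ! j" if "k' < length L" "k' \<noteq> j" for k'
      using L that jl by (simp add: nth_eq_iff_index_eq)
    have th: "int (take_bit (Suc j) g) < 2 ^ j \<longleftrightarrow> \<not> bit g j"
      using bit_threshold(1)[of j g] by (metis of_nat_less_iff of_nat_numeral of_nat_power)
    have rem: "int (take_bit (Suc j) g) - 2 ^ j = int (take_bit j g)" if "bit g j"
      using bit_threshold(2)[of j g] that by simp
    have rem': "int (take_bit (Suc j) g) = int (take_bit j g)" if "\<not> bit g j"
      using bit_threshold(2)[of j g] that by simp
    have upd: "\<forall>k'<length L. j \<le> k' \<longrightarrow>
        ((arrs s' ''y'')(int (L ! j) := of_bool (bit g j))) (int (L ! k')) = of_bool (bit g k')"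
    proof (intro allI impI)
      fix k' assume k': "k' < length L" "j \<le> k'"
      show "((arrs s' ''y'')(int (L ! j) := of_bool (bit g j))) (int (L ! k')) = of_bool (bit g k')"
      proof (cases "k' = j")
        case False
        then have "Suc j \<le> k'" using k'(2) by simp
        then show ?thesis using k(7)[OF k'(1)] ne[OF k'(1) False] j by simp
      qed simp
    qed
    show ?case
    proof (cases "bit g j")
      case True
      then show ?thesis using k(2,3,5,6) k(4) Aj pj th rem jl upd
        by (simp add: j oej ar Tj)
    next
      case False
      then show ?thesis using k(2,3,5,6) k(4) Aj pj th rem' jl upd
        by (simp add: j oej ar Tj)
    qed
  next
    case (3 s' t' q')
    then obtain k where k: "regs s' ''k'' = int k" "k \<le> length L" "t' + 7 * k \<le> t + 7 * length L + 3"
      "regs s' ''acc'' = T k" "q' = k0"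
      "\<forall>k'<length L. k \<le> k' \<longrightarrow> arrs s' ''y'' (int (L ! k')) = of_bool (bit g k')" by blast
    with 3(3) have "k = 0" by simp
    with k show ?case by (auto simp: T_def atLeast0LessThan)
  qed
qed

section \<open>Writing the linear program\<close>

text \<open>The number of a subset of \<open>S\<close>, regarded as a subset of \<open>L\<close>, can be summed up along \<open>S\<close>, by adding for each member its weight in \<open>L\<close>.\<close>

lemma enc_weights:
  fixes W :: "nat \<Rightarrow> nat"
  assumes L: "distinct L" "set S \<subseteq> set L" "distinct S"
    and W: "\<And>k. k < length L \<Longrightarrow> W (L ! k) = 2 ^ k"
  shows "(\<Sum>k<length S. of_bool (bit g k) * W (S ! k)) = enc L (sub S g)"
proof -
  have "enc L (sub S g) = (\<Sum>k<length L. of_bool (L ! k \<in> sub S g) * W (L ! k))"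
    unfolding enc_eq_sum by (rule sum.cong) (use W in auto)
  also have "\<dots> = (\<Sum>x\<in>set L. of_bool (x \<in> sub S g) * W x)"
    by (rule sum.reindex_bij_betw[where h = "(!) L"]) (rule bij_betw_nth[OF L(1) refl refl])
  also have "\<dots> = (\<Sum>x\<in>set S. of_bool (x \<in> sub S g) * W x)"
    by (rule sum.mono_neutral_right) (use L sub_subset[of S g] in auto)
  also have "\<dots> = (\<Sum>k<length S. of_bool (S ! k \<in> sub S g) * W (S ! k))"
    by (rule sum.reindex_bij_betw[where h = "(!) S", symmetric]) (rule bij_betw_nth[OF L(3) refl refl])
  also have "\<dots> = (\<Sum>k<length S. of_bool (bit g k) * W (S ! k))"
    by (rule sum.cong) (use L(3) nth_in_sub in auto)
  finally show ?thesis ..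
qed

context elimination_lp
begin

lemma base_last: "base (Suc n) = nv + 1"
  by (simp add: base_def nv_def atLeastLessThanSuc_atLeastAtMost)

lemma lay_out_wp:
  assumes "regs s ''n'' = int n" and B: "blocks n bag s"
    and pw: "\<And>i. i \<le> n \<Longrightarrow> arrs s ''pw'' (int i) = 2 ^ i"
  shows "wp orc lay_out (\<lambda>s' t' k'. k' = k \<and> t' \<le> t + 5 * n + 8 \<and> (\<forall>v\<le>n. arrs s' ''base'' (int v) = int (base v)) \<and>
     regs s' ''nv'' = int nv \<and> outp s' = outp s @ [int nv, int (length rows)]) s t k"
  unfolding lay_out_def wp_Seq wp_Assign wp_Store
proof (rule wp_count[where l = 1 and u = "Suc n" and J = "\<lambda>r s' t' k'. k' = k \<and> t' + 5 \<le> t + 5 * r + 4 \<and>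
     regs s' ''h'' = int (base r) \<and> regs s' ''e'' = int (\<Sum>v\<in>{1..<r}. 1 + 2 ^ length (sep v)) \<and>
     (\<forall>v<r. arrs s' ''base'' (int v) = int (base v)) \<and> outp s' = outp s"], goal_cases)
  case (6 r s' t' q')
  have r: "r \<in> {1..n}" using 6(1,2) by auto
  have ar: "arrs s' ''len'' = arrs s ''len''" "arrs s' ''pw'' = arrs s ''pw''"
    using 6(3) by (simp_all add: agree_def)
  have l: "arrs s ''len'' (int r) = int (length (bag r))" using blocks_nth(2)[OF B] r by simp
  have ls: "int (length (bag r)) - 1 = int (length (sep r))" using sep_len[OF r] by simp
  have p: "arrs s ''pw'' (int (length (bag r))) = 2 ^ length (bag r)"
    "arrs s ''pw'' (int (length (sep r))) = 2 ^ length (sep r)"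
  proof -
    have "length (bag r) \<le> n" using length_bag(2)[of r] r by simp
    then show "arrs s ''pw'' (int (length (bag r))) = 2 ^ length (bag r)"
      "arrs s ''pw'' (int (length (sep r))) = 2 ^ length (sep r)"
      using sep_len[OF r] by (simp_all only: pw)
  qed
  have b: "int (base (Suc r)) = int (base r) + 2 ^ length (bag r)" using base_Suc[OF r] by simp
  have e: "int (\<Sum>v\<in>{1..<Suc r}. 1 + 2 ^ length (sep v)) = int (\<Sum>v\<in>{1..<r}. 1 + 2 ^ length (sep v)) + (2 ^ length (sep r) + 1)"
    using 6(1) by simp
  show ?case using 6(4,5) unfolding b e
    by (simp add: ar l ls p less_Suc_eq)
next
  case (7 s' t' q')
  have "int (length rows) = int nv - int n + 1 + int (\<Sum>v\<in>{1..<Suc n}. 1 + 2 ^ length (sep v))"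
    unfolding length_rows by (simp add: nv_def atLeastLessThanSuc_atLeastAtMost)
  moreover have "regs s' ''n'' = int n" using 7(1) assms(1) by (simp add: agree_def)
  ultimately show ?case using 7(2) base_last by (auto simp: less_Suc_eq_le)
qed (use assms in \<open>auto simp: agree_def base_def\<close>)

text \<open>A constraint causes one query for each subset of the bag at which it is placed, hence at most \<open>2\<^sup>w\<close> queries.\<close>

lemma query_constraints_wp:
  assumes "regs s ''m'' = int m" and B: "blocks n bag s"
    and pw: "\<And>i. i \<le> n \<Longrightarrow> arrs s ''pw'' (int i) = 2 ^ i"
    and vert': "\<And>i. i \<in> {1..m} \<Longrightarrow> arrs s ''vert'' (int i) = int (vert i)"
    and base': "\<And>v. v \<le> n \<Longrightarrow> arrs s ''base'' (int v) = int (base v)"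
    and bad0: "\<And>h. arrs s ''bad'' (int h) = 0"
    and orc: "\<And>i y Y. i \<in> {1..m} \<Longrightarrow> (\<And>v. v \<in> K i \<Longrightarrow> y (int v) = of_bool (v \<in> Y)) \<Longrightarrow> orc (int i) y \<longleftrightarrow> acc i Y"
  shows "wp orc query_constraints (\<lambda>s' t' k'. k' \<le> k + m * 2 ^ w \<and> t' \<le> t + m * (2 ^ w * (7 * w + 10) + 8) + 2 \<and>
     (\<forall>h. arrs s' ''bad'' (int h) = of_bool (bad h))) s t k"
  unfolding query_constraints_def
proof (rule wp_count[where l = 1 and u = "Suc m" and J = "\<lambda>r s' t' k'. k' \<le> k + (r - 1) * 2 ^ w \<and>
     t' \<le> t + (r - 1) * (2 ^ w * (7 * w + 10) + 8) + 1 \<and>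
     (\<forall>h. arrs s' ''bad'' (int h) = of_bool (\<exists>i\<in>{1..<r}. \<exists>j<2 ^ length (bag (vert i)).
       h = base (vert i) + j \<and> \<not> acc i (sub (bag (vert i)) j)))"], goal_cases)
  case (6 r s' t' q')
  define v where "v = vert r"
  define L where "L = bag v"
  define old where "old h \<longleftrightarrow> (\<exists>i\<in>{1..<r}. \<exists>j<2 ^ length (bag (vert i)). h = base (vert i) + j \<and> \<not> acc i (sub (bag (vert i)) j))" for h
  have r: "r \<in> {1..m}" "Suc (r - 1) = r" using 6(1,2) by auto
  have vn: "v \<le> n" using vert_le[OF r(1)] by (simp add: v_def)
  have ar: "arrs s' ''len'' = arrs s ''len''" "arrs s' ''pw'' = arrs s ''pw''" "arrs s' ''off'' = arrs s ''off''"
    "arrs s' ''bag'' = arrs s ''bag''" "arrs s' ''vert'' = arrs s ''vert''" "arrs s' ''base'' = arrs s ''base''"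
    using 6(3) by (simp_all add: agree_def decode_def)
  have Lw: "length L \<le> w" "length L \<le> n" using length_bag[OF vn] by (simp_all add: L_def)
  have p: "arrs s ''pw'' (int (length L)) = int (2 ^ length L)" using pw[OF Lw(2)] by simp
  have vr: "arrs s ''vert'' (int r) = int v" using vert'[OF r(1)] by (simp add: v_def)
  note bn = blocks_nth[OF B vn, folded L_def]
  have old: "\<And>h. arrs s' ''bad'' (int h) = of_bool (old h)" using 6(5) by (simp add: old_def)
  have Kv: "x \<in> set L" if "x \<in> K r" for x using K_subset_bag[OF r(1)] that by (auto simp: L_def v_def)
  let ?s = "set_reg ''b'' (int (length L)) (set_reg ''o'' (int (v * Suc n)) (set_reg ''v'' (int v) s'))"
  let ?J = "\<lambda>i s'' t'' q''. q'' \<le> q' + i \<and> t'' \<le> t' + i * (7 * w + 10) + 5 \<and>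
     (\<forall>h. arrs s'' ''bad'' (int h) = of_bool (old h \<or> (\<exists>j<i. h = base v + j \<and> \<not> acc r (sub L j))))"
  have inner: "wp orc (count ''i'' (Const 0) (Fetch ''pw'' (Reg ''b''))
        (decode ''bag'' (Reg ''o'') (Reg ''b'') (Reg ''i'') ;; Query ''d'' (Reg ''r'') ''y'' ;;
         Cond (Equal (Reg ''d'') (Const 0))
           (Store ''bad'' (Add (Fetch ''base'' (Reg ''v'')) (Reg ''i'')) (Const 1)) skip))
     (\<lambda>s t q. ?J (2 ^ length L) s (t - 1) q) ?s (Suc (Suc (Suc (Suc t')))) q'"
  proof (rule wp_count[where l = 0 and u = "2 ^ length L" and J = ?J], goal_cases)
    case (6 i s'' t'' q'')
    have rg: "regs s'' ''o'' = int (v * Suc n)" "regs s'' ''b'' = int (length L)" "regs s'' ''v'' = int v"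
      "regs s'' ''r'' = int r" using 6(3) \<open>regs s' ''r'' = int r\<close> by (simp_all add: agree_def decode_def)
    have ar': "arrs s'' ''bag'' = arrs s ''bag''" "arrs s'' ''pw'' = arrs s ''pw''" "arrs s'' ''base'' = arrs s ''base''"
      using 6(3) by (simp_all add: agree_def decode_def ar)
    show ?case unfolding wp_Seq
      apply (rule wp_conseq[OF decode_wp[where L = L and a = "v * Suc n" and g = i]])
      subgoal by simp
      subgoal for s3 using rg by (simp add: agree_def decode_def)
      subgoal for s3 using rg by (simp add: agree_def decode_def)
      subgoal using 6(4) by simp
      subgoal using 6(2) by simp
      subgoal using distinct_bag vn by (simp add: L_def)
      subgoal for j using bn(3)[of j] by (simp add: ar')
      subgoal for j using pw[of j] Lw by (simp add: ar')
      subgoal premises P for s3 t3 q3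
      proof -
        have rg3: "regs s3 ''r'' = int r" "regs s3 ''v'' = int v" "regs s3 ''i'' = int i"
          and ar3: "arrs s3 ''base'' (int v) = int (base v)" "arrs s3 ''bad'' = arrs s'' ''bad''"
          using P(1) rg 6(4) base'[OF vn] by (simp_all add: agree_def decode_def ar')
        have y: "orc (int r) (arrs s3 ''y'') \<longleftrightarrow> acc r (sub L i)"
        proof (rule orc[OF r(1)])
          fix x assume "x \<in> K r"
          then obtain k where k: "k < length L" "L ! k = x" using Kv by (metis in_set_conv_nth)
          then have "arrs s3 ''y'' (int x) = of_bool (bit i k)" using P(2) by blast
          also have "bit i k \<longleftrightarrow> x \<in> sub L i" using nth_in_sub[of L k i] k distinct_bag[OF vn] by (simp add: L_def)
          finally show "arrs s3 ''y'' (int x) = of_bool (x \<in> sub L i)" .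
        qed
        have t3: "t3 \<le> Suc t'' + 7 * w + 4" "q3 = q''" using P(2) Lw by auto
        have h: "(\<exists>j<Suc i. h = base v + j \<and> \<not> acc r (sub L j)) \<longleftrightarrow>
          (\<exists>j<i. h = base v + j \<and> \<not> acc r (sub L j)) \<or> h = base v + i \<and> \<not> acc r (sub L i)" for h
          by (auto simp: less_Suc_eq)
        show ?thesis
        proof (cases "acc r (sub L i)")
          case True
          then have d: "\<And>h. (\<exists>j<Suc i. h = base v + j \<and> \<not> acc r (sub L j)) \<longleftrightarrow> (\<exists>j<i. h = base v + j \<and> \<not> acc r (sub L j))"
            unfolding h by blast
          from True show ?thesis using 6(5) t3 unfolding d by (simp add: rg3 ar3 y)
        next
          case False
          have "((arrs s'' ''bad'')(int (base v + i) := 1)) (int h)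
            = of_bool (old h \<or> (\<exists>j<Suc i. h = base v + j \<and> \<not> acc r (sub L j)))" for h
            unfolding fun_upd_apply of_nat_eq_iff h using 6(5) False by auto
          then show ?thesis using 6(5) t3 False by (simp add: rg3 ar3 y)
        qed
      qed
      done
  next
    case (3 s'')
    then have "regs s'' ''b'' = int (length L)" "arrs s'' ''pw'' = arrs s ''pw''"
      by (simp_all add: agree_def decode_def ar)
    then show ?case using p by simp
  qed (use old in \<open>auto simp: decode_def\<close>)
  have P: "2 ^ length L \<le> (2::nat) ^ w" using Lw by (intro power_increasing) auto
  have m: "r * c = (r - 1) * c + c" for c :: nat using r(2) by (metis add.commute mult_Suc)
  have new: "(\<exists>i\<in>{1..<Suc r}. \<exists>j<2 ^ length (bag (vert i)). h = base (vert i) + j \<and> \<not> acc i (sub (bag (vert i)) j))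
      \<longleftrightarrow> old h \<or> (\<exists>j<2 ^ length L. h = base v + j \<and> \<not> acc r (sub L j))" for h
  proof -
    have "{1..<Suc r} = insert r {1..<r}" using 6(1) by auto
    then show ?thesis by (simp only: old_def L_def v_def bex_simps disj_commute)
  qed
  have P2: "2 ^ length L * (7 * w + 10) \<le> 2 ^ w * (7 * w + 10)" using P by (rule mult_le_mono1)
  have "wp orc (count ''i'' (Const 0) (Fetch ''pw'' (Reg ''b''))
        (decode ''bag'' (Reg ''o'') (Reg ''b'') (Reg ''i'') ;; Query ''d'' (Reg ''r'') ''y'' ;;
         Cond (Equal (Reg ''d'') (Const 0))
           (Store ''bad'' (Add (Fetch ''base'' (Reg ''v'')) (Reg ''i'')) (Const 1)) skip))
     (\<lambda>s'' t'' q''. \<forall>c. q'' \<le> k + (Suc r - 1) * 2 ^ w \<and>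
        Suc t'' \<le> t + (Suc r - 1) * (2 ^ w * (7 * w + 10) + 8) + 1 \<and>
        (\<forall>h. arrs (set_reg ''r'' c s'') ''bad'' (int h) = of_bool (\<exists>i\<in>{1..<Suc r}. \<exists>j<2 ^ length (bag (vert i)).
          h = base (vert i) + j \<and> \<not> acc i (sub (bag (vert i)) j)))) ?s (Suc (Suc (Suc (Suc t')))) q'"
  proof (rule wp_conseq[OF inner])
    fix s4 :: state and t4 q4 :: nat assume Q: "?J (2 ^ length L) s4 (t4 - 1) q4"
    have "q4 \<le> k + r * 2 ^ w" using Q 6(5) P m[of "2 ^ w"] by linarith
    moreover have "Suc t4 \<le> t + r * (2 ^ w * (7 * w + 10) + 8) + 1"
      using Q 6(5) P2 m[of "2 ^ w * (7 * w + 10) + 8"] by linarith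
    ultimately show "\<forall>c. q4 \<le> k + (Suc r - 1) * 2 ^ w \<and>
        Suc t4 \<le> t + (Suc r - 1) * (2 ^ w * (7 * w + 10) + 8) + 1 \<and>
        (\<forall>h. arrs (set_reg ''r'' c s4) ''bad'' (int h) = of_bool (\<exists>i\<in>{1..<Suc r}. \<exists>j<2 ^ length (bag (vert i)).
          h = base (vert i) + j \<and> \<not> acc i (sub (bag (vert i)) j)))"
      unfolding new arrs_set_reg diff_Suc_1 using Q by blast
  qed
  then show ?case unfolding wp_Seq wp_Assign using 6(4) by (simp add: ar vr bn(1,2))
next
  case (7 s' t' q')
  then show ?case by (auto simp: bad_def atLeastLessThanSuc_atLeastAtMost)
qed (use assms in \<open>auto simp: agree_def decode_def\<close>)

lemma emit_bounds_wp:
  assumes "regs s ''n'' = int n" "regs s ''nv'' = int nv"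
    and bad': "\<And>h. arrs s ''bad'' (int h) = of_bool (bad h)"
  shows "wp orc emit_bounds (\<lambda>s' t' k'. k' = k \<and> t' \<le> t + 7 * nv + 10 \<and>
     outp s' = outp s @ concat (map row_code (map bound_row [n + 1..<nv + 1] @ [root_row]))) s t k"
  unfolding emit_bounds_def wp_Seq
proof (rule wp_count[where l = "n + 1" and u = "nv + 1" and J = "\<lambda>r s' t' k'. k' = k \<and> t' + 7 * (n + 1) \<le> t + 7 * r + 1 \<and>
     outp s' = outp s @ concat (map row_code (map bound_row [n + 1..<r]))"], goal_cases)
  case (6 r s' t' q')
  have "arrs s' ''bad'' = arrs s ''bad''" using 6(3) by (simp add: agree_def)
  then show ?case using 6(1,4,5) bad'[of r]
    by (simp add: row_code_def bound_row_def)
next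
  case (7 s' t' q')
  have "regs s' ''n'' = int n" using 7(1) assms(1) by (simp add: agree_def)
  then show ?case using 7(2) by (simp add: row_code_def root_row_def del: upt_Suc)
qed (use assms in \<open>auto simp: agree_def nv_def\<close>)

lemma emit_vertex_row_wp:
  assumes v: "v \<in> {1..n}" "regs s ''r'' = int v" and B: "blocks n bag s"
    and pw: "\<And>i. i \<le> n \<Longrightarrow> arrs s ''pw'' (int i) = 2 ^ i"
    and base': "\<And>v. v \<le> n \<Longrightarrow> arrs s ''base'' (int v) = int (base v)"
  shows "wp orc emit_vertex_row (\<lambda>s' t' k'. k' = k \<and> t' \<le> t + 4 * 2 ^ length (sep v) + 10 \<and>
     regs s' ''o'' = int (v * Suc n + 1) \<and> regs s' ''b'' = int (length (sep v)) \<and> regs s' ''a'' = int (base v) \<and>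
     outp s' = outp s @ row_code (vertex_row v)) s t k"
proof -
  have vn: "v \<le> n" using v by simp
  note bn = blocks_nth(1,2)[OF B vn]
  have ls: "int (length (bag v)) - 1 = int (length (sep v))" using sep_len[OF v(1)] by simp
  have p: "arrs s ''pw'' (int (length (sep v))) = int (2 ^ length (sep v))"
    using pw[of "length (sep v)"] length_bag(2)[OF vn] sep_len[OF v(1)] by simp
  have core: "wp orc (count ''i'' (Const 0) (Fetch ''pw'' (Reg ''b''))
       (Emit (plus1 (Add (Reg ''a'') (Add (Reg ''i'') (Reg ''i'')))) ;; Emit (Const (-1))))
     (\<lambda>s' t' k'. k' = k \<and> t' \<le> t + 4 * 2 ^ length (sep v) + 10 \<and>
     regs s' ''o'' = int (v * Suc n + 1) \<and> regs s' ''b'' = int (length (sep v)) \<and> regs s' ''a'' = int (base v) \<and>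
     outp s' = outp s @ row_code (vertex_row v)) s1 t1 k"
    if s1: "regs s1 ''a'' = int (base v)" "regs s1 ''b'' = int (length (sep v))" "regs s1 ''o'' = int (v * Suc n + 1)"
      "outp s1 = outp s @ [0, 0, 2 ^ length (sep v) + 1, int v, 1]" "arrs s1 = arrs s" "t1 = t + 8" for s1 t1
  proof (rule wp_count[where l = 0 and u = "2 ^ length (sep v)" and J = "\<lambda>i s' t' k'. k' = k \<and> t' \<le> t + 9 + 4 * i \<and>
       outp s' = outp s1 @ concat (map (\<lambda>i. [int (base v + (2 * i + 1)), -1]) [0..<i])"], goal_cases)
    case (3 s')
    then show ?case using p by (simp add: agree_def s1)
  next
    case (6 i s' t' q')
    then have "regs s' ''a'' = int (base v)" by (simp add: agree_def s1)
    then show ?case using 6(4,5) by simp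
  next
    case (7 s' t' q')
    then have "regs s' ''a'' = int (base v)" "regs s' ''b'' = int (length (sep v))" "regs s' ''o'' = int (v * Suc n + 1)"
      by (simp_all add: agree_def s1)
    then show ?case using 7(2) by (simp add: s1 row_code_def vertex_row_def comp_def)
  qed (use s1 in auto)
  show ?thesis unfolding emit_vertex_row_def wp_Seq wp_Assign wp_Emit
    by (rule core) (simp_all add: bn ls base'[OF vn] v(2) p)
qed

end

context elimination_lp
begin

lemma split_parent_wp:
  assumes v: "v \<in> {1..n}" "regs s ''r'' = int v" and B: "blocks n bag s"
    and pw: "\<And>i. i \<le> n \<Longrightarrow> arrs s ''pw'' (int i) = 2 ^ i"
    and par': "arrs s ''par'' (int v) = int (par v)"
    and o: "regs s ''o'' = int (v * Suc n + 1)" "regs s ''b'' = int (length (sep v))"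
    and mark: "\<And>x. arrs s ''mark'' (int x) < int v"
  shows "wp orc split_parent (\<lambda>s' t' k'. k' = k \<and> t' \<le> t + 3 * length (sep v) + 7 * length (bag (par v)) + 6 \<and>
     regs s' ''p'' = int (par v) \<and> regs s' ''f'' = int (length (free v)) \<and>
     (\<forall>i<length (free v). arrs s' ''free'' (int i) = int (free v ! i)) \<and>
     (\<forall>i<length (bag (par v)). arrs s' ''wt'' (int (bag (par v) ! i)) = 2 ^ i) \<and>
     (\<forall>x. arrs s' ''mark'' (int x) < int (Suc v))) s t k"
proof -
  have vn: "v \<le> n" "par v \<le> n" using v par_le[OF v(1)] by auto
  note bn = blocks_nth[OF B vn(1)] and bp = blocks_nth[OF B vn(2)]
  have sepn: "arrs s ''bag'' (int (v * Suc n + 1) + int i) = int (sep v ! i)" if "i < length (sep v)" for i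
    using bn(3)[of "Suc i"] that bag_Cons[OF v(1)] by (simp add: add.commute add.left_commute)
  define L where "L = bag (par v)"
  have L: "distinct L" "length L \<le> n" using distinct_bag[OF vn(2)] length_bag(2)[OF vn(2)] by (simp_all add: L_def)
  define marked where "marked s' \<longleftrightarrow> (\<forall>x. (arrs s' ''mark'' (int x) = int v \<longleftrightarrow> x \<in> set (sep v)) \<and>
     arrs s' ''mark'' (int x) \<le> int v)" for s' :: state
  show ?thesis unfolding split_parent_def wp_Seq wp_Assign
  proof (rule wp_count[where l = 0 and u = "length (sep v)" and J = "\<lambda>i s' t' k'. k' = k \<and> t' \<le> t + 3 * i + 2 \<and>
     (\<forall>x. (arrs s' ''mark'' (int x) = int v \<longleftrightarrow> x \<in> set (take i (sep v))) \<and> arrs s' ''mark'' (int x) \<le> int v)"], goal_cases)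
    case 5
    have "arrs s ''mark'' (int x) \<noteq> int v \<and> arrs s ''mark'' (int x) \<le> int v" for x
      using mark[of x] by simp
    then show ?case by simp
  next
    case (6 i s' t' q')
    have "arrs s' ''bag'' = arrs s ''bag''" "regs s' ''o'' = int (v * Suc n + 1)" "regs s' ''r'' = int v"
      using 6(3) o v(2) by (simp_all add: agree_def)
    moreover have "take (Suc i) (sep v) = take i (sep v) @ [sep v ! i]" using 6(2) by (rule take_Suc_conv_app_nth)
    ultimately show ?case using 6(4,5) sepn[OF 6(2)]
      by (simp del: of_nat_add of_nat_mult mult_Suc_right) simp
  next
    case (7 s1 t1 q1)
    have m1: "marked s1" and t1: "t1 \<le> t + 3 * length (sep v) + 2" "q1 = k" using 7(2) by (simp_all add: marked_def)
    have p1: "regs s1 ''p'' = int (par v)" "regs s1 ''r'' = int v"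
      and ar1: "arrs s1 ''len'' = arrs s ''len''" "arrs s1 ''off'' = arrs s ''off''" "arrs s1 ''bag'' = arrs s ''bag''"
        "arrs s1 ''pw'' = arrs s ''pw''"
      using 7(1) par' v(2) by (simp_all add: agree_def)
    let ?F = "\<lambda>i. filter (\<lambda>x. x \<notin> set (sep v)) (take i L)"
    show ?case
    proof (rule wp_count[where l = 0 and u = "length L" and J = "\<lambda>i s' t' k'. k' = k \<and> t' \<le> t1 + 7 * i + 3 \<and>
       regs s' ''f'' = int (length (?F i)) \<and> (\<forall>j<length (?F i). arrs s' ''free'' (int j) = int (?F i ! j)) \<and>
       (\<forall>j<i. arrs s' ''wt'' (int (L ! j)) = 2 ^ j)"], goal_cases)
      case (3 s')
      then show ?case using bp(2) p1 by (simp add: agree_def ar1 L_def)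
    next
      case (6 i s' t' q')
      have ar: "regs s' ''p'' = int (par v)" "regs s' ''r'' = int v" "arrs s' ''mark'' = arrs s1 ''mark''"
        "arrs s' ''off'' = arrs s ''off''" "arrs s' ''bag'' = arrs s ''bag''" "arrs s' ''pw'' = arrs s ''pw''"
        using 6(3) p1 by (simp_all add: agree_def ar1)
      define x where "x = L ! i"
      have take: "take (Suc i) L = take i L @ [x]" using 6(2) by (simp add: take_Suc_conv_app_nth x_def)
      have x: "arrs s ''bag'' (int (par v * Suc n) + int i) = int x" using bp(3)[of i] 6(2) by (simp add: L_def x_def)
      have pi: "arrs s ''pw'' (int i) = 2 ^ i" using pw[of i] 6(2) L(2) by simp
      have mk: "arrs s1 ''mark'' (int x) = int v \<longleftrightarrow> x \<in> set (sep v)" using m1 by (simp add: marked_def)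
      have wt: "\<forall>j<Suc i. ((arrs s' ''wt'')(int x := 2 ^ i)) (int (L ! j)) = 2 ^ j"
      proof (intro allI impI)
        fix j assume j: "j < Suc i"
        show "((arrs s' ''wt'')(int x := 2 ^ i)) (int (L ! j)) = 2 ^ j"
        proof (cases "j = i")
          case False
          then have "L ! j \<noteq> x" using j 6(2) L(1) by (simp add: x_def nth_eq_iff_index_eq)
          then show ?thesis using 6(5) j False by simp
        qed (simp add: x_def)
      qed
      show ?case
      proof (cases "x \<in> set (sep v)")
        case True
        then have F: "?F (Suc i) = ?F i" by (simp add: take)
        have mk1: "arrs s1 ''mark'' (int x) = int v" using mk True by simp
        show ?thesis using 6(4,5) wt unfolding F
          by (simp add: ar bp(1) x pi mk1 del: of_nat_add of_nat_mult mult_Suc_right; simp)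
      next
        case False
        then have F: "?F (Suc i) = ?F i @ [x]" by (simp add: take)
        have mk0: "arrs s1 ''mark'' (int x) \<noteq> int v" using mk False by simp
        have "\<forall>j<length (?F i @ [x]). ((arrs s' ''free'')(int (length (?F i)) := int x)) (int j) = int ((?F i @ [x]) ! j)"
          using 6(5) by (auto simp: nth_append less_Suc_eq)
        then show ?thesis using 6(4,5) wt unfolding F
          by (simp add: ar bp(1) x pi mk0 del: of_nat_add of_nat_mult mult_Suc_right; simp)
      qed
    next
      case (7 s' t' q')
      have "arrs s' ''mark'' = arrs s1 ''mark''" "regs s' ''p'' = int (par v)"
        using 7(1) p1 by (simp_all add: agree_def)
      moreover have "arrs s1 ''mark'' (int x) < int (Suc v)" for x
      proof -
        have "arrs s1 ''mark'' (int x) \<le> int v" using m1 by (simp add: marked_def)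
        then show ?thesis by simp
      qed
      moreover have "?F (length L) = free v" by (simp add: free_def L_def)
      ultimately show ?case using 7(2) t1 by (auto simp: L_def)
    qed (use t1 in auto)
  qed (use assms in \<open>auto simp: agree_def\<close>)
qed

lemma emit_marg_rows_wp:
  assumes v: "v \<in> {1..n}" and B: "blocks n bag s"
    and pw: "\<And>i. i \<le> n \<Longrightarrow> arrs s ''pw'' (int i) = 2 ^ i"
    and base': "\<And>v. v \<le> n \<Longrightarrow> arrs s ''base'' (int v) = int (base v)"
    and rg: "regs s ''o'' = int (v * Suc n + 1)" "regs s ''b'' = int (length (sep v))" "regs s ''a'' = int (base v)"
      "regs s ''p'' = int (par v)" "regs s ''f'' = int (length (free v))"
    and fr: "\<And>i. i < length (free v) \<Longrightarrow> arrs s ''free'' (int i) = int (free v ! i)"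
    and wt: "\<And>i. i < length (bag (par v)) \<Longrightarrow> arrs s ''wt'' (int (bag (par v) ! i)) = 2 ^ i"
  shows "wp orc emit_marg_rows (\<lambda>s' t' k'. k' = k \<and>
     t' \<le> t + 2 ^ length (sep v) * (7 * w + 20) + 2 ^ length (bag (par v)) * (7 * w + 9) + 2 \<and>
     outp s' = outp s @ concat (map row_code (map (marg_row v) [0..<2 ^ length (sep v)]))) s t k"
proof -
  have vn: "v \<le> n" "par v \<le> n" using v par_le[OF v(1)] by auto
  note bn = blocks_nth[OF B vn(1)]
  define L where "L = bag (par v)"
  define F where "F = free v"
  define S where "S = sep v"
  have L: "distinct L" "length L \<le> w" "length L \<le> n"
    using distinct_bag[OF vn(2)] length_bag[OF vn(2)] by (simp_all add: L_def)
  have S: "distinct S" "length S \<le> w" "length S \<le> n" "set S \<subseteq> set L"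
    using distinct_sep[OF v] length_bag[OF vn(1)] sep_len[OF v] sep_subset_bag[OF v] by (simp_all add: S_def L_def)
  have F: "distinct F" "set F \<subseteq> set L" using distinct_free[OF v] set_free[of v] by (auto simp: F_def L_def)
  \<comment> \<open>Hence the number of rows and the number of parent entries per row multiply to the number of subsets of the bag of the parent.\<close>
  have LSF: "length L = length S + length F"
  proof -
    have "card (set L) = card (set S) + card (set F)"
      using S(4) by (subst card_Un_disjoint[symmetric]) (auto simp: F_def set_free S_def L_def intro!: arg_cong[where f = card])
    then show ?thesis using L(1) S(1) F(1) by (simp add: distinct_card)
  qed
  have Fw: "length F \<le> w" "length F \<le> n" using LSF L by auto
  have sepn: "arrs s ''bag'' (int (v * Suc n + 1 + i)) = int (S ! i)" if "i < length S" for i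
    using bn(3)[of "Suc i"] that bag_Cons[OF v(1)] by (simp add: S_def add.commute add.left_commute)
  define W where "W x = nat (arrs s ''wt'' (int x))" for x
  have WL: "W (L ! k) = 2 ^ k" if "k < length L" for k
    using wt[of k] that by (simp add: W_def L_def nat_power_eq)
  have Wi: "arrs s ''wt'' (int x) = int (W x)" if "x \<in> set L" for x
  proof -
    obtain k where "k < length L" "L ! k = x" using \<open>x \<in> set L\<close> by (metis in_set_conv_nth)
    then show ?thesis using WL[of k] wt[of k] by (simp add: L_def)
  qed
  have weights: "(\<Sum>k<length X. of_bool (bit g k) * arrs s ''wt'' (int (X ! k))) = int (enc L (sub X g))"
    if X: "distinct X" "set X \<subseteq> set L" for X g
  proof -
    have "(\<Sum>k<length X. of_bool (bit g k) * arrs s ''wt'' (int (X ! k))) = (\<Sum>k<length X. int (of_bool (bit g k) * W (X ! k)))"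
    proof (rule sum.cong[OF refl])
      fix k assume "k \<in> {..<length X}"
      then have "X ! k \<in> set L" using X(2) nth_mem by blast
      from Wi[OF this] show "of_bool (bit g k) * arrs s ''wt'' (int (X ! k)) = int (of_bool (bit g k) * W (X ! k))"
        by simp
    qed
    also have "\<dots> = int (enc L (sub X g))"
      using enc_weights[OF L(1) X(2,1) WL, of g] by (simp flip: of_nat_sum)
    finally show ?thesis .
  qed
  have pS: "arrs s ''pw'' (int (length S)) = int (2 ^ length S)" and pF: "arrs s ''pw'' (int (length F)) = int (2 ^ length F)"
    using pw S(3) Fw(2) by simp_all
  define cF where "cF = 2 ^ length F * (7 * length F + 9)"
  show ?thesis unfolding emit_marg_rows_def
  proof (rule wp_count[where l = 0 and u = "2 ^ length S" and J = "\<lambda>i s' t' k'. k' = k \<and>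
       t' \<le> t + 1 + i * (7 * w + 20 + cF) \<and> outp s' = outp s @ concat (map row_code (map (marg_row v) [0..<i]))"], goal_cases)
    case (3 s')
    then show ?case using rg(2) pS by (simp add: agree_def decode_def S_def)
  next
    case (6 i s' t' q')
    have rg': "regs s' ''o'' = int (v * Suc n + 1)" "regs s' ''b'' = int (length S)" "regs s' ''a'' = int (base v)"
      "regs s' ''p'' = int (par v)" "regs s' ''f'' = int (length F)" "regs s' ''i'' = int i"
      using 6(3,4) rg by (simp_all add: agree_def decode_def S_def F_def)
    have ar: "arrs s' ''bag'' = arrs s ''bag''" "arrs s' ''pw'' = arrs s ''pw''" "arrs s' ''wt'' = arrs s ''wt''"
      "arrs s' ''free'' = arrs s ''free''" "arrs s' ''base'' = arrs s ''base''"
      using 6(3) by (simp_all add: agree_def decode_def)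
    define u where "u = base (par v) + enc L (sub S i)"
    define R where "R s1 t1 q1 \<longleftrightarrow> q1 = k \<and> t1 + 1 \<le> t + 1 + Suc i * (7 * w + 20 + cF) \<and>
      outp s1 = outp s' @ row_code (marg_row v i)" for s1 :: state and t1 q1 :: nat
    have core: "wp orc (count ''j'' (Const 0) (Fetch ''pw'' (Reg ''f''))
        (decode ''free'' (Const 0) (Reg ''f'') (Reg ''j'') ;; Emit (Add (Reg ''u'') (Reg ''acc'')) ;; Emit (Const (-1))))
       R s1 t1 k"
      if s1: "regs s1 ''u'' = int u" "regs s1 ''f'' = int (length F)" "arrs s1 ''pw'' = arrs s ''pw''"
        "arrs s1 ''free'' = arrs s ''free''" "arrs s1 ''wt'' = arrs s ''wt''"
        "outp s1 = outp s' @ [0, 0, 2 ^ length F + 2, int (base v + 2 * i), 1, int (base v + (2 * i + 1)), 1]"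
        "t1 \<le> t' + 7 * w + 13" for s1 t1
    proof (rule wp_count[where l = 0 and u = "2 ^ length F" and J = "\<lambda>j s2 t2 q2. q2 = k \<and> t2 \<le> t1 + 1 + j * (7 * length F + 9) \<and>
        outp s2 = outp s1 @ concat (map (\<lambda>j. [int (u + enc L (sub F j)), -1]) [0..<j])"], goal_cases)
      case (3 s2)
      then show ?case using s1(2) pF by (simp add: agree_def decode_def s1(3))
    next
      case (6 j s2 t2 q2)
      have rg2: "regs s2 ''u'' = int u" "regs s2 ''f'' = int (length F)"
        and ar2: "arrs s2 ''pw'' = arrs s ''pw''" "arrs s2 ''free'' = arrs s ''free''" "arrs s2 ''wt'' = arrs s ''wt''"
        using 6(3) s1 by (simp_all add: agree_def decode_def)
      show ?case unfolding wp_Seq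
        apply (rule wp_conseq[OF decode_wp[where L = F and a = 0 and g = j]])
        subgoal by simp
        subgoal by simp
        subgoal for s3 using rg2 by (simp add: agree_def decode_def)
        subgoal using 6(4) by simp
        subgoal using 6(2) by simp
        subgoal by (rule F(1))
        subgoal for l using fr[of l] by (simp add: ar2 F_def)
        subgoal for l using pw[of l] Fw by (simp add: ar2)
        subgoal premises P for s3 t3 q3
        proof -
          have "regs s3 ''u'' = int u" "outp s3 = outp s2"
            using P(1) rg2 by (simp_all add: agree_def decode_def)
          moreover have "regs s3 ''acc'' = int (enc L (sub F j))"
            using P(2) weights[OF F] by (simp add: ar2)
          ultimately show ?thesis using P(2) 6(5) by simp
        qed
        done
    next
      case (7 s2 t2 q2)
      have e: "[0, 0, 2 ^ length F + 2, int (base v + 2 * i), 1, int (base v + (2 * i + 1)), 1] @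
          concat (map (\<lambda>j. [int (u + enc L (sub F j)), -1]) [0..<2 ^ length F]) = row_code (marg_row v i)"
        by (simp add: row_code_def marg_row_def comp_def u_def F_def L_def S_def add.assoc)
      have "t2 + 2 \<le> t1 + 3 + cF" using 7(2) by (simp add: cF_def)
      then have "Suc t2 + 1 \<le> t + 1 + Suc i * (7 * w + 20 + cF)" using s1(7) \<open>q' = k \<and> _\<close> by simp
      then show ?case using 7(2) unfolding R_def s1(6) e[symmetric] by simp
    qed (use s1 in \<open>auto simp: decode_def\<close>)
    have RJ: "R = (\<lambda>s'' t'' q''. q'' = k \<and> t'' + 1 \<le> t + 1 + Suc i * (7 * w + 20 + cF) \<and>
        outp s'' = outp s @ concat (map row_code (map (marg_row v) [0..<Suc i])))"
      using 6(5) by (auto simp: R_def fun_eq_iff)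
    have "wp orc (decode ''bag'' (Reg ''o'') (Reg ''b'') (Reg ''i'') ;; ''u'' ::= Add (Fetch ''base'' (Reg ''p'')) (Reg ''acc'') ;;
      Emit (Const 0) ;; Emit (Const 0) ;; Emit (Add (Fetch ''pw'' (Reg ''f'')) (Const 2)) ;;
      Emit (Add (Reg ''a'') (Add (Reg ''i'') (Reg ''i''))) ;; Emit (Const 1) ;;
      Emit (plus1 (Add (Reg ''a'') (Add (Reg ''i'') (Reg ''i'')))) ;; Emit (Const 1) ;;
      count ''j'' (Const 0) (Fetch ''pw'' (Reg ''f''))
        (decode ''free'' (Const 0) (Reg ''f'') (Reg ''j'') ;; Emit (Add (Reg ''u'') (Reg ''acc'')) ;; Emit (Const (-1)))) R s' (Suc t') q'"
      unfolding wp_Seq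
      apply (rule wp_conseq[OF decode_wp[where L = S and a = "v * Suc n + 1" and g = i]])
      subgoal by simp
      subgoal for s3 using rg' by (simp add: agree_def decode_def)
      subgoal for s3 using rg' by (simp add: agree_def decode_def)
      subgoal using 6(4) by simp
      subgoal using 6(2) by simp
      subgoal by (rule S(1))
      subgoal for l using sepn[of l] by (simp add: ar)
      subgoal for l using pw[of l] S by (simp add: ar)
      subgoal premises P for s3 t3 q3
      proof -
        have rg3: "regs s3 ''p'' = int (par v)" "regs s3 ''a'' = int (base v)" "regs s3 ''f'' = int (length F)" "regs s3 ''i'' = int i"
          and ar3: "outp s3 = outp s'" "arrs s3 ''pw'' = arrs s ''pw''" "arrs s3 ''free'' = arrs s ''free''"
          "arrs s3 ''wt'' = arrs s ''wt''" "arrs s3 ''base'' = arrs s ''base''"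
          using P(1) rg' by (simp_all add: agree_def decode_def ar)
        have "regs s3 ''acc'' = int (enc L (sub S i))"
          using P(2) weights[OF S(1,4)] by (simp add: ar)
        moreover have "q3 = k" "t3 \<le> t' + 7 * w + 5" using P(2) S(2) 6(5) by auto
        ultimately show ?thesis using base'[OF vn(2)] pF
          by (simp add: rg3 ar3) (rule core, simp_all add: rg3 ar3 u_def)
      qed
      done
    then show ?case unfolding RJ
      by (rule wp_conseq) (simp only: outp_set_reg Suc_eq_plus1 simp_thms; blast)
  next
    case (7 s' t' q')
    have "2 ^ length S * cF = 2 ^ length L * (7 * length F + 9)"
      by (simp add: cF_def LSF power_add)
    also have "\<dots> \<le> 2 ^ length L * (7 * w + 9)" using Fw by simp
    finally have "2 ^ length S * (7 * w + 20 + cF) \<le> 2 ^ length S * (7 * w + 20) + 2 ^ length L * (7 * w + 9)"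
      by (simp add: distrib_left)
    then show ?case using 7(2) by (simp add: S_def L_def)
  qed (use assms in \<open>auto simp: decode_def\<close>)
qed

text \<open>An upper bound for the time spent on the rows of \<open>v\<close>. The marginal rows partition the subsets of the bag of the
  parent, and each subset of either bag is decoded in \<open>O(w)\<close> steps.\<close>

definition vertex_cost :: "nat \<Rightarrow> nat" where
  "vertex_cost v = (2 ^ length (bag v) + 2 ^ length (bag (par v))) * (17 * w + 60)"

lemma emit_vertices_wp:
  assumes n: "regs s ''n'' = int n" and B: "blocks n bag s"
    and pw: "\<And>i. i \<le> n \<Longrightarrow> arrs s ''pw'' (int i) = 2 ^ i"
    and base': "\<And>v. v \<le> n \<Longrightarrow> arrs s ''base'' (int v) = int (base v)"
    and par': "\<And>v. v \<in> {1..n} \<Longrightarrow> arrs s ''par'' (int v) = int (par v)"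
    and mark: "\<And>x. arrs s ''mark'' (int x) = 0"
  shows "wp orc emit_vertices (\<lambda>s' t' k'. k' = k \<and> t' \<le> t + sum vertex_cost {1..n} + 2 \<and>
     outp s' = outp s @ concat (map row_code (concat (map vertex_block [1..<n + 1])))) s t k"
  unfolding emit_vertices_def
proof (rule wp_count[where l = 1 and u = "Suc n" and J = "\<lambda>v s' t' k'. k' = k \<and> t' \<le> t + 1 + sum vertex_cost {1..<v} \<and>
     (\<forall>x. arrs s' ''mark'' (int x) < int v) \<and>
     outp s' = outp s @ concat (map row_code (concat (map vertex_block [1..<v])))"], goal_cases)
  case (6 v s' t' q')
  have v: "v \<in> {1..n}" using 6(1,2) by auto
  have ar: "arrs s' ''bag'' = arrs s ''bag''" "arrs s' ''off'' = arrs s ''off''" "arrs s' ''len'' = arrs s ''len''"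
    "arrs s' ''pw'' = arrs s ''pw''" "arrs s' ''base'' = arrs s ''base''" "arrs s' ''par'' = arrs s ''par''"
    using 6(3) by (simp_all add: agree_def decode_def emit_vertex_row_def split_parent_def emit_marg_rows_def)
  have B': "blocks n bag s'" using B by (simp add: blocks_def ar)
  have pw': "\<And>i. i \<le> n \<Longrightarrow> arrs s' ''pw'' (int i) = 2 ^ i" and base'': "\<And>v. v \<le> n \<Longrightarrow> arrs s' ''base'' (int v) = int (base v)"
    and par'': "arrs s' ''par'' (int v) = int (par v)"
    using pw base' par'[OF v] by (simp_all add: ar)
  have len: "length (sep v) \<le> w" "length (bag (par v)) \<le> w" "length (bag v) = Suc (length (sep v))"
    using length_bag(1)[of v] length_bag(1)[OF par_le[OF v]] sep_len[OF v] v by auto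
  show ?case
  proof (rule wp_cut[OF emit_vertex_row_wp[OF v 6(4) B' pw' base'']])
    fix s1 t1 q1 assume a1: "agree emit_vertex_row s' s1" and P1: "q1 = q' \<and> t1 \<le> Suc t' + 4 * 2 ^ length (sep v) + 10 \<and>
      regs s1 ''o'' = int (v * Suc n + 1) \<and> regs s1 ''b'' = int (length (sep v)) \<and> regs s1 ''a'' = int (base v) \<and>
      outp s1 = outp s' @ row_code (vertex_row v)"
    have ar1: "arrs s1 = arrs s'" "regs s1 ''r'' = int v"
      using a1 6(4) by (auto simp: agree_def emit_vertex_row_def)
    have B1: "blocks n bag s1" using B' by (simp add: blocks_def ar1)
    have mark1: "arrs s1 ''mark'' (int x) < int v" for x using 6(5) by (simp add: ar1)
    show "wp orc (split_parent ;; emit_marg_rows) (\<lambda>s'' t'' k'. \<forall>c. k' = k \<and> Suc t'' \<le> t + 1 + sum vertex_cost {1..<Suc v} \<and>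
       (\<forall>x. arrs (set_reg ''r'' c s'') ''mark'' (int x) < int (Suc v)) \<and>
       outp (set_reg ''r'' c s'') = outp s @ concat (map row_code (concat (map vertex_block [1..<Suc v])))) s1 t1 q1"
    proof (rule wp_cut[OF split_parent_wp[OF v ar1(2) B1 _ _ _ _ mark1]])
      fix s2 t2 q2 assume a2: "agree split_parent s1 s2" and P2: "q2 = q1 \<and>
         t2 \<le> t1 + 3 * length (sep v) + 7 * length (bag (par v)) + 6 \<and>
         regs s2 ''p'' = int (par v) \<and> regs s2 ''f'' = int (length (free v)) \<and>
         (\<forall>i<length (free v). arrs s2 ''free'' (int i) = int (free v ! i)) \<and>
         (\<forall>i<length (bag (par v)). arrs s2 ''wt'' (int (bag (par v) ! i)) = 2 ^ i) \<and>
         (\<forall>x. arrs s2 ''mark'' (int x) < int (Suc v))"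
      have ar2: "arrs s2 ''bag'' = arrs s' ''bag''" "arrs s2 ''off'' = arrs s' ''off''" "arrs s2 ''len'' = arrs s' ''len''"
          "arrs s2 ''pw'' = arrs s' ''pw''" "arrs s2 ''base'' = arrs s' ''base''"
        and rg2: "regs s2 ''o'' = int (v * Suc n + 1)" "regs s2 ''b'' = int (length (sep v))" "regs s2 ''a'' = int (base v)"
        and out2: "outp s2 = outp s' @ row_code (vertex_row v)"
        using a2 P1 by (simp_all add: agree_def split_parent_def ar1 del: of_nat_add of_nat_mult mult_Suc_right)
      have B2: "blocks n bag s2" using B' by (simp add: blocks_def ar2)
      show "wp orc emit_marg_rows (\<lambda>s'' t'' k'. \<forall>c. k' = k \<and> Suc t'' \<le> t + 1 + sum vertex_cost {1..<Suc v} \<and>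
         (\<forall>x. arrs (set_reg ''r'' c s'') ''mark'' (int x) < int (Suc v)) \<and>
         outp (set_reg ''r'' c s'') = outp s @ concat (map row_code (concat (map vertex_block [1..<Suc v])))) s2 t2 q2"
      proof (rule wp_conseq[OF emit_marg_rows_wp[OF v B2]])
        fix s3 t3 q3 assume a3: "agree emit_marg_rows s2 s3" and P3: "q3 = q2 \<and>
          t3 \<le> t2 + 2 ^ length (sep v) * (7 * w + 20) + 2 ^ length (bag (par v)) * (7 * w + 9) + 2 \<and>
          outp s3 = outp s2 @ concat (map row_code (map (marg_row v) [0..<2 ^ length (sep v)]))"
        have mk: "arrs s3 ''mark'' = arrs s2 ''mark''" using a3 by (simp add: agree_def emit_marg_rows_def decode_def)
        have "[1..<Suc v] = [1..<v] @ [v]" using v by (simp add: upt_Suc)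
        then have out: "outp s3 = outp s @ concat (map row_code (concat (map vertex_block [1..<Suc v])))"
          using P3 out2 6(5) by (simp add: vertex_block_def del: upt_Suc)
        define a b where "a = (2::nat) ^ length (sep v)" and "b = (2::nat) ^ length (bag (par v))"
        have ab: "1 \<le> a" "1 \<le> b" by (simp_all add: a_def b_def)
        have "vertex_cost v = (2 * a + b) * (17 * w + 60)" by (simp add: vertex_cost_def a_def b_def len(3))
        moreover have "a * (7 * w + 20) + b * (7 * w + 9) + 4 * a + 10 * w + 30 \<le> (2 * a + b) * (17 * w + 60)"
        proof -
          have "10 * w + 30 \<le> a * (10 * w + 30)" using ab(1) by simp
          then show ?thesis by (simp add: algebra_simps; linarith)
        qed
        moreover have "sum vertex_cost {1..<Suc v} = sum vertex_cost {1..<v} + vertex_cost v" using v by simp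
        moreover have "t3 + 1 \<le> t' + a * (7 * w + 20) + b * (7 * w + 9) + 4 * a + 10 * w + 20"
          using P1 P2 P3 len(1,2) unfolding a_def[symmetric] b_def[symmetric] by linarith
        ultimately have "Suc t3 \<le> t + 1 + sum vertex_cost {1..<Suc v}" using 6(5) by linarith
        then show "\<forall>c. q3 = k \<and> Suc t3 \<le> t + 1 + sum vertex_cost {1..<Suc v} \<and>
         (\<forall>x. arrs (set_reg ''r'' c s3) ''mark'' (int x) < int (Suc v)) \<and>
         outp (set_reg ''r'' c s3) = outp s @ concat (map row_code (concat (map vertex_block [1..<Suc v])))"
          using out P1 P2 P3 6(5) by (simp only: mk arrs_set_reg outp_set_reg simp_thms)
      qed (use P2 rg2 pw' base'' in \<open>simp_all add: ar2 del: of_nat_add of_nat_mult mult_Suc_right\<close>)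
    qed (use P1 pw' par'' in \<open>simp_all add: ar1 del: of_nat_add of_nat_mult mult_Suc_right\<close>)
  qed
next
  case (7 s' t' q')
  then show ?case by (simp add: atLeastLessThanSuc_atLeastAtMost)
qed (use assms in \<open>auto simp: agree_def decode_def emit_vertex_row_def split_parent_def emit_marg_rows_def\<close>)

end

section \<open>From the numbering to the output\<close>

lemmas phase_defs = read_sizes_def locate_def add_half_edge_def read_edges_def visit_neighbours_def
  search_tree_def number_vertices_def initial_bags_def powers_of_two_def find_last_def insert_vertex_def
  absorb_list_def absorb_constraints_def absorb_separators_def lay_out_def decode_def query_constraints_def
  emit_bounds_def emit_vertex_row_def split_parent_def emit_marg_rows_def emit_vertices_def

context elimination_lp
begin

text \<open>The phases following the numbering of the vertices. The factor \<open>187 * w + 730\<close> collects the constants of all phases,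
  after the sums over the vertices have been replaced by their bounds.\<close>

lemma build_wp:
  fixes koff :: "nat \<Rightarrow> nat"
  assumes nm: "regs s ''n'' = int n" "regs s ''m'' = int m"
    and koff: "\<And>i. i \<in> {1..m} \<Longrightarrow> arrs s ''koff'' (int i) = int (koff i)"
    and inp: "\<And>i. i \<in> {1..m} \<Longrightarrow> arrs s ''input'' (int (koff i)) = int (length (Kl i))"
      "\<And>i j. i \<in> {1..m} \<Longrightarrow> j < length (Kl i) \<Longrightarrow> arrs s ''input'' (int (koff i + 1 + j)) = int (Kl i ! j)"
    and pos': "\<And>v. v \<le> n \<Longrightarrow> arrs s ''pos'' (int v) = int (pos v)"
    and ord': "\<And>c. c \<in> {1..n} \<Longrightarrow> arrs s ''ord'' (int c) = int (ord c)"
    and B: "blocks n (BK 0) s"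
    and pw: "\<And>i. i \<le> n \<Longrightarrow> arrs s ''pw'' (int i) = 2 ^ i"
    and zero: "\<And>h. arrs s ''bad'' (int h) = 0" "\<And>x. arrs s ''mark'' (int x) = 0"
    and outp: "outp s = []"
    and orc: "\<And>i y Y. i \<in> {1..m} \<Longrightarrow> (\<And>v. v \<in> K i \<Longrightarrow> y (int v) = of_bool (v \<in> Y)) \<Longrightarrow> orc (int i) y \<longleftrightarrow> acc i Y"
    and w: "1 \<le> w"
  shows "wp orc (absorb_constraints ;; absorb_separators ;; lay_out ;; query_constraints ;; emit_bounds ;; emit_vertices)
    (\<lambda>s' t' k'. k' \<le> k + m * 2 ^ w \<and> t' \<le> t + (2 ^ w * m + n + 1) * (187 * w + 730) \<and>
       lp_encoding (the_lp c) (outp s')) s t k" (is "wp orc _ ?R s t k")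
proof (rule wp_cut[OF absorb_constraints_wp[OF nm(2) koff inp pos' B]])
  fix s1 t1 k1 assume a1: "agree absorb_constraints s s1" and P1: "k1 = k \<and> t1 \<le> t + m * (w * (2 * w + 14) + 10) + 2 \<and>
     blocks n (BK m) s1 \<and> (\<forall>i\<in>{1..m}. arrs s1 ''vert'' (int i) = int (vert i))"
  have k1: "regs s1 ''n'' = int n" "regs s1 ''m'' = int m" "outp s1 = []" "arrs s1 ''pos'' = arrs s ''pos''" "arrs s1 ''ord'' = arrs s ''ord''"
    "arrs s1 ''pw'' = arrs s ''pw''" "arrs s1 ''bad'' = arrs s ''bad''" "arrs s1 ''mark'' = arrs s ''mark''"
    using a1 nm outp by (simp_all add: agree_def phase_defs)
  show "wp orc (absorb_separators ;; lay_out ;; query_constraints ;; emit_bounds ;; emit_vertices) ?R s1 t1 k1"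
  proof (rule wp_cut[OF absorb_separators_wp])
    fix s2 t2 k2 assume a2: "agree absorb_separators s1 s2" and P2: "k2 = k1 \<and>
       t2 \<le> t1 + (\<Sum>v = 1..n. length (sep v) * (2 * w + 14) + 12) + 2 \<and>
       blocks n bag s2 \<and> (\<forall>v\<in>{1..n}. arrs s2 ''par'' (int v) = int (par v))"
    have k2: "regs s2 ''n'' = int n" "regs s2 ''m'' = int m" "outp s2 = []" "arrs s2 ''vert'' = arrs s1 ''vert''"
      "arrs s2 ''pw'' = arrs s ''pw''" "arrs s2 ''bad'' = arrs s ''bad''" "arrs s2 ''mark'' = arrs s ''mark''"
      using a2 by (simp_all add: agree_def phase_defs k1)
    show "wp orc (lay_out ;; query_constraints ;; emit_bounds ;; emit_vertices) ?R s2 t2 k2"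
    proof (rule wp_cut[OF lay_out_wp])
      fix s3 t3 k3 assume a3: "agree lay_out s2 s3" and P3: "k3 = k2 \<and> t3 \<le> t2 + 5 * n + 8 \<and>
        (\<forall>v\<le>n. arrs s3 ''base'' (int v) = int (base v)) \<and>
        regs s3 ''nv'' = int nv \<and> outp s3 = outp s2 @ [int nv, int (length rows)]"
      have k3: "regs s3 ''n'' = int n" "regs s3 ''m'' = int m" "arrs s3 ''vert'' = arrs s1 ''vert''"
        "arrs s3 ''pw'' = arrs s ''pw''" "arrs s3 ''bad'' = arrs s ''bad''" "arrs s3 ''mark'' = arrs s ''mark''"
        "arrs s3 ''off'' = arrs s2 ''off''" "arrs s3 ''len'' = arrs s2 ''len''" "arrs s3 ''bag'' = arrs s2 ''bag''"
        "arrs s3 ''par'' = arrs s2 ''par''"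
        using a3 by (simp_all add: agree_def phase_defs k2)
      have B3: "blocks n bag s3" using P2 by (simp add: blocks_def k3)
      show "wp orc (query_constraints ;; emit_bounds ;; emit_vertices) ?R s3 t3 k3"
      proof (rule wp_cut[OF query_constraints_wp[OF k3(2) B3 _ _ _ _ orc]])
        fix s4 t4 k4 assume a4: "agree query_constraints s3 s4" and P4: "k4 \<le> k3 + m * 2 ^ w \<and>
           t4 \<le> t3 + m * (2 ^ w * (7 * w + 10) + 8) + 2 \<and> (\<forall>h. arrs s4 ''bad'' (int h) = of_bool (bad h))"
        have k4: "regs s4 ''n'' = int n" "regs s4 ''nv'' = int nv" "outp s4 = outp s3"
          "arrs s4 ''pw'' = arrs s ''pw''" "arrs s4 ''mark'' = arrs s ''mark''" "arrs s4 ''base'' = arrs s3 ''base''"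
          "arrs s4 ''off'' = arrs s2 ''off''" "arrs s4 ''len'' = arrs s2 ''len''" "arrs s4 ''bag'' = arrs s2 ''bag''"
          "arrs s4 ''par'' = arrs s2 ''par''"
          using a4 P3 by (simp_all add: agree_def phase_defs k3)
        show "wp orc (emit_bounds ;; emit_vertices) ?R s4 t4 k4"
        proof (rule wp_cut[OF emit_bounds_wp])
          fix s5 t5 k5 assume a5: "agree emit_bounds s4 s5" and P5: "k5 = k4 \<and> t5 \<le> t4 + 7 * nv + 10 \<and>
             outp s5 = outp s4 @ concat (map row_code (map bound_row [n + 1..<nv + 1] @ [root_row]))"
          have k5: "regs s5 ''n'' = int n" "arrs s5 = arrs s4"
            using a5 by (auto simp: agree_def phase_defs k4)
          have B5: "blocks n bag s5" using P2 by (simp add: blocks_def k4 k5)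
          show "wp orc emit_vertices ?R s5 t5 k5"
          proof (rule wp_conseq[OF emit_vertices_wp[OF k5(1) B5]])
            fix s6 t6 k6 assume P6: "k6 = k5 \<and> t6 \<le> t5 + sum vertex_cost {1..n} + 2 \<and>
              outp s6 = outp s5 @ concat (map row_code (concat (map vertex_block [1..<n + 1])))"
            have "outp s6 = [int nv, int (length rows)] @ concat (map row_code rows)"
              using P6 P5 P3 by (simp add: rows_def k4 k2 del: upt_Suc)
            then have "lp_encoding (the_lp c) (outp s6)" using lp_encoding_the_lp by simp
            moreover have "k6 \<le> k + m * 2 ^ w" using P1 P2 P3 P4 P5 P6 by linarith
            moreover have "t6 \<le> t + (2 ^ w * m + n + 1) * (187 * w + 730)"
            proof -
              define W where "W = (2::nat) ^ w"
              define S where "S = (\<Sum>v = 1..n. (2::nat) ^ length (bag v))"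
              define S' where "S' = (\<Sum>v = 1..n. (2::nat) ^ length (bag (par v)))"
              have S: "S \<le> 4 * (W * m) + 4 * n" "S' \<le> 6 * (W * m) + 5 * n"
                using sum_bag_powers sum_parent_bag_powers by (simp_all add: S_def S'_def W_def mult.assoc)
              have "w \<le> W" using less_exp[of w] by (simp add: W_def)
              have c1: "m * (w * (2 * w + 14) + 10) \<le> (W * m) * (2 * w + 14) + 10 * m"
              proof -
                have "m * (w * (2 * w + 14)) \<le> m * (W * (2 * w + 14))" using \<open>w \<le> W\<close> by simp
                then show ?thesis by (simp add: algebra_simps)
              qed
              have "(\<Sum>v = 1..n. length (sep v) * (2 * w + 14) + 12) \<le> (\<Sum>v = 1..n. 2 ^ length (bag v) * (2 * w + 14) + 12)"
              proof (rule sum_mono)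
                fix v assume v: "v \<in> {1..n}"
                have "length (sep v) \<le> length (bag v)" using sep_len[OF v] by simp
                also have "\<dots> \<le> 2 ^ length (bag v)" using less_exp[of "length (bag v)"] by simp
                finally show "length (sep v) * (2 * w + 14) + 12 \<le> 2 ^ length (bag v) * (2 * w + 14) + 12" by simp
              qed
              also have "\<dots> = S * (2 * w + 14) + 12 * n" by (simp add: S_def sum.distrib sum_distrib_right)
              finally have c2: "(\<Sum>v = 1..n. length (sep v) * (2 * w + 14) + 12) \<le> S * (2 * w + 14) + 12 * n" .
              have "sum vertex_cost {1..n} = (\<Sum>v = 1..n. (2 ^ length (bag v) + 2 ^ length (bag (par v))) * (17 * w + 60))"
                by (rule sum.cong[OF refl]) (rule vertex_cost_def)
              then have c3: "sum vertex_cost {1..n} = (S + S') * (17 * w + 60)"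
                by (simp only: S_def S'_def sum.distrib sum_distrib_right[symmetric])
              have m: "m \<le> W * m" by (simp add: W_def)
              have c4: "m * (2 ^ w * (7 * w + 10) + 8) = (W * m) * (7 * w + 10) + 8 * m"
                by (simp add: W_def algebra_simps)
              have c5: "S * (2 * w + 14) \<le> (4 * (W * m) + 4 * n) * (2 * w + 14)" using S(1) by (rule mult_le_mono1)
              have c6: "(S + S') * (17 * w + 60) \<le> (10 * (W * m) + 9 * n) * (17 * w + 60)"
                by (rule mult_le_mono1) (use S in linarith)
              have nvS: "nv = n + 1 + S" by (simp add: nv_def S_def)
              have "t6 \<le> t + ((W * m) * (2 * w + 14) + 10 * m) + 2 + ((4 * (W * m) + 4 * n) * (2 * w + 14) + 12 * n) + 2 + 5 * n + 8
                + ((W * m) * (7 * w + 10) + 8 * m) + 2 + 7 * nv + 10 + (10 * (W * m) + 9 * n) * (17 * w + 60) + 2"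
                using P1 P2 P3 P4 P5 P6 c1 c2 c3 c4 c5 c6 by linarith
              also have "\<dots> \<le> t + (W * m + n + 1) * (187 * w + 730)"
              proof -
                define x where "x = W * m"
                have "10 * m + 8 * m \<le> 18 * x" using m by (simp add: x_def)
                moreover have "7 * nv \<le> 7 * n + 7 + 28 * x + 28 * n" using S(1) nvS by (simp add: x_def)
                ultimately show ?thesis unfolding x_def[symmetric] by (simp add: algebra_simps)
              qed
              finally show ?thesis by (simp add: W_def)
            qed
            ultimately show "k6 \<le> k + m * 2 ^ w \<and> t6 \<le> t + (2 ^ w * m + n + 1) * (187 * w + 730) \<and>
               lp_encoding (the_lp c) (outp s6)" by simp
          qed (use P2 P3 pw zero in \<open>simp_all add: k4 k5\<close>)
        qed (use P4 k4 in simp_all)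
      qed (use P1 P3 pw zero in \<open>simp_all add: k3\<close>)
    qed (use P2 pw in \<open>simp_all add: k2\<close>)
  qed (use P1 ord' pos' in \<open>simp_all add: k1\<close>)
qed

end

section \<open>From tree-decompositions to elimination orders\<close>

definition bag_list :: "(nat \<Rightarrow> nat set) \<Rightarrow> nat \<Rightarrow> nat list" where
  "bag_list Q t = sorted_list_of_set (Q t)"

text \<open>The vertices in the order of their first occurrence in the bags listed by \<open>q\<close>.\<close>

definition vertex_order :: "(nat \<Rightarrow> nat set) \<Rightarrow> nat list \<Rightarrow> nat list" where
  "vertex_order Q q = fold snoc_new (concat (map (bag_list Q) q)) []"

definition index_pos :: "nat list \<Rightarrow> nat \<Rightarrow> nat" where
  "index_pos vs v = (if v \<in> set vs then Suc (THE i. i < length vs \<and> vs ! i = v) else 0)"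

lemma index_pos_nth: "distinct vs \<Longrightarrow> i < length vs \<Longrightarrow> index_pos vs (vs ! i) = Suc i"
  by (auto simp: index_pos_def nth_eq_iff_index_eq intro!: the_equality)

lemma index_pos_cases:
  assumes "distinct vs" "v \<in> set vs"
  obtains i where "i < length vs" "v = vs ! i" "index_pos vs v = Suc i"
  using assms index_pos_nth by (metis in_set_conv_nth)

lemma vertex_order_props:
  assumes td: "tree_decomposition (ig_vertices P) (ig_edges P) VT ET Q" and q: "search_order VT ET q"
  shows "distinct (vertex_order Q q)" "set (vertex_order Q q) = {1..gb_n P}" "length (vertex_order Q q) = gb_n P"
    and "t \<in> VT \<Longrightarrow> Q t \<subseteq> {1..gb_n P}" "t \<in> VT \<Longrightarrow> finite (Q t)" "v \<in> {1..gb_n P} \<Longrightarrow> \<exists>t\<in>VT. v \<in> Q t"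
proof -
  have V: "ig_vertices P = {1..gb_n P}" by (simp add: ig_vertices_def)
  have QV: "Q t \<subseteq> {1..gb_n P}" if "t \<in> VT" for t using td that by (simp add: tree_decomposition_def V)
  then have finQ: "finite (Q t)" if "t \<in> VT" for t using that finite_subset by blast
  have cover: "\<exists>t\<in>VT. v \<in> Q t" if "v \<in> {1..gb_n P}" for v
    using td that unfolding tree_decomposition_def V induces_connected_def by blast
  show d: "distinct (vertex_order Q q)" by (simp add: vertex_order_def)
  have "set (vertex_order Q q) = (\<Union>t\<in>VT. Q t)"
    using finQ q by (auto simp: vertex_order_def bag_list_def search_order_def)
  then show s: "set (vertex_order Q q) = {1..gb_n P}" using QV cover by blast
  show "length (vertex_order Q q) = gb_n P" using distinct_card[OF d] s by simp
  show "t \<in> VT \<Longrightarrow> Q t \<subseteq> {1..gb_n P}" "t \<in> VT \<Longrightarrow> finite (Q t)" "v \<in> {1..gb_n P} \<Longrightarrow> \<exists>t\<in>VT. v \<in> Q t"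
    using QV finQ cover by auto
qed

lemma good_order_vertex_order:
  assumes td: "tree_decomposition (ig_vertices P) (ig_edges P) VT ET Q" and q: "search_order VT ET q"
  shows "good_order VT Q (index_pos (vertex_order Q q))"
proof (rule first_occurrence_good_order[OF td q])
  let ?vs = "vertex_order Q q"
  note vo = vertex_order_props[OF td q]
  fix u v k assume uv: "u \<in> ig_vertices P" "v \<in> ig_vertices P" "index_pos ?vs u \<le> index_pos ?vs v"
    "k < length q" "v \<in> Q (q ! k)"
  define pre where "pre = fold snoc_new (concat (map (bag_list Q) (take (Suc k) q))) []"
  have "concat (map (bag_list Q) q)
      = concat (map (bag_list Q) (take (Suc k) q)) @ concat (map (bag_list Q) (drop (Suc k) q))"
    by (metis append_take_drop_id concat_append map_append)
  then have "?vs = fold snoc_new (concat (map (bag_list Q) (drop (Suc k) q))) pre"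
    by (simp add: vertex_order_def pre_def)
  then obtain zs where zs: "?vs = pre @ zs" using fold_snoc_new_append by metis
  have "set (take (Suc k) q) \<subseteq> VT" using q set_take_subset unfolding search_order_def by fastforce
  then have "set (bag_list Q t) = Q t" if "t \<in> set (take (Suc k) q)" for t
    using vo(5)[of t] that by (auto simp: bag_list_def)
  then have setpre: "set pre = (\<Union>t\<in>set (take (Suc k) q). Q t)" by (simp add: pre_def)
  have "q ! k \<in> set (take (Suc k) q)" using uv(4) by (auto simp: take_Suc_conv_app_nth)
  then have "v \<in> set pre" using uv(5) setpre by blast
  then obtain j where j: "j < length pre" "pre ! j = v" by (auto simp: in_set_conv_nth)
  then have "index_pos ?vs v = Suc j" using index_pos_nth[OF vo(1), of j] zs by (simp add: nth_append)
  moreover obtain i where i: "i < length ?vs" "u = ?vs ! i" "index_pos ?vs u = Suc i"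
    using index_pos_cases[OF vo(1), of u] uv(1) vo(2) by (auto simp: ig_vertices_def)
  ultimately have "i < length pre" using uv(3) j by simp
  then have "u \<in> set pre" using i(2) zs by (simp add: nth_append)
  then obtain t where "t \<in> set (take (Suc k) q)" "u \<in> Q t" using setpre by blast
  then show "\<exists>j\<le>k. u \<in> Q (q ! j)" by (auto simp: in_set_conv_nth less_Suc_eq_le)
qed

lemma card_bag_le_width:
  assumes "finite VT" "td_width VT Q \<le> \<omega>" "t \<in> VT"
  shows "card (Q t) \<le> Suc \<omega>"
proof -
  have "card (Q t) \<le> Max ((\<lambda>t. card (Q t)) ` VT)" using assms by (intro Max_ge) auto
  then show ?thesis using assms(2) by (simp add: td_width_def)
qed

text \<open>The set \<open>C v\<close> consists of \<open>v\<close> and the predecessors of \<open>v\<close> in the topmost bag containing \<open>v\<close>.\<close>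

lemma elimination_from_search:
  assumes P: "gb_problem P"
    and td: "tree_decomposition (ig_vertices P) (ig_edges P) VT ET Q" and wd: "td_width VT Q \<le> \<omega>"
    and q: "search_order VT ET q"
  shows "\<exists>C. elimination (gb_n P) (gb_m P) (Suc \<omega>) (gb_K P) (index_pos (vertex_order Q q))
      (\<lambda>c. vertex_order Q q ! (c - 1)) C"
proof -
  define n where "n = gb_n P"
  define vs where "vs = vertex_order Q q"
  define pos where "pos = index_pos vs"
  note vo = vertex_order_props[OF td q, folded n_def vs_def]
  note dvs = vo(1) and setvs = vo(2) and lvs = vo(3) and QV = vo(4) and finQ = vo(5) and cover = vo(6)
  have finVT: "finite VT" using td by (simp add: tree_decomposition_def is_tree_def)
  have "good_order VT Q pos" unfolding pos_def vs_def by (rule good_order_vertex_order[OF td q])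
  then have "\<forall>v. \<exists>T. v \<in> {1..n} \<longrightarrow> T \<in> VT \<and> (\<forall>t\<in>VT. \<forall>u\<in>Q t. v \<in> Q t \<longrightarrow> pos u \<le> pos v \<longrightarrow> u \<in> Q T)"
    using cover unfolding good_order_def by (metis UN_iff)
  then obtain T where T: "\<And>v. v \<in> {1..n} \<Longrightarrow> T v \<in> VT"
    "\<And>v t u. v \<in> {1..n} \<Longrightarrow> t \<in> VT \<Longrightarrow> u \<in> Q t \<Longrightarrow> v \<in> Q t \<Longrightarrow> pos u \<le> pos v \<Longrightarrow> u \<in> Q (T v)" by metis
  define C where "C v = {u \<in> Q (T v). pos u \<le> pos v}" for v
  have "elimination n (gb_m P) (Suc \<omega>) (gb_K P) pos (\<lambda>c. vs ! (c - 1)) C"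
  proof
    show "pos 0 = 0" using setvs by (simp add: pos_def index_pos_def)
    show "pos v \<in> {1..n} \<and> vs ! (pos v - 1) = v" if "v \<in> {1..n}" for v
      using index_pos_cases[OF dvs, of v] that setvs lvs unfolding pos_def by fastforce
    show "vs ! (c - 1) \<in> {1..n} \<and> pos (vs ! (c - 1)) = c" if "c \<in> {1..n}" for c
      using index_pos_nth[OF dvs, of "c - 1"] that lvs nth_mem[of "c - 1" vs] unfolding setvs pos_def by auto
    show "gb_K P i \<subseteq> {1..n}" if "i \<in> {1..gb_m P}" for i
      using P that by (simp add: gb_problem_def n_def)
    show "C v \<subseteq> {1..n}" if "v \<in> {1..n}" for v using QV[OF T(1)[OF that]] by (auto simp: C_def)
    show "card (C v) \<le> Suc \<omega>" if "v \<in> {1..n}" for v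
    proof -
      have "card (C v) \<le> card (Q (T v))" by (rule card_mono[OF finQ[OF T(1)[OF that]]]) (auto simp: C_def)
      also have "\<dots> \<le> Suc \<omega>" by (rule card_bag_le_width[OF finVT wd T(1)[OF that]])
      finally show ?thesis .
    qed
    show "v \<in> C v" if v: "v \<in> {1..n}" for v
      using cover[OF v] T(2)[OF v _ _ _ order_refl] by (auto simp: C_def)
    show "pos u \<le> pos v" if "u \<in> C v" for u v using that by (simp add: C_def)
    show "a \<in> C b" if "v \<in> {1..n}" "a \<in> C v" "b \<in> C v" "pos a \<le> pos b" for v a b
    proof -
      have "b \<in> {1..n}" using that QV[OF T(1)[OF that(1)]] by (auto simp: C_def)
      then show ?thesis using T(2)[of b "T v" a] that T(1)[OF that(1)] by (auto simp: C_def)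
    qed
    show "a \<in> C b" if i: "i \<in> {1..gb_m P}" and ab: "a \<in> gb_K P i" "b \<in> gb_K P i" and p: "pos a \<le> pos b" for i a b
    proof -
      have "gb_K P i \<subseteq> {1..n}" using P i by (simp add: gb_problem_def n_def)
      then have n: "a \<in> {1..n}" "b \<in> {1..n}" using ab by blast+
      have "\<exists>t\<in>VT. a \<in> Q t \<and> b \<in> Q t"
      proof (cases "a = b")
        case False
        then have "{a, b} \<in> ig_edges P" using i ab unfolding ig_edges_def by blast
        then obtain t where "t \<in> VT" "{a, b} \<subseteq> Q t" using td unfolding tree_decomposition_def by blast
        then show ?thesis by blast
      qed (use cover n in blast)
      then show ?thesis using T(2)[OF n(2)] p by (auto simp: C_def)
    qed
  qed
  then show "\<exists>C. elimination (gb_n P) (gb_m P) (Suc \<omega>) (gb_K P) (index_pos (vertex_order Q q))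
      (\<lambda>c. vertex_order Q q ! (c - 1)) C"
    unfolding n_def pos_def vs_def by blast
qed

definition gb_acc :: "gb \<Rightarrow> nat \<Rightarrow> nat set \<Rightarrow> bool" where
  "gb_acc P i Y \<longleftrightarrow> restrict (\<lambda>j. of_bool (j \<in> Y)) (gb_K P i) \<in> gb_S P i"

lemma gb_acc_local: "gb_acc P i (Y \<inter> gb_K P i) = gb_acc P i Y"
proof -
  have "restrict (\<lambda>j. of_bool (j \<in> Y \<inter> gb_K P i)) (gb_K P i) = (restrict (\<lambda>j. of_bool (j \<in> Y)) (gb_K P i) :: nat \<Rightarrow> real)"
    by (rule restrict_ext) simp
  then show ?thesis by (simp only: gb_acc_def)
qed

lemma gb_oracle_acc:
  assumes "i \<in> {1..gb_m P}" "\<And>v. v \<in> gb_K P i \<Longrightarrow> y (int v) = of_bool (v \<in> Y)"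
  shows "gb_oracle P (int i) y \<longleftrightarrow> gb_acc P i Y"
proof -
  have "restrict (\<lambda>j. real_of_int (y (int j))) (gb_K P i) = restrict (\<lambda>j. of_bool (j \<in> Y)) (gb_K P i)"
    by (rule restrict_ext) (use assms(2) in simp)
  then show ?thesis using assms(1) by (auto simp: gb_oracle_def gb_acc_def)
qed

lemma gb_feasible_points:
  assumes "gb_problem P"
  shows "gb_feasible P = point (gb_n P) ` {X. X \<subseteq> {1..gb_n P} \<and> (\<forall>i\<in>{1..gb_m P}. gb_acc P i X)}"
proof -
  have K: "gb_K P i \<subseteq> {1..gb_n P}" if "i \<in> {1..gb_m P}" for i using assms that by (simp add: gb_problem_def)
  have r: "restrict (point (gb_n P) X) (gb_K P i) \<in> gb_S P i \<longleftrightarrow> gb_acc P i X" if "i \<in> {1..gb_m P}" for i X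
  proof -
    have "restrict (point (gb_n P) X) (gb_K P i) = restrict (\<lambda>j. of_bool (j \<in> X)) (gb_K P i)"
      by (rule restrict_ext) (use K[OF that] in \<open>auto simp: point_def\<close>)
    then show ?thesis by (simp add: gb_acc_def)
  qed
  show ?thesis
  proof (intro equalityI subsetI)
    fix x assume x: "x \<in> gb_feasible P"
    define X where "X = {j \<in> {1..gb_n P}. x j = 1}"
    have xX: "x = point (gb_n P) X"
    proof
      fix j
      show "x j = point (gb_n P) X j"
        using x by (cases "j \<in> {1..gb_n P}") (auto simp: gb_feasible_def X_def point_def PiE_iff extensional_def)
    qed
    have "gb_acc P i X" if "i \<in> {1..gb_m P}" for i
      using x r[OF that, of X] that unfolding xX[symmetric] by (simp add: gb_feasible_def)
    moreover have "X \<subseteq> {1..gb_n P}" by (auto simp: X_def)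
    ultimately show "x \<in> point (gb_n P) ` {X. X \<subseteq> {1..gb_n P} \<and> (\<forall>i\<in>{1..gb_m P}. gb_acc P i X)}"
      using xX by blast
  next
    fix x assume "x \<in> point (gb_n P) ` {X. X \<subseteq> {1..gb_n P} \<and> (\<forall>i\<in>{1..gb_m P}. gb_acc P i X)}"
    then obtain X where X: "x = point (gb_n P) X" "\<forall>i\<in>{1..gb_m P}. gb_acc P i X" by blast
    then show "x \<in> gb_feasible P" using r by (auto simp: gb_feasible_def point_def)
  qed
qed

text \<open>The width \<open>\<omega>\<close> stands for bags with up to \<open>\<omega> + 1\<close> vertices, hence \<open>2\<^bsup>\<omega>+1\<^esup>\<close> variables per vertex.\<close>

lemma the_lp_formulation:
  assumes P: "gb_problem P" and el: "elimination (gb_n P) (gb_m P) (Suc \<omega>) (gb_K P) pos ord C"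
  defines "L \<equiv> elimination_lp.the_lp (gb_n P) (gb_m P) (gb_K P) pos ord (gb_acc P) (gb_c P)"
  shows "elimination_lp (gb_n P) (gb_m P) (Suc \<omega>) (gb_K P) pos ord C (gb_acc P)"
    "exact_formulation P L" "lp_size_le L (6 * 2 ^ \<omega> * real (gb_n P))" "unit_coefficients L"
proof -
  interpret elimination "gb_n P" "gb_m P" "Suc \<omega>" "gb_K P" pos ord C by (rule el)
  show elp: "elimination_lp (gb_n P) (gb_m P) (Suc \<omega>) (gb_K P) pos ord C (gb_acc P)"
    by unfold_locales (rule gb_acc_local)
  interpret E: elimination_lp "gb_n P" "gb_m P" "Suc \<omega>" "gb_K P" pos ord C "gb_acc P" by (rule elp)
  have n1: "1 \<le> gb_n P" using P by (simp add: gb_problem_def)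
  have "(\<lambda>z. restrict z {1..gb_n P}) ` lp_feasible L = convex hull (gb_feasible P)"
    unfolding L_def E.projection gb_feasible_points[OF P] E.solutions_def ..
  then show "exact_formulation P L"
    by (simp add: exact_formulation_def L_def E.the_lp_def E.nv_def)
  show "unit_coefficients L" unfolding L_def by (rule E.unit_coefficients_the_lp)
  have "real E.nv \<le> real (6 * 2 ^ \<omega> * gb_n P)" "real (length E.rows) \<le> real (6 * 2 ^ \<omega> * gb_n P)"
    using E.size_the_lp[OF n1 refl] by (simp_all only: of_nat_le_iff)
  then show "lp_size_le L (6 * 2 ^ \<omega> * real (gb_n P))"
    by (simp add: lp_size_le_def L_def E.the_lp_def)
qed

section \<open>The input in memory\<close>

text \<open>The address of list \<open>i\<close>, counted from \<open>1\<close>, if the lists \<open>yss\<close> are stored consecutively from address \<open>a\<close> on.\<close>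

definition block_start :: "int list list \<Rightarrow> nat \<Rightarrow> nat \<Rightarrow> nat" where
  "block_start yss a i = a + length (concat (take (i - 1) yss))"

lemma block_nth:
  assumes "k < length yss" "j < length (yss ! k)"
  shows "(pre @ concat yss @ post) ! (length pre + length (concat (take k yss)) + j) = yss ! k ! j"
proof -
  have "concat yss = concat (take k yss) @ yss ! k @ concat (drop (Suc k) yss)"
    by (metis assms(1) id_take_nth_drop concat.simps(2) concat_append)
  then show ?thesis using assms(2) by (simp add: nth_append)
qed

lemma block_length:
  assumes "k < length yss"
  shows "length (concat (take k yss)) + length (yss ! k) \<le> length (concat yss)"
proof -
  have "concat yss = concat (take k yss) @ yss ! k @ concat (drop (Suc k) yss)"
    by (metis assms(1) id_take_nth_drop concat.simps(2) concat_append)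
  then show ?thesis by simp
qed

lemma input_block:
  fixes A :: "nat \<Rightarrow> nat set" and b :: nat
  defines "yss \<equiv> map (\<lambda>i. encode_set (A i)) [1..<b + 1]"
  assumes xs: "xs = pre @ concat yss @ post" and fin: "\<And>i. i \<in> {1..b} \<Longrightarrow> finite (A i)"
    and i: "i \<in> {1..b}"
  defines "I \<equiv> arrs (initial_state xs) ''input''"
  shows "I (int (block_start yss (length pre) i)) = int (card (A i))"
    and "j < card (A i) \<Longrightarrow> I (int (block_start yss (length pre) i + 1 + j)) = int (sorted_list_of_set (A i) ! j)"
    and "block_start yss (length pre) (Suc i) = block_start yss (length pre) i + card (A i) + 1"
proof -
  have k: "i - 1 < length yss" "yss ! (i - 1) = encode_set (A i)" "Suc (i - 1) = i" "length yss = b"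
    using i unfolding yss_def by (auto simp del: upt_Suc)
  have len: "length (encode_set (A i)) = Suc (card (A i))" using fin[OF i] by (simp add: encode_set_def)
  have nth: "I (int (block_start yss (length pre) i + j)) = encode_set (A i) ! j" if "j < Suc (card (A i))" for j
  proof -
    have "block_start yss (length pre) i + j < length xs"
      using block_length[OF k(1)] that len k(2) by (simp add: block_start_def xs)
    moreover have "xs ! (block_start yss (length pre) i + j) = encode_set (A i) ! j"
      using block_nth[OF k(1), of j pre post] that len k(2) by (simp add: block_start_def xs add.assoc)
    ultimately show ?thesis by (simp add: I_def initial_state_def nat_int_add)
  qed
  show "I (int (block_start yss (length pre) i)) = int (card (A i))"
    using nth[of 0] by (simp add: encode_set_def)
  show "I (int (block_start yss (length pre) i + 1 + j)) = int (sorted_list_of_set (A i) ! j)" if "j < card (A i)"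
    using nth[of "Suc j"] that fin[OF i] by (simp add: encode_set_def)
  show "block_start yss (length pre) (Suc i) = block_start yss (length pre) i + card (A i) + 1"
    using k len by (simp add: block_start_def take_Suc_conv_app_nth[OF k(1), unfolded k(3)])
qed

lemma input_pairs:
  assumes xs: "xs = pre @ int (length es) # concat (map (\<lambda>(s, t). [int s, int t]) es)"
  defines "I \<equiv> arrs (initial_state xs) ''input''"
  shows "I (int (length pre)) = int (length es)"
    and "i < length es \<Longrightarrow> I (int (length pre + 1 + 2 * i)) = int (fst (es ! i)) \<and>
        I (int (length pre + 2 + 2 * i)) = int (snd (es ! i))"
proof -
  let ?yss = "map (\<lambda>(s, t). [int s, int t]) es"
  have lc: "length (concat (map (\<lambda>(s, t). [int s, int t]) es)) = 2 * length es" for es :: "(nat \<times> nat) list"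
    by (induction es) auto
  have len: "length xs = length pre + 1 + 2 * length es" unfolding xs using lc[of es] by simp
  have I: "I (int k) = xs ! k" if "k < length xs" for k
    using that by (simp add: I_def initial_state_def)
  have "xs ! length pre = int (length es)" by (simp add: xs)
  then show "I (int (length pre)) = int (length es)" using I[of "length pre"] len by simp
  assume i: "i < length es"
  have nth: "xs ! (length pre + 1 + 2 * i + j) = (case es ! i of (s, t) \<Rightarrow> [int s, int t]) ! j" if "j < 2" for j
  proof -
    have "j < length (?yss ! i)" using i that by (cases "es ! i") simp
    moreover have "length (concat (take i ?yss)) = 2 * i" using lc[of "take i es"] i by (simp add: take_map)
    ultimately show ?thesis using block_nth[of i ?yss j "pre @ [int (length es)]" "[]"] i by (simp add: xs)
  qed
  show "I (int (length pre + 1 + 2 * i)) = int (fst (es ! i)) \<and>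
        I (int (length pre + 2 + 2 * i)) = int (snd (es ! i))"
    using nth[of 0] nth[of 1] I[of "length pre + 1 + 2 * i"] I[of "length pre + 2 + 2 * i"] len i
    by (auto simp: case_prod_beta)
qed

text \<open>The search order, and with it the linear program, depends on the order in which the edges are listed in the input;
  it becomes known after the search has run.\<close>

lemma construct_wp:
  assumes P: "gb_problem P"
    and td: "tree_decomposition (ig_vertices P) (ig_edges P) {1..N} ET Q" and wd: "td_width {1..N} Q \<le> \<omega>"
    and inp: "input_encoding P N ET Q xs"
  shows "wp (gb_oracle P) construct (\<lambda>s t q. q \<le> gb_m P * 2 ^ Suc \<omega> \<and>
      t \<le> (2 ^ Suc \<omega> * gb_m P + gb_n P + N + 1) * (194 * Suc \<omega> + 800) \<and>
      (\<exists>L. exact_formulation P L \<and> lp_size_le L (6 * 2 ^ \<omega> * real (gb_n P)) \<and> unit_coefficients L \<and>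
        lp_encoding L (outp s))) (initial_state xs) 0 0"
proof -
  define n m where "n = gb_n P" and "m = gb_m P"
  define Ks where "Ks = map (\<lambda>i. encode_set (gb_K P i)) [1..<m + 1]"
  define Qs where "Qs = map (\<lambda>t. encode_set (Q t)) [1..<N + 1]"
  define s0 where "s0 = initial_state xs"
  obtain es :: "(nat \<times> nat) list" where es: "distinct (map (\<lambda>(s, t). {s, t}) es)" "set (map (\<lambda>(s, t). {s, t}) es) = ET"
    and xs: "xs = [int n, int m, int N] @ concat Ks @ concat Qs @ int (length es) # concat (map (\<lambda>(s, t). [int s, int t]) es)"
    using inp unfolding input_encoding_def Ks_def Qs_def n_def m_def by blast
  have tree: "is_tree {1..N} ET" using td by (simp add: tree_decomposition_def)
  have K: "gb_K P i \<subseteq> {1..n}" "finite (gb_K P i)" if "i \<in> {1..m}" for i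
  proof -
    show "gb_K P i \<subseteq> {1..n}" using P that by (simp add: gb_problem_def n_def m_def)
    then show "finite (gb_K P i)" using finite_subset by blast
  qed
  have Qf: "finite (Q t)" if "t \<in> {1..N}" for t
    using td that finite_subset[of "Q t" "{1..n}"] by (simp add: tree_decomposition_def ig_vertices_def n_def)
  define koff where "koff = block_start Ks (length [int n, int m, int N])"
  define toff where "toff = block_start Qs (length ([int n, int m, int N] @ concat Ks))"
  have xsK: "xs = [int n, int m, int N] @ concat (map (\<lambda>i. encode_set (gb_K P i)) [1..<m + 1]) @
      (concat Qs @ int (length es) # concat (map (\<lambda>(s, t). [int s, int t]) es))"
    unfolding xs Ks_def ..
  have xsQ: "xs = ([int n, int m, int N] @ concat Ks) @ concat (map (\<lambda>i. encode_set (Q i)) [1..<N + 1]) @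
      (int (length es) # concat (map (\<lambda>(s, t). [int s, int t]) es))"
    unfolding xs Qs_def by simp
  have xsE: "xs = ([int n, int m, int N] @ concat Ks @ concat Qs) @
      int (length es) # concat (map (\<lambda>(s, t). [int s, int t]) es)"
    unfolding xs by simp
  let ?I = "arrs s0 ''input''"
  have IK: "?I (int (koff i)) = int (card (gb_K P i))"
    "\<And>j. j < card (gb_K P i) \<Longrightarrow> ?I (int (koff i + 1 + j)) = int (sorted_list_of_set (gb_K P i) ! j)"
    "koff (Suc i) = koff i + card (gb_K P i) + 1" if "i \<in> {1..m}" for i
    unfolding koff_def Ks_def s0_def
    by (rule input_block(1)[OF xsK K(2) that], assumption,
        erule input_block(2)[OF xsK K(2) that, rotated], assumption,
        rule input_block(3)[OF xsK K(2) that], assumption)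
  have IQ: "?I (int (toff i)) = int (card (Q i))"
    "\<And>j. j < card (Q i) \<Longrightarrow> ?I (int (toff i + 1 + j)) = int (sorted_list_of_set (Q i) ! j)"
    "toff (Suc i) = toff i + card (Q i) + 1" if "i \<in> {1..N}" for i
    unfolding toff_def Qs_def s0_def
    by (rule input_block(1)[OF xsQ Qf that], assumption,
        erule input_block(2)[OF xsQ Qf that, rotated], assumption,
        rule input_block(3)[OF xsQ Qf that], assumption)
  define a0 where "a0 = toff (Suc N)"
  have lKs: "length Ks = m" and lQs: "length Qs = N" by (simp_all add: Ks_def Qs_def del: upt_Suc)
  have koff_end: "koff (Suc m) = toff 1" by (simp add: koff_def toff_def block_start_def lKs)
  have a0: "a0 = length ([int n, int m, int N] @ concat Ks @ concat Qs)"
    by (simp add: a0_def toff_def block_start_def lQs)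
  have IE: "?I (int a0) = int (length es)"
    "\<And>i. i < length es \<Longrightarrow> ?I (int (a0 + 1 + 2 * i)) = int (fst (es ! i)) \<and> ?I (int (a0 + 2 + 2 * i)) = int (snd (es ! i))"
    using input_pairs[OF xsE] unfolding s0_def a0 by blast+
  have I0: "?I 0 = int n" "?I 1 = int m" "?I 2 = int N"
    by (simp_all add: s0_def initial_state_def xs)
  have zero: "arrs s0 a k = 0" if "a \<noteq> ''input''" for a k using that by (simp add: s0_def initial_state_def)
  have out0: "outp s0 = []" by (simp add: s0_def initial_state_def)
  let ?R = "\<lambda>s t q. q \<le> m * 2 ^ Suc \<omega> \<and> t \<le> (2 ^ Suc \<omega> * m + n + N + 1) * (194 * Suc \<omega> + 800) \<and>
      (\<exists>L. exact_formulation P L \<and> lp_size_le L (6 * 2 ^ \<omega> * real n) \<and> unit_coefficients L \<and> lp_encoding L (outp s))"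
  let ?p = "absorb_constraints ;; absorb_separators ;; lay_out ;; query_constraints ;; emit_bounds ;; emit_vertices"
  have sizes: "wp (gb_oracle P) read_sizes (\<lambda>s t q. q = 0 \<and> t = 4 \<and> regs s ''n'' = int n \<and> regs s ''m'' = int m \<and>
      regs s ''N'' = int N \<and> regs s ''a'' = int (koff 1) \<and> arrs s = arrs s0) s0 0 0"
    by (simp add: read_sizes_def I0 koff_def block_start_def)
  have "wp (gb_oracle P) construct ?R s0 0 0"
    unfolding construct_def
  proof (rule wp_cut[OF sizes])
    fix s1 :: state and t1 q1 :: nat assume a1: "agree read_sizes s0 s1" and P1: "q1 = 0 \<and> t1 = 4 \<and> regs s1 ''n'' = int n \<and> regs s1 ''m'' = int m \<and>
      regs s1 ''N'' = int N \<and> regs s1 ''a'' = int (koff 1) \<and> arrs s1 = arrs s0"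
    have o1: "outp s1 = []" using a1 out0 by (simp add: agree_def phase_defs)
    show "wp (gb_oracle P) (locate ''koff'' ''m'' ;; locate ''toff'' ''N'' ;; read_edges ;; search_tree ;; number_vertices ;;
      initial_bags ;; powers_of_two ;; ?p) ?R s1 t1 q1"
    proof (rule wp_cut[OF locate_wp[where off = koff and b = m and cd = "\<lambda>i. card (gb_K P i)"]])
      fix s2 :: state and t2 q2 :: nat assume a2: "agree (locate ''koff'' ''m'') s1 s2" and P2: "q2 = q1 \<and> t2 = t1 + 4 * m + 2 \<and>
        (\<forall>i\<in>{1..m}. arrs s2 ''koff'' (int i) = int (koff i)) \<and> regs s2 ''a'' = int (koff (Suc m))"
      have r2: "regs s2 ''n'' = int n" "regs s2 ''m'' = int m" "regs s2 ''N'' = int N" "outp s2 = []"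
        and ar2: "\<And>a. a \<noteq> ''koff'' \<Longrightarrow> arrs s2 a = arrs s0 a"
        using a2 P1 o1 by (simp_all add: agree_def phase_defs)
      show "wp (gb_oracle P) (locate ''toff'' ''N'' ;; read_edges ;; search_tree ;; number_vertices ;;
        initial_bags ;; powers_of_two ;; ?p) ?R s2 t2 q2"
      proof (rule wp_cut[OF locate_wp[where off = toff and b = N and cd = "\<lambda>i. card (Q i)"]])
        fix s3 :: state and t3 q3 :: nat assume a3: "agree (locate ''toff'' ''N'') s2 s3" and P3: "q3 = q2 \<and> t3 = t2 + 4 * N + 2 \<and>
          (\<forall>i\<in>{1..N}. arrs s3 ''toff'' (int i) = int (toff i)) \<and> regs s3 ''a'' = int (toff (Suc N))"
        have r3: "regs s3 ''n'' = int n" "regs s3 ''m'' = int m" "regs s3 ''N'' = int N" "outp s3 = []"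
          and ar3: "\<And>a. a \<notin> {''koff'', ''toff''} \<Longrightarrow> arrs s3 a = arrs s0 a" "arrs s3 ''koff'' = arrs s2 ''koff''"
          using a3 r2 ar2 by (simp_all add: agree_def phase_defs)
        show "wp (gb_oracle P) (read_edges ;; search_tree ;; number_vertices ;;
          initial_bags ;; powers_of_two ;; ?p) ?R s3 t3 q3"
        proof (rule wp_cut[OF read_edges_wp[where a = a0 and es = es]])
          fix s4 :: state and t4 q4 :: nat assume a4: "agree read_edges s3 s4"
            and P4: "adjacency es (2 * length es) s4 \<and> t4 = t3 + 13 * length es + 4 \<and> q4 = q3"
          have r4: "regs s4 ''n'' = int n" "regs s4 ''m'' = int m" "regs s4 ''N'' = int N" "outp s4 = []"
            and ar4: "\<And>a. a \<notin> {''koff'', ''toff'', ''head'', ''nxt'', ''dst''} \<Longrightarrow> arrs s4 a = arrs s0 a"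
              "arrs s4 ''koff'' = arrs s2 ''koff''" "arrs s4 ''toff'' = arrs s3 ''toff''"
            using a4 r3 ar3 by (simp_all add: agree_def phase_defs)
          show "wp (gb_oracle P) (search_tree ;; number_vertices ;; initial_bags ;; powers_of_two ;; ?p) ?R s4 t4 q4"
          proof (rule wp_cut[OF search_tree_wp[where es = es and N = N and ET = ET]])
            fix s5 :: state and t5 q5 :: nat assume a5: "agree search_tree s4 s5" and P5: "q5 = q4 \<and> t5 \<le> t4 + 6 * N + 14 * length es + 5 \<and>
              (\<exists>q. search_order {1..N} ET q \<and> (\<forall>i<N. arrs s5 ''qu'' (int (Suc i)) = int (q ! i)))"
            have r5: "regs s5 ''n'' = int n" "regs s5 ''m'' = int m" "regs s5 ''N'' = int N" "outp s5 = []"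
              and ar5: "\<And>a. a \<notin> {''koff'', ''toff'', ''head'', ''nxt'', ''dst'', ''vis'', ''qu''} \<Longrightarrow> arrs s5 a = arrs s0 a"
                "arrs s5 ''koff'' = arrs s2 ''koff''" "arrs s5 ''toff'' = arrs s3 ''toff''"
              using a5 r4 ar4 by (simp_all add: agree_def phase_defs)
            obtain q where q: "search_order {1..N} ET q" "\<forall>i<N. arrs s5 ''qu'' (int (Suc i)) = int (q ! i)"
              using P5 by blast
            have setq: "set q = {1..N}" "length q = N"
              using q(1) distinct_card[of q] by (simp_all add: search_order_def)
            note vo = vertex_order_props[OF td q(1)]
            have cQ: "card (Q t) \<le> Suc \<omega>" if "t \<in> {1..N}" for t
              using card_bag_le_width[OF _ wd that] by simp
            define vs where "vs = vertex_order Q q"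
            have lb: "length (bag_list Q t) = card (Q t)" for t by (simp add: bag_list_def)
            have esN: "length es \<le> N"
            proof -
              have "length es = card ET" using es distinct_card[of "map (\<lambda>(s, t). {s, t}) es"] by simp
              then show ?thesis using card_tree_edges[OF tree q(1)] setq(2) by simp
            qed
            show "wp (gb_oracle P) (number_vertices ;; initial_bags ;; powers_of_two ;; ?p) ?R s5 t5 q5"
            proof (rule wp_cut[OF number_vertices_wp[where N = N and q = q and toff = toff and bl = "bag_list Q" and w = "Suc \<omega>"]])
              fix s6 :: state and t6 q6 :: nat assume a6: "agree number_vertices s5 s6" and P6: "q6 = q5 \<and> t6 \<le> t5 + N * (7 * Suc \<omega> + 5) + 3 \<and>
                numbered (fold snoc_new (concat (map (bag_list Q) q)) []) s6"
              have r6: "regs s6 ''n'' = int n" "regs s6 ''m'' = int m" "outp s6 = []"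
                and ar6: "\<And>a. a \<notin> {''koff'', ''toff'', ''head'', ''nxt'', ''dst'', ''vis'', ''qu'', ''pos'', ''ord''} \<Longrightarrow> arrs s6 a = arrs s0 a"
                "arrs s6 ''koff'' = arrs s2 ''koff''"
                using a6 r5 ar5 by (simp_all add: agree_def phase_defs)
              have num: "numbered vs s6" using P6 by (simp add: vs_def vertex_order_def)
              show "wp (gb_oracle P) (initial_bags ;; powers_of_two ;; ?p) ?R s6 t6 q6"
              proof (rule wp_cut[OF initial_bags_wp[where n = n]])
                fix s7 :: state and t7 q7 :: nat assume a7: "agree initial_bags s6 s7" and P7: "q7 = q6 \<and> t7 \<le> t6 + 6 * n + 3 \<and>
                  blocks n (\<lambda>v. if v = 0 then [] else [v]) s7"
                have r7: "regs s7 ''n'' = int n" "regs s7 ''m'' = int m" "outp s7 = []"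
                  and ar7: "\<And>a. a \<notin> {''koff'', ''toff'', ''head'', ''nxt'', ''dst'', ''vis'', ''qu'', ''pos'', ''ord'',
                    ''off'', ''len'', ''bag''} \<Longrightarrow> arrs s7 a = arrs s0 a"
                    "arrs s7 ''koff'' = arrs s2 ''koff''" "arrs s7 ''pos'' = arrs s6 ''pos''" "arrs s7 ''ord'' = arrs s6 ''ord''"
                  using a7 r6 ar6 by (simp_all add: agree_def phase_defs)
                show "wp (gb_oracle P) (powers_of_two ;; ?p) ?R s7 t7 q7"
                proof (rule wp_cut[OF powers_of_two_wp[where n = n]])
                  fix s8 :: state and t8 q8 :: nat assume a8: "agree powers_of_two s7 s8" and P8: "q8 = q7 \<and> t8 \<le> t7 + 3 * n + 3 \<and>
                    (\<forall>i\<le>n. arrs s8 ''pw'' (int i) = 2 ^ i)"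
                  have r8: "regs s8 ''n'' = int n" "regs s8 ''m'' = int m" "outp s8 = []"
                    and ar8: "\<And>a. a \<notin> {''koff'', ''toff'', ''head'', ''nxt'', ''dst'', ''vis'', ''qu'', ''pos'', ''ord'',
                      ''off'', ''len'', ''bag'', ''pw''} \<Longrightarrow> arrs s8 a = arrs s0 a"
                      "arrs s8 ''koff'' = arrs s2 ''koff''" "arrs s8 ''pos'' = arrs s6 ''pos''" "arrs s8 ''ord'' = arrs s6 ''ord''"
                      "arrs s8 ''off'' = arrs s7 ''off''" "arrs s8 ''len'' = arrs s7 ''len''" "arrs s8 ''bag'' = arrs s7 ''bag''"
                    using a8 r7 ar7 by (simp_all add: agree_def phase_defs)
                  define pos where "pos = index_pos vs"
                  define ord where "ord = (\<lambda>c. vs ! (c - 1))"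
                  obtain C where C: "elimination n m (Suc \<omega>) (gb_K P) pos ord C"
                    using elimination_from_search[OF P td wd q(1)] unfolding n_def m_def pos_def ord_def vs_def by blast
                  note lpf = the_lp_formulation[OF P C[unfolded n_def m_def]]
                  interpret E: elimination_lp n m "Suc \<omega>" "gb_K P" pos ord C "gb_acc P"
                    using lpf(1) unfolding n_def m_def .
                  have vs: "distinct vs" "set vs = {1..n}" "length vs = n" using vo(1-3) by (simp_all add: vs_def n_def)
                  have pos_arr: "arrs s8 ''pos'' (int v) = int (pos v)" for v
                  proof (cases "v \<in> set vs")
                    case True
                    then obtain i where "i < length vs" "v = vs ! i" "pos v = Suc i"
                      using index_pos_cases[OF vs(1)] by (metis pos_def)
                    then show ?thesis using num by (simp add: ar8 numbered_def)
                  next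
                    case False
                    then show ?thesis using num by (simp add: ar8 numbered_def pos_def index_pos_def)
                  qed
                  have ord_arr: "arrs s8 ''ord'' (int c) = int (ord c)" if "c \<in> {1..n}" for c
                    using num that vs(3) unfolding numbered_def ar8 ord_def
                    by (auto dest!: spec[of _ "c - 1"] simp: Suc_le_eq of_nat_diff)
                  have "blocks n (E.BK 0) s8" using P7 unfolding E.BK.simps by (simp add: blocks_def ar8)
                  then have "wp (gb_oracle P) ?p (\<lambda>s' t' k'. k' \<le> q8 + m * 2 ^ Suc \<omega> \<and>
                       t' \<le> t8 + (2 ^ Suc \<omega> * m + n + 1) * (187 * Suc \<omega> + 730) \<and>
                       lp_encoding (E.the_lp (gb_c P)) (outp s')) s8 t8 q8"
                  proof (rule E.build_wp[where koff = koff, rotated 7])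
                    fix i :: nat and y :: "int \<Rightarrow> int" and Y assume "i \<in> {1..m}" "\<And>v. v \<in> gb_K P i \<Longrightarrow> y (int v) = of_bool (v \<in> Y)"
                    then show "gb_oracle P (int i) y = gb_acc P i Y" by (intro gb_oracle_acc) (auto simp: m_def)
                  qed (use r8 P2 P8 IK pos_arr ord_arr zero in \<open>simp_all add: ar8\<close>)
                  then show "wp (gb_oracle P) ?p ?R s8 t8 q8"
                  proof (rule wp_conseq)
                    fix s9 :: state and t9 q9 :: nat assume P9: "q9 \<le> q8 + m * 2 ^ Suc \<omega> \<and>
                       t9 \<le> t8 + (2 ^ Suc \<omega> * m + n + 1) * (187 * Suc \<omega> + 730) \<and>
                       lp_encoding (E.the_lp (gb_c P)) (outp s9)"
                    define x where "x = 2 ^ Suc \<omega> * m"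
                    define w where "w = Suc \<omega>"
                    have mx: "m \<le> x" by (simp add: x_def)
                    have "t8 \<le> 4 + (4 * m + 2) + (4 * N + 2) + (13 * N + 4) + (6 * N + 14 * N + 5) + (N * (7 * w + 5) + 3)
                       + (6 * n + 3) + (3 * n + 3)"
                      using P1 P2 P3 P4 P5 P6 P7 P8 esN unfolding w_def by linarith
                    moreover have "t9 \<le> t8 + (x + n + 1) * (187 * w + 730)" using P9 by (simp add: x_def w_def)
                    moreover have "4 + (4 * m + 2) + (4 * N + 2) + (13 * N + 4) + (6 * N + 14 * N + 5) + (N * (7 * w + 5) + 3)
                       + (6 * n + 3) + (3 * n + 3) + (x + n + 1) * (187 * w + 730) \<le> (x + n + N + 1) * (194 * w + 800)"
                      using mx by (simp add: algebra_simps)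
                    ultimately have "t9 \<le> (x + n + N + 1) * (194 * w + 800)" by linarith
                    moreover have "q9 \<le> m * 2 ^ Suc \<omega>" using P1 P2 P3 P4 P5 P6 P7 P8 P9 by linarith
                    ultimately show "?R s9 t9 q9"
                      using P9 lpf(2-4) unfolding x_def w_def n_def m_def by blast
                  qed
                qed (use r7 in simp_all)
              qed (use r6 zero in \<open>simp_all add: ar6\<close>)
            qed (use r5 q setq P3 IQ zero cQ in \<open>simp_all add: ar5 lb, simp_all add: bag_list_def\<close>)
          qed (use P4 tree es zero in \<open>simp_all add: ar4\<close>)
        qed (use P3 IE zero in \<open>simp_all add: ar3 a0_def\<close>)
      qed (use r2 P2 IQ koff_end in \<open>simp_all add: ar2\<close>)
    qed (use P1 IK in simp_all)
  qed
  then show ?thesis by (simp only: n_def m_def s0_def)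
qed

section \<open>Existence and workload\<close>

text \<open>The minimum defining the tree-width is attained, because there is at least this decomposition.\<close>

lemma one_bag_decomposition:
  assumes "gb_problem P"
  shows "tree_decomposition (ig_vertices P) (ig_edges P) {0} {} (\<lambda>_. ig_vertices P)"
proof -
  have "e \<subseteq> ig_vertices P" if "e \<in> ig_edges P" for e
  proof -
    from that obtain i j k where "i \<in> {1..gb_m P}" "e = {j, k}" "{j, k} \<subseteq> gb_K P i" unfolding ig_edges_def by blast
    then show ?thesis using assms unfolding gb_problem_def ig_vertices_def by blast
  qed
  moreover have "\<not> has_cycle {}" by (force simp: has_cycle_def)
  ultimately show ?thesis
    by (auto simp: tree_decomposition_def is_tree_def induces_connected_def)
qed

lemma formulation_exists:
  assumes P: "gb_problem P" and tw: "treewidth (ig_vertices P) (ig_edges P) \<le> \<omega>"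
  shows "\<exists>L. exact_formulation P L \<and> lp_size_le L (6 * 2 ^ \<omega> * real (gb_n P)) \<and> unit_coefficients L"
proof -
  have "\<exists>w VT ET Q. tree_decomposition (ig_vertices P) (ig_edges P) VT ET Q \<and> td_width VT Q = w"
    using one_bag_decomposition[OF P] by blast
  then have "\<exists>VT ET Q. tree_decomposition (ig_vertices P) (ig_edges P) VT ET Q \<and>
      td_width VT Q = treewidth (ig_vertices P) (ig_edges P)"
    unfolding treewidth_def by (rule LeastI_ex)
  then obtain VT ET Q where td: "tree_decomposition (ig_vertices P) (ig_edges P) VT ET Q"
    and wd: "td_width VT Q \<le> \<omega>" using tw by auto
  have "finite VT" "induces_connected ET VT" using td by (auto simp: tree_decomposition_def is_tree_def)
  then obtain q where q: "search_order VT ET q" using search_order_exists by blast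
  obtain C where "elimination (gb_n P) (gb_m P) (Suc \<omega>) (gb_K P) (index_pos (vertex_order Q q))
      (\<lambda>c. vertex_order Q q ! (c - 1)) C"
    using elimination_from_search[OF P td wd q] by blast
  from the_lp_formulation(2-4)[OF P this] show ?thesis by blast
qed

text \<open>A nonempty \<open>K i\<close> is a clique, so it is contained in the topmost bag of its last vertex. Hence the sum in
  the workload counts every constraint at least once.\<close>

lemma workload1_ge:
  assumes P: "gb_problem P" and td: "tree_decomposition (ig_vertices P) (ig_edges P) {1..N} ET Q"
    and wd: "td_width {1..N} Q \<le> \<omega>"
  shows "real (max 1 \<omega>) * (2 ^ \<omega> * real (gb_m P) + real (max (gb_n P) N)) \<le> workload1 P {1..N} Q \<omega>"
proof -
  define x where "x = real (max 1 \<omega>)"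
  define X where "X = real (max (gb_n P) N)"
  define S where "S = (\<Sum>t\<in>{1..N}. card {i \<in> {1..gb_m P}. gb_K P i \<subseteq> Q t})"
  have "induces_connected ET {1..N}" using td by (auto simp: tree_decomposition_def is_tree_def)
  then have N: "1 \<in> {1..N}" by (auto simp: induces_connected_def)
  obtain q where q: "search_order {1..N} ET q"
    using search_order_exists[of "{1..N}" ET] \<open>induces_connected ET {1..N}\<close> by auto
  have "\<exists>t\<in>{1..N}. gb_K P i \<subseteq> Q t" if i: "i \<in> {1..gb_m P}" for i
  proof (cases "gb_K P i = {}")
    case False
    define pos where "pos = index_pos (vertex_order Q q)"
    have K: "gb_K P i \<subseteq> {1..gb_n P}" using P i by (simp add: gb_problem_def)
    have "finite (gb_K P i)" using K finite_subset by blast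
    then have "Max (pos ` gb_K P i) \<in> pos ` gb_K P i" using False by (intro Max_in) auto
    then obtain v where "v \<in> gb_K P i" "pos v = Max (pos ` gb_K P i)" by auto
    then have v: "v \<in> gb_K P i" "\<And>u. u \<in> gb_K P i \<Longrightarrow> pos u \<le> pos v"
      using \<open>finite (gb_K P i)\<close> by auto
    have good: "good_order {1..N} Q pos" unfolding pos_def by (rule good_order_vertex_order[OF td q])
    have both: "\<exists>t\<in>{1..N}. u \<in> Q t \<and> v \<in> Q t" if "u \<in> gb_K P i" for u
    proof (cases "u = v")
      case True
      have "v \<in> ig_vertices P" using v(1) K by (auto simp: ig_vertices_def)
      then show ?thesis using True td unfolding tree_decomposition_def induces_connected_def by blast
    next
      case False
      then have "{u, v} \<in> ig_edges P" using that v(1) i unfolding ig_edges_def by blast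
      then obtain t where "t \<in> {1..N}" "{u, v} \<subseteq> Q t" using td unfolding tree_decomposition_def by blast
      then show ?thesis by blast
    qed
    then have "v \<in> \<Union>(Q ` {1..N})" using v(1) by blast
    then obtain T where "T \<in> {1..N}" "\<forall>t\<in>{1..N}. \<forall>u\<in>Q t. v \<in> Q t \<longrightarrow> pos u \<le> pos v \<longrightarrow> u \<in> Q T"
      using good unfolding good_order_def by blast
    then show ?thesis using both v(2) by blast
  qed (use N in blast)
  then have "{1..gb_m P} \<subseteq> (\<Union>t\<in>{1..N}. {i \<in> {1..gb_m P}. gb_K P i \<subseteq> Q t})" by blast
  then have "card {1..gb_m P} \<le> card (\<Union>t\<in>{1..N}. {i \<in> {1..gb_m P}. gb_K P i \<subseteq> Q t})"
    by (intro card_mono) auto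
  also have "\<dots> \<le> S" unfolding S_def by (rule card_UN_le) simp
  finally have "real (gb_m P) \<le> real S" by simp
  then have "x * 2 ^ \<omega> * real (gb_m P) \<le> x * 2 ^ \<omega> * real S" by (intro mult_left_mono) (auto simp: x_def)
  moreover have "x * X * 1 \<le> x * X * real (max 1 (gb_m P))" by (intro mult_left_mono) (auto simp: x_def X_def)
  moreover have "workload1 P {1..N} Q \<omega> = x * 2 ^ \<omega> * real S + x * real (max 1 (gb_m P)) * X"
    by (simp add: workload1_def x_def X_def S_def)
  ultimately have "x * (2 ^ \<omega> * real (gb_m P) + X) \<le> workload1 P {1..N} Q \<omega>"
    by (simp add: algebra_simps)
  then show ?thesis by (simp only: x_def X_def)
qed

lemma workload1_le_workload2:
  "workload1 P {1..N} Q \<omega> \<le> 2 * workload2 P {1..N} \<omega>"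
proof -
  define x where "x = real (max 1 \<omega>)"
  define X where "X = real (max (gb_n P) N)"
  define m where "m = real (gb_m P)"
  have x: "1 \<le> x" "0 \<le> X" "0 \<le> m" by (simp_all add: x_def X_def m_def)
  have "(\<Sum>t\<in>{1..N}. real (card {i \<in> {1..gb_m P}. gb_K P i \<subseteq> Q t})) \<le> (\<Sum>t\<in>{1..N}. m)"
  proof (rule sum_mono)
    fix t
    have "card {i \<in> {1..gb_m P}. gb_K P i \<subseteq> Q t} \<le> card {1..gb_m P}" by (rule card_mono) auto
    then show "real (card {i \<in> {1..gb_m P}. gb_K P i \<subseteq> Q t}) \<le> m" by (simp add: m_def)
  qed
  also have "\<dots> \<le> m * X" using x by (simp add: X_def mult.commute mult_left_mono)
  finally have 1: "x * 2 ^ \<omega> * (\<Sum>t\<in>{1..N}. real (card {i \<in> {1..gb_m P}. gb_K P i \<subseteq> Q t})) \<le> x * 2 ^ \<omega> * (m * X)"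
    using x by (intro mult_left_mono) auto
  have "x * real (max 1 (gb_m P)) * X \<le> x * (m + 1) * X"
    using x by (intro mult_right_mono mult_left_mono) (auto simp: m_def)
  also have "\<dots> = 1 * (x * (m * X)) + 1 * (x * X)" by (simp add: algebra_simps)
  also have "\<dots> \<le> 2 ^ \<omega> * (x * (m * X)) + (x * 2 ^ \<omega>) * (x * X)"
  proof (intro add_mono mult_right_mono)
    show "1 \<le> x * 2 ^ \<omega>" using x(1) mult_mono[of 1 x 1 "2 ^ \<omega>"] by simp
  qed (use x in auto)
  finally have 2: "x * real (max 1 (gb_m P)) * X \<le> 2 ^ \<omega> * (x * (m * X)) + (x * 2 ^ \<omega>) * (x * X)" .
  have "workload1 P {1..N} Q \<omega> = x * 2 ^ \<omega> * (\<Sum>t\<in>{1..N}. real (card {i \<in> {1..gb_m P}. gb_K P i \<subseteq> Q t}))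
      + x * real (max 1 (gb_m P)) * X"
    by (simp add: workload1_def x_def X_def)
  moreover have "workload2 P {1..N} \<omega> = x * 2 ^ \<omega> * (m * X) + (x * 2 ^ \<omega>) * (x * X)"
    by (simp add: workload2_def x_def X_def m_def power2_eq_square ac_simps)
  moreover have "0 \<le> (x * 2 ^ \<omega>) * (x * X)" using x by simp
  ultimately show ?thesis using 1 2 by (simp add: ac_simps)
qed

lemma step_bound:
  assumes t: "t \<le> (2 ^ Suc \<omega> * m + n + N + 1) * (194 * Suc \<omega> + 800)" and n: "1 \<le> (n :: nat)"
  shows "real t \<le> 4000 * (real (max 1 \<omega>) * (2 ^ \<omega> * real m + real (max n N)))"
proof -
  define x where "x = max 1 \<omega>"
  define y where "y = 2 ^ \<omega> * m + max n N"
  have "2 ^ Suc \<omega> * m + n + N + 1 \<le> 3 * y" using n by (simp add: y_def)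
  moreover have "194 * Suc \<omega> + 800 \<le> 1188 * x" by (simp add: x_def)
  ultimately have "(2 ^ Suc \<omega> * m + n + N + 1) * (194 * Suc \<omega> + 800) \<le> (3 * y) * (1188 * x)" by (rule mult_le_mono)
  also have "\<dots> \<le> 4000 * (x * y)" by simp
  finally have "real t \<le> real (4000 * (x * y))" using t by (simp only: of_nat_le_iff)
  then show ?thesis by (simp add: x_def y_def)
qed

theorem theorem9:
  shows
    "(\<exists>C :: real. \<forall>P \<omega>.
        gb_problem P \<and> treewidth (ig_vertices P) (ig_edges P) \<le> \<omega> \<longrightarrow>
        (\<exists>L. exact_formulation P L \<and> lp_size_le L (C * 2 ^ \<omega> * real (gb_n P)) \<and>
             unit_coefficients L))
     \<and>
     (\<exists>(p :: prog) (C :: real) (k :: nat). \<forall>P \<omega> N ET Q xs.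
        gb_problem P \<and>
        tree_decomposition (ig_vertices P) (ig_edges P) {1..N} ET Q \<and> td_width {1..N} Q \<le> \<omega> \<and>
        input_encoding P N ET Q xs \<longrightarrow>
        (\<exists>L t q s.
           exact_formulation P L \<and> lp_size_le L (C * 2 ^ \<omega> * real (gb_n P)) \<and>
           unit_coefficients L \<and>
           exec (gb_oracle P) p (initial_state xs) t q s \<and> lp_encoding L (outp s) \<and>
           q \<le> 2 ^ (\<omega> + 1) * gb_m P \<and>
           real t \<le> C * log_factor P ^ k * workload1 P {1..N} Q \<omega>) \<and>
        workload1 P {1..N} Q \<omega> \<le> C * log_factor P ^ k * workload2 P {1..N} \<omega>)"
proof (rule conjI)
  show "\<exists>C :: real. \<forall>P \<omega>.
        gb_problem P \<and> treewidth (ig_vertices P) (ig_edges P) \<le> \<omega> \<longrightarrow>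
        (\<exists>L. exact_formulation P L \<and> lp_size_le L (C * 2 ^ \<omega> * real (gb_n P)) \<and>
             unit_coefficients L)"
    using formulation_exists by blast
  show "\<exists>(p :: prog) (C :: real) (k :: nat). \<forall>P \<omega> N ET Q xs.
        gb_problem P \<and>
        tree_decomposition (ig_vertices P) (ig_edges P) {1..N} ET Q \<and> td_width {1..N} Q \<le> \<omega> \<and>
        input_encoding P N ET Q xs \<longrightarrow>
        (\<exists>L t q s.
           exact_formulation P L \<and> lp_size_le L (C * 2 ^ \<omega> * real (gb_n P)) \<and>
           unit_coefficients L \<and>
           exec (gb_oracle P) p (initial_state xs) t q s \<and> lp_encoding L (outp s) \<and>
           q \<le> 2 ^ (\<omega> + 1) * gb_m P \<and>
           real t \<le> C * log_factor P ^ k * workload1 P {1..N} Q \<omega>) \<and>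
        workload1 P {1..N} Q \<omega> \<le> C * log_factor P ^ k * workload2 P {1..N} \<omega>"
  proof (rule exI[of _ construct], rule exI[of _ 4000], rule exI[of _ 0], intro allI impI conjI)
    fix P \<omega> N ET Q xs
    assume "gb_problem P \<and>
        tree_decomposition (ig_vertices P) (ig_edges P) {1..N} ET Q \<and> td_width {1..N} Q \<le> \<omega> \<and>
        input_encoding P N ET Q xs"
    then have P: "gb_problem P" and td: "tree_decomposition (ig_vertices P) (ig_edges P) {1..N} ET Q"
      and wd: "td_width {1..N} Q \<le> \<omega>" and inp: "input_encoding P N ET Q xs" by simp_all
    have n: "1 \<le> gb_n P" using P by (simp add: gb_problem_def)
    obtain t q s L where e: "exec (gb_oracle P) construct (initial_state xs) t q s"
      and q: "q \<le> gb_m P * 2 ^ Suc \<omega>"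
      and t: "t \<le> (2 ^ Suc \<omega> * gb_m P + gb_n P + N + 1) * (194 * Suc \<omega> + 800)"
      and L: "exact_formulation P L" "lp_size_le L (6 * 2 ^ \<omega> * real (gb_n P))" "unit_coefficients L"
        "lp_encoding L (outp s)"
      using construct_wp[OF P td wd inp] unfolding wp_def by auto
    have "6 * 2 ^ \<omega> * real (gb_n P) \<le> 4000 * 2 ^ \<omega> * real (gb_n P)" by (intro mult_right_mono) auto
    then have size: "lp_size_le L (4000 * 2 ^ \<omega> * real (gb_n P))"
      using L(2) unfolding lp_size_le_def by linarith
    have time: "real t \<le> 4000 * workload1 P {1..N} Q \<omega>"
      using step_bound[OF t n] workload1_ge[OF P td wd] by linarith
    have queries: "q \<le> 2 ^ (\<omega> + 1) * gb_m P" using q by (simp add: mult.commute)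
    show "\<exists>L t q s.
           exact_formulation P L \<and> lp_size_le L (4000 * 2 ^ \<omega> * real (gb_n P)) \<and>
           unit_coefficients L \<and>
           exec (gb_oracle P) construct (initial_state xs) t q s \<and> lp_encoding L (outp s) \<and>
           q \<le> 2 ^ (\<omega> + 1) * gb_m P \<and>
           real t \<le> 4000 * log_factor P ^ 0 * workload1 P {1..N} Q \<omega>"
      using e L size time queries by (intro exI[of _ L] exI[of _ t] exI[of _ q] exI[of _ s]) simp
    have "0 \<le> workload2 P {1..N} \<omega>" by (simp add: workload2_def)
    then show "workload1 P {1..N} Q \<omega> \<le> 4000 * log_factor P ^ 0 * workload2 P {1..N} \<omega>"
      using workload1_le_workload2[of P N Q \<omega>] by simp
  qed
qed

end
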